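(* Fix $\gamma>1$, $\underline{\rho}>0$, $L>0$, $T_*>0$, $\beta_*<0$ and real constants $\kappa_1,\kappa_2$ with $|\kappa_1|<1$, $|\kappa_2|<1$, and let $\epsilon_1,C_E>0$ be constants with the existence property (P) described in the context. There exist a (small) constant $\epsilon_2\in(0,\epsilon_1)$ and constants $C_S>0$, $\xi\in(0,1)$ such that the following holds for every $\epsilon\in(0,\epsilon_2)$ and every $C^2$ function $\beta:D\to\mathbb{R}$ satisfying $$\beta_*\le\beta\le0,\qquad |\partial_t\beta|,|\partial_x\beta|\le\epsilon,\qquad \beta(t+T_*,x)=\beta(t,x)\qquad\text{on }D .$$ Let $\phi_{1_b},\phi_{2_b}:\mathbb{R}_+\to\mathbb{R}$ be $C^1$ functions with $\phi_{i_b}(t+T_* )=\phi_{i_b}(t)$ $(t>0)$ and $\|\phi_{i_b}\|_{C^1(\mathbb{R}_+)}\le\epsilon$, $i=1,2$, and let $\phi_0:[0,L]\to\mathbb{R}^2$ be a $C^1$ function with $\|\phi_0\|_{C^1([0,L])}\le C_E\epsilon$ such that the compatibility conditions (C) in the context hold. Then the initial-boundary value problem $$\partial_t\phi_i+\lambda_i(\phi+\Phi)\,\partial_x\phi_i=\tfrac{\beta}{2}(\phi_1+\phi_2)\ \text{ on } D,\quad i=1,2,$$ $$\phi(0,x)=\phi_0(x),\qquad \phi_2(t,0)=\phi_{2_b}(t)+\kappa_2\phi_1(t,0),\qquad \phi_1(t,L)=\phi_{1_b}(t)+\kappa_1\phi_2(t,L)\quad(x\in[0,L],\ t\ge0)$$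 has a unique global $C^1$ classical solution $\phi=\phi(t,x)$ on $D$, and it satisfies $$\|\phi(t,\cdot)-\phi^{(T_* )}(t,\cdot)\|_{C^0}\le C_S\,\epsilon\,\xi^{[t/T_0]},\qquad \forall t\ge0,$$ where $\phi^{(T_* )}$ is the time-periodic solution, corresponding to $\beta,\phi_{1_b},\phi_{2_b}$, provided by (P), and $T_0=\max_{i=1,2}\sup_{\phi\in\Psi}\frac{L}{|\lambda_i(\phi+\Phi)|}$.
   Context: $\mathbb{R}_+=[0,\infty)$, $D=\{(t,x): t\in\mathbb{R}_+,\ x\in[0,L]\}$, $[s]$ is the integer part of $s$. For $(m,n)\in\mathbb{R}^2$, $$\lambda_1(m,n)=\tfrac{\gamma+1}{2}m+\tfrac{3-\gamma}{2}n,\qquad \lambda_2(m,n)=\tfrac{3-\gamma}{2}m+\tfrac{\gamma+1}{2}n .$$ $\Phi=(\underline m,\underline n)^\top$ with $-\underline m=\underline n=\frac{\sqrt\gamma}{\gamma-1}\underline\rho^{\frac{\gamma-1}{2}}$, so $\lambda_1(\Phi)<0<\lambda_2(\Phi)$. $\Psi$ is a fixed small neighborhood of $0\in\mathbb{R}^2$ on which $\lambda_1(\phi+\Phi)<0<\lambda_2(\phi+\Phi)$ and $\max_{i}\sup_{\phi\in\Psi}|\lambda_i(\phi+\Phi)|^{-1}<\infty$. Norms ($C^0$, $C^1$) of a (vector) function are maxima over components of sup norms of the component (and, for $C^1$, of its first-order partial derivatives). (P) Existence property: for every $0<\epsilon<\epsilon_1$, every $C^2$ function $\beta$ on $D$ with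 $\beta_*\le\beta\le0$, $|\partial_t\beta|,|\partial_x\beta|\le\epsilon$, $\beta(t+T_*,x)=\beta(t,x)$, and all $C^1$ functions $\phi_{i_b}$ $(i=1,2)$ on $\mathbb{R}_+$ that are $T_*$-periodic with $\|\phi_{i_b}\|_{C^1}\le\epsilon$, there is a $C^1$ function $\phi^{(T_* )}:D\to\mathbb{R}^2$ which solves $\partial_t\phi_i+\lambda_i(\phi+\Phi)\partial_x\phi_i=\frac\beta2(\phi_1+\phi_2)$ $(i=1,2)$ on $D$ with $\phi_2(t,0)=\phi_{2_b}(t)+\kappa_2\phi_1(t,0)$, $\phi_1(t,L)=\phi_{1_b}(t)+\kappa_1\phi_2(t,L)$ for $t\ge0$, and satisfies $\phi^{(T_* )}(t+T_*,x)=\phi^{(T_* )}(t,x)$ on $D$ and $\|\phi^{(T_* )}\|_{C^1(D)}\le C_E\epsilon$. (Such constants $\epsilon_1,C_E$ exist.) "The time-periodic solution provided by (P)" means a function $\phi^{(T_* )}$ with these properties. (C) Compatibility conditions: write $\phi_0=(\phi_{1_0},\phi_{2_0})^\top$ and $q_i(x)=-\lambda_i(\phi_0(x)+\Phi)\phi_{i_0}'(x)+\frac{\beta(0,x)}{2}(\phi_{1_0}(x)+\phi_{2_0}(x))$, $i=1,2$. Then $$\phi_{2_0}(0)=\phi_{2_b}(0)+\kappa_2\phi_{1_0}(0),\quad q_2(0)=\phi_{2_b}'(0)+\kappa_2q_1(0),$$ $$\phi_{1_0}(L)=\phi_{1_b}(0)+\kappa_1\phi_{2_0}(L),\quad q_1(L)=\phi_{1_b}'(0)+\kappa_1q_2(L).$$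 *)

theory Defs
  imports "HOL-Analysis.Analysis"
begin

text \<open>
  Space-time functions are total functions on pairs \<open>(t, x)\<close>; only their values on the closed
  set \<open>dom_D L\<close> matter. All derivatives are relative to the closed domain, hence one-sided
  on its boundary.
\<close>

definition dom_D :: "real \<Rightarrow> (real \<times> real) set" where
  "dom_D L = {0..} \<times> {0..L}"

definition partial_t :: "(real \<times> real \<Rightarrow> 'a::real_normed_vector) \<Rightarrow> real \<times> real \<Rightarrow> 'a" where
  "partial_t f = (\<lambda>(t, x). vector_derivative (\<lambda>s. f (s, x)) (at t within {0..}))"

definition partial_x ::
    "real \<Rightarrow> (real \<times> real \<Rightarrow> 'a::real_normed_vector) \<Rightarrow> real \<times> real \<Rightarrow> 'a" where
  "partial_x L f = (\<lambda>(t, x). vector_derivative (\<lambda>y. f (t, y)) (at x within {0..L}))"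

text \<open>
  \<open>C1_differentiable_on\<close> from the library demands two-sided derivatives at end points, so it
  is not the class of continuously differentiable functions on a closed interval.
\<close>

definition C1_on :: "real set \<Rightarrow> (real \<Rightarrow> 'a::real_normed_vector) \<Rightarrow> bool" where
  "C1_on I f \<longleftrightarrow>
     (\<forall>x\<in>I. f differentiable (at x within I)) \<and>
     continuous_on I (\<lambda>x. vector_derivative f (at x within I))"

definition C1_D :: "real \<Rightarrow> (real \<times> real \<Rightarrow> 'a::real_normed_vector) \<Rightarrow> bool" where
  "C1_D L f \<longleftrightarrow>
     (\<forall>(t, x)\<in>dom_D L. (\<lambda>s. f (s, x)) differentiable (at t within {0..}) \<and>
                      (\<lambda>y. f (t, y)) differentiable (at x within {0..L})) \<and>
     continuous_on (dom_D L) f \<and>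
     continuous_on (dom_D L) (partial_t f) \<and>
     continuous_on (dom_D L) (partial_x L f)"

definition C2_D :: "real \<Rightarrow> (real \<times> real \<Rightarrow> 'a::real_normed_vector) \<Rightarrow> bool" where
  "C2_D L f \<longleftrightarrow> C1_D L f \<and> C1_D L (partial_t f) \<and> C1_D L (partial_x L f)"

text \<open>Norms are extended-real valued, so that a norm bound entails boundedness.\<close>

definition sup_norm :: "'b set \<Rightarrow> ('b \<Rightarrow> real) \<Rightarrow> ereal" where
  "sup_norm S f = (SUP p\<in>S. ereal \<bar>f p\<bar>)"

definition C0_norm_vec :: "'b set \<Rightarrow> ('b \<Rightarrow> real^2) \<Rightarrow> ereal" where
  "C0_norm_vec S f = (MAX i\<in>UNIV. sup_norm S (\<lambda>p. f p $ i))"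

definition C1_norm :: "real set \<Rightarrow> (real \<Rightarrow> real) \<Rightarrow> ereal" where
  "C1_norm I f = max (sup_norm I f) (sup_norm I (\<lambda>x. vector_derivative f (at x within I)))"

definition C1_norm_vec :: "real set \<Rightarrow> (real \<Rightarrow> real^2) \<Rightarrow> ereal" where
  "C1_norm_vec I f = (MAX i\<in>UNIV. C1_norm I (\<lambda>x. f x $ i))"

definition C1_norm_D :: "real \<Rightarrow> (real \<times> real \<Rightarrow> real^2) \<Rightarrow> ereal" where
  "C1_norm_D L f =
     (MAX i\<in>UNIV. max (sup_norm (dom_D L) (\<lambda>p. f p $ i))
                     (max (sup_norm (dom_D L) (partial_t (\<lambda>p. f p $ i)))
                          (sup_norm (dom_D L) (partial_x L (\<lambda>p. f p $ i)))))"

definition char_speed :: "real \<Rightarrow> 2 \<Rightarrow> real^2 \<Rightarrow> real" where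
  "char_speed \<gamma> i v =
     (if i = 1 then (\<gamma> + 1) / 2 * v $ 1 + (3 - \<gamma>) / 2 * v $ 2
      else (3 - \<gamma>) / 2 * v $ 1 + (\<gamma> + 1) / 2 * v $ 2)"

definition bg_state :: "real \<Rightarrow> real \<Rightarrow> real^2" where
  "bg_state \<gamma> \<rho> =
     (let n = sqrt \<gamma> / (\<gamma> - 1) * \<rho> powr ((\<gamma> - 1) / 2) in vector [- n, n])"

definition admissible_nbhd :: "real \<Rightarrow> real \<Rightarrow> (real^2) set \<Rightarrow> bool" where
  "admissible_nbhd \<gamma> \<rho> \<Psi> \<longleftrightarrow>
     0 \<in> interior \<Psi> \<and>
     (\<forall>v\<in>\<Psi>. char_speed \<gamma> 1 (v + bg_state \<gamma> \<rho>) < 0 \<and> 0 < char_speed \<gamma> 2 (v + bg_state \<gamma> \<rho>)) \<and>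
     (\<forall>i. bdd_above ((\<lambda>v. 1 / \<bar>char_speed \<gamma> i (v + bg_state \<gamma> \<rho>)\<bar>) ` \<Psi>))"

definition travel_time :: "real \<Rightarrow> real \<Rightarrow> real \<Rightarrow> (real^2) set \<Rightarrow> real" where
  "travel_time \<gamma> \<rho> L \<Psi> =
     (MAX i\<in>UNIV. SUP v\<in>\<Psi>. L / \<bar>char_speed \<gamma> i (v + bg_state \<gamma> \<rho>)\<bar>)"

definition admissible_damping ::
    "real \<Rightarrow> real \<Rightarrow> real \<Rightarrow> real \<Rightarrow> (real \<times> real \<Rightarrow> real) \<Rightarrow> bool" where
  "admissible_damping L T \<beta>s \<epsilon> \<beta> \<longleftrightarrow>
     C2_D L \<beta> \<and>
     (\<forall>(t, x)\<in>dom_D L.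
        \<beta>s \<le> \<beta> (t, x) \<and> \<beta> (t, x) \<le> 0 \<and>
        \<bar>partial_t \<beta> (t, x)\<bar> \<le> \<epsilon> \<and> \<bar>partial_x L \<beta> (t, x)\<bar> \<le> \<epsilon> \<and>
        \<beta> (t + T, x) = \<beta> (t, x))"

definition bvp_solution ::
    "real \<Rightarrow> real \<Rightarrow> real \<Rightarrow> real \<Rightarrow> real \<Rightarrow> (real \<times> real \<Rightarrow> real) \<Rightarrow> (real \<Rightarrow> real) \<Rightarrow> (real \<Rightarrow> real)
      \<Rightarrow> (real \<times> real \<Rightarrow> real^2) \<Rightarrow> bool" where
  "bvp_solution \<gamma> \<rho> L \<kappa>1 \<kappa>2 \<beta> \<phi>1b \<phi>2b \<phi> \<longleftrightarrow>
     C1_D L \<phi> \<and>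
     (\<forall>(t, x)\<in>dom_D L. \<forall>i.
        partial_t \<phi> (t, x) $ i
          + char_speed \<gamma> i (\<phi> (t, x) + bg_state \<gamma> \<rho>) * partial_x L \<phi> (t, x) $ i
        = \<beta> (t, x) / 2 * (\<phi> (t, x) $ 1 + \<phi> (t, x) $ 2)) \<and>
     (\<forall>t\<ge>0. \<phi> (t, 0) $ 2 = \<phi>2b t + \<kappa>2 * \<phi> (t, 0) $ 1 \<and>
            \<phi> (t, L) $ 1 = \<phi>1b t + \<kappa>1 * \<phi> (t, L) $ 2)"

definition ibvp_solution ::
    "real \<Rightarrow> real \<Rightarrow> real \<Rightarrow> real \<Rightarrow> real \<Rightarrow> (real \<times> real \<Rightarrow> real) \<Rightarrow> (real \<Rightarrow> real) \<Rightarrow> (real \<Rightarrow> real)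
      \<Rightarrow> (real \<Rightarrow> real^2) \<Rightarrow> (real \<times> real \<Rightarrow> real^2) \<Rightarrow> bool" where
  "ibvp_solution \<gamma> \<rho> L \<kappa>1 \<kappa>2 \<beta> \<phi>1b \<phi>2b \<phi>0 \<phi> \<longleftrightarrow>
     bvp_solution \<gamma> \<rho> L \<kappa>1 \<kappa>2 \<beta> \<phi>1b \<phi>2b \<phi> \<and> (\<forall>x\<in>{0..L}. \<phi> (0, x) = \<phi>0 x)"

definition periodic_solution ::
    "real \<Rightarrow> real \<Rightarrow> real \<Rightarrow> real \<Rightarrow> real \<Rightarrow> real \<Rightarrow> real \<Rightarrow> real
      \<Rightarrow> (real \<times> real \<Rightarrow> real) \<Rightarrow> (real \<Rightarrow> real) \<Rightarrow> (real \<Rightarrow> real) \<Rightarrow> (real \<times> real \<Rightarrow> real^2) \<Rightarrow> bool"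
  where
  "periodic_solution \<gamma> \<rho> L T \<kappa>1 \<kappa>2 C\<^sub>E \<epsilon> \<beta> \<phi>1b \<phi>2b \<phi> \<longleftrightarrow>
     bvp_solution \<gamma> \<rho> L \<kappa>1 \<kappa>2 \<beta> \<phi>1b \<phi>2b \<phi> \<and>
     (\<forall>(t, x)\<in>dom_D L. \<phi> (t + T, x) = \<phi> (t, x)) \<and>
     C1_norm_D L \<phi> \<le> ereal (C\<^sub>E * \<epsilon>)"

definition periodic_existence ::
    "real \<Rightarrow> real \<Rightarrow> real \<Rightarrow> real \<Rightarrow> real \<Rightarrow> real \<Rightarrow> real \<Rightarrow> real \<Rightarrow> real \<Rightarrow> bool" where
  "periodic_existence \<gamma> \<rho> L T \<beta>s \<kappa>1 \<kappa>2 \<epsilon>1 C\<^sub>E \<longleftrightarrow>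
     (\<forall>\<epsilon> \<beta> \<phi>1b \<phi>2b.
        0 < \<epsilon> \<and> \<epsilon> < \<epsilon>1 \<and>
        admissible_damping L T \<beta>s \<epsilon> \<beta> \<and>
        C1_on {0..} \<phi>1b \<and> (\<forall>t\<ge>0. \<phi>1b (t + T) = \<phi>1b t) \<and> C1_norm {0..} \<phi>1b \<le> ereal \<epsilon> \<and>
        C1_on {0..} \<phi>2b \<and> (\<forall>t\<ge>0. \<phi>2b (t + T) = \<phi>2b t) \<and> C1_norm {0..} \<phi>2b \<le> ereal \<epsilon>
        \<longrightarrow> (\<exists>\<phi>. periodic_solution \<gamma> \<rho> L T \<kappa>1 \<kappa>2 C\<^sub>E \<epsilon> \<beta> \<phi>1b \<phi>2b \<phi>))"

text \<open>The value of \<open>\<partial>\<^sub>t \<phi>\<^sub>i (0, x)\<close> forced by the equation and the initial datum.\<close>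

definition init_rate ::
    "real \<Rightarrow> real \<Rightarrow> real \<Rightarrow> (real \<times> real \<Rightarrow> real) \<Rightarrow> (real \<Rightarrow> real^2) \<Rightarrow> 2 \<Rightarrow> real \<Rightarrow> real" where
  "init_rate \<gamma> \<rho> L \<beta> \<phi>0 i x =
     - char_speed \<gamma> i (\<phi>0 x + bg_state \<gamma> \<rho>) * vector_derivative (\<lambda>y. \<phi>0 y $ i) (at x within {0..L})
     + \<beta> (0, x) / 2 * (\<phi>0 x $ 1 + \<phi>0 x $ 2)"

definition compatible ::
    "real \<Rightarrow> real \<Rightarrow> real \<Rightarrow> real \<Rightarrow> real \<Rightarrow> (real \<times> real \<Rightarrow> real) \<Rightarrow> (real \<Rightarrow> real) \<Rightarrow> (real \<Rightarrow> real)
      \<Rightarrow> (real \<Rightarrow> real^2) \<Rightarrow> bool" where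
  "compatible \<gamma> \<rho> L \<kappa>1 \<kappa>2 \<beta> \<phi>1b \<phi>2b \<phi>0 \<longleftrightarrow>
     (let q = init_rate \<gamma> \<rho> L \<beta> \<phi>0 in
        \<phi>0 0 $ 2 = \<phi>2b 0 + \<kappa>2 * \<phi>0 0 $ 1 \<and>
        q 2 0 = vector_derivative \<phi>2b (at 0 within {0..}) + \<kappa>2 * q 1 0 \<and>
        \<phi>0 L $ 1 = \<phi>1b 0 + \<kappa>1 * \<phi>0 L $ 2 \<and>
        q 1 L = vector_derivative \<phi>1b (at 0 within {0..}) + \<kappa>1 * q 2 L)"

end

theory Submission imports Defs begin

text \<open>
  \<^bold>\<open>Existence.\<close> The speeds never vanish, so \<open>x\<close> can serve as evolution variable: read from its own
  inflow end, each Riemann invariant \<open>f\<close> solves \<open>f\<^sub>x + a f\<^sub>t = - a b (f + f')\<close> with \<open>a > 0\<close> the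
  reciprocal speed, \<open>b = - \<beta> / 2\<close> and \<open>f'\<close> the other invariant. Add \<open>\<Gamma> f\<close> on both sides, with
  \<open>\<Gamma> \<ge> a b\<close>, freeze \<open>a\<close> and the right-hand side at the previous iterate, and integrate along
  characteristics. As \<open>0 \<le> a b \<le> \<Gamma>\<close> and the reflection coefficients are at most \<open>\<kappa> < 1\<close>, this
  iteration is, up to an error of the size of the data, a contraction of the sup norm over all
  times with factor \<open>1 - (1 - \<kappa>) exp (- \<Gamma> L)\<close>, and it preserves smallness of \<open>f\<close> and of \<open>f\<^sub>t\<close>.
  That the limit is \<open>C\<^sup>1\<close> is a fibre contraction argument: the time derivatives of the iterates are
  driven by maps which contract uniformly in the derivative and depend continuously on the iterate.

  \<^bold>\<open>Uniqueness and decay.\<close> Both follow from one maximum principle for the difference of two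
  solutions, with the weight \<open>1 - (1 - \<kappa>') exp (- m x)\<close>, \<open>\<kappa> \<le> \<kappa>' < 1\<close>, in the inflow coordinate: it
  leaves a margin which absorbs the small slope of the reference solution and an exponential rate.
\<close>

section \<open>Analytic preliminaries\<close>

text \<open>With \<open>x\<close> as evolution variable the line \<open>t = 0\<close> is a lateral
  boundary, and characteristics crossing it would have no inflow datum. The problem is therefore
  posed for all real times: every iterate is frozen at its initial value for
  \<open>t \<le> 0\<close>. Frozen data violate the equation there by a known defect; a correction
  of the boundary datum at negative labels cancels the accumulated defect exactly where the
  characteristic reaches \<open>t = 0\<close>. The price is a kink at \<open>t = 0\<close>. Each
  characteristic meets that line at most once, so integrals do not see the kink, and first-order
  compatibility removes it from the boundary datum.

  In the sup norm the same displacement costs only time Lipschitz constants, which are of the size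
  \<open>M\<close> of the iterates. No estimate depends on the length of the time interval, so the
  solution is global at once, without a continuation argument.\<close>

lemma contraction_iterates_converge:
  fixes T :: "('i \<Rightarrow> 'a \<Rightarrow> real) \<Rightarrow> 'i \<Rightarrow> 'a \<Rightarrow> real"
  assumes inv: "\<And>f. P f \<Longrightarrow> P (T f)" and P0: "P f0" and \<theta>: "0 \<le> \<theta>" "\<theta> < 1"
    and contr: "\<And>f g d i z. P f \<Longrightarrow> P g \<Longrightarrow> (\<And>i z. \<bar>f i z - g i z\<bar> \<le> d) \<Longrightarrow> \<bar>T f i z - T g i z\<bar> \<le> \<theta> * d"
    and bdd: "\<And>i z. \<bar>T f0 i z - f0 i z\<bar> \<le> D"
  obtains F where "\<And>n i z. \<bar>(T ^^ n) f0 i z - F i z\<bar> \<le> \<theta> ^ n * (D / (1 - \<theta>))"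
proof -
  define u where "u n = (T ^^ n) f0" for n
  have Pu: "P (u n)" for n by (induction n) (auto simp: u_def P0 inv)
  have step: "\<bar>u (Suc n) i z - u n i z\<bar> \<le> \<theta> ^ n * D" for n i z
  proof (induction n arbitrary: i z)
    case 0 show ?case using bdd by (simp add: u_def)
  next
    case (Suc n)
    have "\<bar>T (u (Suc n)) i z - T (u n) i z\<bar> \<le> \<theta> * (\<theta> ^ n * D)"
      by (intro contr Pu Suc)
    then show ?case by (simp add: u_def mult.assoc)
  qed
  have D: "0 \<le> D" using bdd[of undefined undefined] by linarith
  \<comment> \<open>The geometric sum is kept in closed form; the weaker bound without
    \<open>1 - \<theta> ^ k\<close> would not survive the induction.\<close>
  have far: "\<bar>u (n + k) i z - u n i z\<bar> \<le> \<theta> ^ n * (D / (1 - \<theta>)) * (1 - \<theta> ^ k)" for n k i z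
  proof (induction k)
    case 0 show ?case by simp
  next
    case (Suc k)
    have "\<bar>u (n + Suc k) i z - u n i z\<bar> \<le> \<bar>u (Suc (n + k)) i z - u (n + k) i z\<bar> + \<bar>u (n + k) i z - u n i z\<bar>"
      by simp
    also have "\<dots> \<le> \<theta> ^ (n + k) * D + \<theta> ^ n * (D / (1 - \<theta>)) * (1 - \<theta> ^ k)"
      using step Suc by (intro add_mono) auto
    also have "\<dots> = \<theta> ^ n * (D / (1 - \<theta>)) * (1 - \<theta> ^ Suc k)"
      using \<theta> by (simp add: power_add field_simps)
    finally show ?case .
  qed
  have far': "\<bar>u (n + k) i z - u n i z\<bar> \<le> \<theta> ^ n * (D / (1 - \<theta>))" for n k i z
  proof -
    have "\<theta> ^ n * (D / (1 - \<theta>)) * (1 - \<theta> ^ k) \<le> \<theta> ^ n * (D / (1 - \<theta>)) * 1"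
      using \<theta> D by (intro mult_left_mono) auto
    with far[of n k i z] show ?thesis by linarith
  qed
  have e0: "(\<lambda>n. \<theta> ^ n * (D / (1 - \<theta>))) \<longlonglongrightarrow> 0"
    using \<theta> by (intro tendsto_mult_left_zero LIMSEQ_power_zero) auto
  have conv: "convergent (\<lambda>n. u n i z)" for i z
  proof (rule real_Cauchy_convergent, rule metric_CauchyI)
    fix e :: real assume "e > 0"
    then obtain N where N: "\<And>n. n \<ge> N \<Longrightarrow> \<theta> ^ n * (D / (1 - \<theta>)) < e / 2"
      using order_tendstoD(2)[OF e0, of "e/2"] by (auto simp: eventually_sequentially)
    have *: "\<bar>u m i z - u N i z\<bar> < e / 2" if "m \<ge> N" for m
    proof -
      have "\<bar>u (N + (m - N)) i z - u N i z\<bar> < e / 2"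
        using far'[of N "m - N" i z] N[OF order_refl] by linarith
      then show ?thesis using that by simp
    qed
    show "\<exists>M. \<forall>m\<ge>M. \<forall>n\<ge>M. dist (u m i z) (u n i z) < e"
    proof (intro exI allI impI)
      fix m n assume "N \<le> m" "N \<le> n"
      then show "dist (u m i z) (u n i z) < e"
        using *[of m] *[of n] unfolding dist_real_def by linarith
    qed
  qed
  have "\<bar>(T ^^ n) f0 i z - lim (\<lambda>n. u n i z)\<bar> \<le> \<theta> ^ n * (D / (1 - \<theta>))" for n i z
  proof -
    have "(\<lambda>k. \<bar>u n i z - u (k + n) i z\<bar>) \<longlonglongrightarrow> \<bar>u n i z - lim (\<lambda>n. u n i z)\<bar>"
      using conv by (intro tendsto_intros LIMSEQ_ignore_initial_segment) (simp add: convergent_LIMSEQ_iff)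
    then have "\<bar>u n i z - lim (\<lambda>n. u n i z)\<bar> \<le> \<theta> ^ n * (D / (1 - \<theta>))"
    proof (rule LIMSEQ_le_const2, intro exI[of _ 0] allI impI)
      fix k show "\<bar>u n i z - u (k + n) i z\<bar> \<le> \<theta> ^ n * (D / (1 - \<theta>))"
        using far'[of n k i z] unfolding abs_minus_commute[of "u n i z"] add.commute[of k n] .
    qed
    then show ?thesis by (simp add: u_def)
  qed
  then show thesis by (rule that[of "\<lambda>i z. lim (\<lambda>n. u n i z)"])
qed

text \<open>Two predicates, because the class kept by the iteration (functions with a continuous
  time rate) is not closed under uniform limits: \<open>P\<close> is invariant, \<open>Q\<close> is
  a larger class which receives the limit and on which \<open>T\<close> still contracts. The
  functions may be unbounded; only the first step has to be bounded. The iterates are returned with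
  an error bound so that further properties can be passed to the limit later.\<close>

lemma contraction_fixed_point:
  fixes T :: "('i \<Rightarrow> 'a \<Rightarrow> real) \<Rightarrow> 'i \<Rightarrow> 'a \<Rightarrow> real"
  assumes inv: "\<And>f. P f \<Longrightarrow> P (T f)" and P0: "P f0" and \<theta>: "0 \<le> \<theta>" "\<theta> < 1"
    and PQ: "\<And>f. P f \<Longrightarrow> Q f"
    and closed: "\<And>F u e. (\<And>n. P (u n)) \<Longrightarrow> e \<longlonglongrightarrow> 0 \<Longrightarrow> (\<And>n i z. \<bar>u n i z - F i z\<bar> \<le> e n) \<Longrightarrow> Q F"
    and contr: "\<And>f g d i z. Q f \<Longrightarrow> Q g \<Longrightarrow> (\<And>i z. \<bar>f i z - g i z\<bar> \<le> d) \<Longrightarrow> \<bar>T f i z - T g i z\<bar> \<le> \<theta> * d"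
    and bdd: "\<And>i z. \<bar>T f0 i z - f0 i z\<bar> \<le> D"
  obtains F e where "Q F" "T F = F" "e \<longlonglongrightarrow> 0" "\<And>n i z. \<bar>(T ^^ n) f0 i z - F i z\<bar> \<le> e n"
proof -
  obtain F where F: "\<And>n i z. \<bar>(T ^^ n) f0 i z - F i z\<bar> \<le> \<theta> ^ n * (D / (1 - \<theta>))"
    by (rule contraction_iterates_converge[of P T f0 \<theta> D]) (use inv P0 \<theta> contr PQ bdd in auto)
  define e where "e n = \<theta> ^ n * (D / (1 - \<theta>))" for n
  have e0: "e \<longlonglongrightarrow> 0"
    unfolding e_def using \<theta> by (intro tendsto_mult_left_zero LIMSEQ_power_zero) auto
  have Pu: "P ((T ^^ n) f0)" for n by (induction n) (auto simp: P0 inv)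
  have QF: "Q F" using F by (intro closed[of "\<lambda>n. (T ^^ n) f0" e F] Pu e0) (simp add: e_def)
  have "T F i z = F i z" for i z
  proof -
    have "\<bar>T F i z - F i z\<bar> \<le> \<theta> * e n + e (Suc n)" for n
    proof -
      have "\<bar>T F i z - T ((T ^^ n) f0) i z\<bar> \<le> \<theta> * e n"
        using F by (intro contr QF PQ Pu) (simp add: e_def abs_minus_commute)
      moreover have "\<bar>T ((T ^^ n) f0) i z - F i z\<bar> \<le> e (Suc n)"
        using F[of "Suc n" i z] by (simp add: e_def)
      ultimately show ?thesis by linarith
    qed
    moreover have "(\<lambda>n. \<theta> * e n + e (Suc n)) \<longlonglongrightarrow> \<theta> * 0 + 0"
      by (intro tendsto_intros e0 LIMSEQ_Suc)
    ultimately have "\<bar>T F i z - F i z\<bar> \<le> \<theta> * 0 + 0"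
      by (intro LIMSEQ_le_const) auto
    then show ?thesis by simp
  qed
  then show thesis using that[OF QF _ e0] F by (auto simp: e_def)
qed

section \<open>Limits of sequences, integrals and difference quotients\<close>

lemma tendsto_of_bound:
  fixes u :: "nat \<Rightarrow> real"
  assumes "e \<longlonglongrightarrow> 0" "\<And>n. \<bar>u n - l\<bar> \<le> e n"
  shows "u \<longlonglongrightarrow> l"
proof -
  have "(\<lambda>n. u n - l) \<longlonglongrightarrow> 0" by (rule Lim_null_comparison[OF _ assms(1)]) (use assms(2) in auto)
  then show ?thesis by (simp add: LIM_zero_iff)
qed

text \<open>A substitute for Gronwall's inequality on a short interval: at a maximum point of
  \<open>\<bar>g\<bar>\<close>, with \<open>m\<close> the maximum, a quarter of the maximum is
  absorbed into the left-hand side. The factor 1/4 stems from \<open>4 * (K * L) \<le> 1\<close> in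
  the applications.\<close>

lemma sup_absorb:
  fixes g :: "real \<Rightarrow> real"
  assumes "continuous_on {0..L} g" "0 \<le> L"
    and "\<And>y m. y \<in> {0..L} \<Longrightarrow> (\<And>\<eta>. \<eta> \<in> {0..L} \<Longrightarrow> \<bar>g \<eta>\<bar> \<le> m) \<Longrightarrow> \<bar>g y\<bar> \<le> c + m / 4"
    and "y \<in> {0..L}"
  shows "\<bar>g y\<bar> \<le> 2 * c"
proof -
  have "continuous_on {0..L} (\<lambda>y. \<bar>g y\<bar>)" using assms(1) by (intro continuous_intros)
  then obtain z where z: "z \<in> {0..L}" "\<And>y. y \<in> {0..L} \<Longrightarrow> \<bar>g y\<bar> \<le> \<bar>g z\<bar>"
    using continuous_attains_sup[of "{0..L}" "\<lambda>y. \<bar>g y\<bar>"] assms(2) by auto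
  have "\<bar>g z\<bar> \<le> c + \<bar>g z\<bar> / 4" by (rule assms(3)[OF z])
  then show ?thesis using z(2)[OF assms(4)] by linarith
qed

text \<open>The finite exceptional set is there because time rates jump where a characteristic
  crosses \<open>t = 0\<close>; the integrands are reset to 0 on it before dominated convergence
  applies.\<close>

lemma bounded_convergence:
  fixes g :: "nat \<Rightarrow> real \<Rightarrow> real"
  assumes int: "\<And>n. g n integrable_on {a..b}" and bd: "\<And>n y. y \<in> {a..b} \<Longrightarrow> \<bar>g n y\<bar> \<le> C"
    and fin: "finite N" and lim: "\<And>y. y \<in> {a..b} - N \<Longrightarrow> (\<lambda>n. g n y) \<longlonglongrightarrow> h y"
  shows "h integrable_on {a..b}" "(\<lambda>n. integral {a..b} (g n)) \<longlonglongrightarrow> integral {a..b} h"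
proof -
  define g' where "g' n y = (if y \<in> N then 0 else g n y)" for n y
  define h' where "h' y = (if y \<in> N then 0 else h y)" for y
  have i: "g' n integrable_on {a..b}" for n
    by (rule integrable_spike_finite[OF fin _ int]) (auto simp: g'_def)
  have b: "norm (g' n y) \<le> \<bar>C\<bar>" if "y \<in> {a..b}" for n y
  proof -
    have "\<bar>g n y\<bar> \<le> \<bar>C\<bar>" using bd[OF that, of n] by linarith
    then show ?thesis by (simp add: g'_def)
  qed
  have l: "(\<lambda>n. g' n y) \<longlonglongrightarrow> h' y" if "y \<in> {a..b}" for y
    using lim that by (auto simp: g'_def h'_def)
  have c: "(\<lambda>y. \<bar>C\<bar>) integrable_on {a..b}" by (rule integrable_const_ivl)
  have h': "h' integrable_on {a..b}" and L: "(\<lambda>n. integral {a..b} (g' n)) \<longlonglongrightarrow> integral {a..b} h'"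
    using dominated_convergence[OF i c b l] by auto
  show "h integrable_on {a..b}"
    by (rule integrable_spike_finite[OF fin _ h']) (auto simp: h'_def)
  have "integral {a..b} (g' n) = integral {a..b} (g n)" for n
    by (rule integral_spike[OF negligible_finite[OF fin]]) (auto simp: g'_def)
  moreover have "integral {a..b} h' = integral {a..b} h"
    by (rule integral_spike[OF negligible_finite[OF fin]]) (auto simp: h'_def)
  ultimately show "(\<lambda>n. integral {a..b} (g n)) \<longlonglongrightarrow> integral {a..b} h" using L by simp
qed

text \<open>The moving end point becomes a cut-off of the integrand on a fixed interval. The
  cut-offs converge except possibly at the limit point \<open>x\<close>, which joins the exceptional
  set.\<close>

lemma bounded_convergence_moving:
  fixes g :: "nat \<Rightarrow> real \<Rightarrow> real"
  assumes int: "\<And>n. g n integrable_on {0..L}" and bd: "\<And>n y. y \<in> {0..L} \<Longrightarrow> \<bar>g n y\<bar> \<le> C"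
    and fin: "finite N" and lim: "\<And>y. y \<in> {0..L} - N \<Longrightarrow> (\<lambda>n. g n y) \<longlonglongrightarrow> h y"
    and X: "X \<longlonglongrightarrow> x" "\<And>n. X n \<in> {0..L}"
  shows "(\<lambda>n. integral {0..X n} (g n)) \<longlonglongrightarrow> integral {0..x} h"
proof -
  have x: "x \<in> {0..L}"
    using closed_sequentially[OF closed_atLeastAtMost] X by blast
  define G where "G n y = (if y \<in> {0..X n} then g n y else 0)" for n y
  define H where "H y = (if y \<in> {0..x} then h y else 0)" for y
  have sub: "{0..X n} \<inter> {0..L} = {0..X n}" for n using X(2)[of n] by auto
  have subx: "{0..x} \<inter> {0..L} = {0..x}" using x by auto
  have i: "G n integrable_on {0..L}" for n
    unfolding G_def integrable_restrict_Int sub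
    by (rule integrable_on_subinterval[OF int]) (use X(2) sub in auto)
  have b: "\<bar>G n y\<bar> \<le> \<bar>C\<bar>" if "y \<in> {0..L}" for n y
    using bd[OF that, of n] by (auto simp: G_def)
  have l: "(\<lambda>n. G n y) \<longlonglongrightarrow> H y" if "y \<in> {0..L} - (insert x N)" for y
  proof (cases "y < x")
    case True
    then have ev: "\<forall>\<^sub>F n in sequentially. y < X n" using order_tendstoD(1)[OF X(1)] by auto
    have "\<forall>\<^sub>F n in sequentially. G n y = g n y"
      by (rule eventually_mono[OF ev]) (use that in \<open>auto simp: G_def\<close>)
    moreover have "(\<lambda>n. g n y) \<longlonglongrightarrow> H y" using lim[of y] that True by (auto simp: H_def)
    ultimately show ?thesis by (simp add: tendsto_cong)
  next
    case False
    then have ev: "\<forall>\<^sub>F n in sequentially. X n < y" using order_tendstoD(2)[OF X(1)] that by auto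
    have "\<forall>\<^sub>F n in sequentially. G n y = 0"
      by (rule eventually_mono[OF ev]) (use that in \<open>auto simp: G_def\<close>)
    moreover have "H y = 0" using that False by (auto simp: H_def)
    ultimately show ?thesis by (simp add: tendsto_cong)
  qed
  have "(\<lambda>n. integral {0..L} (G n)) \<longlonglongrightarrow> integral {0..L} H"
    by (rule bounded_convergence(2)[where N = "insert x N", OF i b _ l]) (use fin in simp_all)
  then show ?thesis
    unfolding G_def H_def integral_restrict_Int sub subx .
qed

lemma DERIV_sequentially:
  fixes f :: "real \<Rightarrow> real"
  shows "(f has_real_derivative D) (at x) \<longleftrightarrow>
    (\<forall>u. (\<forall>n. u n \<noteq> 0) \<longrightarrow> u \<longlonglongrightarrow> 0 \<longrightarrow> (\<lambda>n. (f (x + u n) - f x) / u n) \<longlonglongrightarrow> D)"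
  unfolding DERIV_def tendsto_at_iff_sequentially by (auto simp: o_def)

lemma DERIV_sequence:
  fixes f :: "real \<Rightarrow> real"
  assumes "(f has_real_derivative D) (at x)" "u \<longlonglongrightarrow> x" "\<And>n. u n \<noteq> x"
  shows "(\<lambda>n. (f (u n) - f x) / (u n - x)) \<longlonglongrightarrow> D"
proof -
  have "(\<lambda>n. (f (x + (u n - x)) - f x) / (u n - x)) \<longlonglongrightarrow> D"
    using assms(1)[unfolded DERIV_sequentially, rule_format, of "\<lambda>n. u n - x"] assms(3)
      LIM_zero[OF assms(2)] by simp
  then show ?thesis by simp
qed

text \<open>By the mean value theorem each difference quotient at \<open>c\<close> is a value of
  \<open>f'\<close> at a nearby point. Used at label 0, where the boundary datum is glued from two
  pieces.\<close>

lemma DERIV_from_punctured: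
  fixes f :: "real \<Rightarrow> real"
  assumes f: "continuous_on UNIV f" and d: "\<And>x. x \<noteq> c \<Longrightarrow> (f has_real_derivative f' x) (at x)"
    and f': "isCont f' c"
  shows "(f has_real_derivative f' c) (at c)"
  unfolding DERIV_sequentially
proof (intro allI impI)
  fix u :: "nat \<Rightarrow> real" assume u: "\<forall>n. u n \<noteq> 0" "u \<longlonglongrightarrow> 0"
  have "\<exists>z. \<bar>z - c\<bar> \<le> \<bar>u n\<bar> \<and> (f (c + u n) - f c) / u n = f' z" for n
  proof (cases "u n > 0")
    case True
    obtain l z where z: "c < z" "z < c + u n" "(f has_real_derivative l) (at z)" "f (c + u n) - f c = (c + u n - c) * l"
      using MVT[of c "c + u n" f] True continuous_on_subset[OF f subset_UNIV] d real_differentiable_def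
      by (metis less_add_same_cancel1 less_irrefl)
    have "l = f' z" using z d DERIV_unique by (metis less_irrefl)
    then show ?thesis using z True by (intro exI[of _ z]) auto
  next
    case False
    with u have neg: "u n < 0" by (meson not_less_iff_gr_or_eq)
    obtain l z where z: "c + u n < z" "z < c" "(f has_real_derivative l) (at z)" "f c - f (c + u n) = (c - (c + u n)) * l"
      using MVT[of "c + u n" c f] neg continuous_on_subset[OF f subset_UNIV] d real_differentiable_def
      by (metis add.right_neutral add_less_cancel_left less_irrefl)
    have "l = f' z" using z d DERIV_unique by (metis less_irrefl)
    then show ?thesis using z neg by (intro exI[of _ z]) (auto simp: field_simps)
  qed
  then obtain z where z: "\<And>n. \<bar>z n - c\<bar> \<le> \<bar>u n\<bar>" "\<And>n. (f (c + u n) - f c) / u n = f' (z n)"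
    by metis
  have "(\<lambda>n. z n - c) \<longlonglongrightarrow> 0"
    by (rule Lim_null_comparison[of _ "\<lambda>n. \<bar>u n\<bar>"]) (use z u tendsto_rabs_zero in auto)
  then have "z \<longlonglongrightarrow> c" by (simp add: LIM_zero_iff)
  then have "(\<lambda>n. f' (z n)) \<longlonglongrightarrow> f' c" using f' isCont_tendsto_compose by blast
  then show "(\<lambda>n. (f (c + u n) - f c) / u n) \<longlonglongrightarrow> f' c" by (simp add: z)
qed

lemma at_within_atLeast: "(t::real) \<ge> 0 \<Longrightarrow> at t within {0..} = at t within {0..t + 1}"
  by (rule at_within_nhd[of _ "{..<t + 1}"]) auto

text \<open>Only the derivative from the left is taken, since the maximum may sit at the final time
  or at the outflow end.\<close>

lemma left_derivative_nonneg_at_max: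
  fixes f :: "real \<Rightarrow> real"
  assumes "(f has_real_derivative D) (at c within {a..c})" "a < c" "\<And>x. x \<in> {a..c} \<Longrightarrow> f x \<le> f c"
  shows "0 \<le> D"
proof -
  have "((\<lambda>x. (f x - f c) / (x - c)) \<longlongrightarrow> D) (at c within {a..c})"
    using assms(1) by (simp add: has_field_derivative_iff)
  moreover have "\<forall>\<^sub>F x in at c within {a..c}. 0 \<le> (f x - f c) / (x - c)"
    using assms(3) by (auto simp: eventually_at_filter divide_nonpos_nonpos intro!: always_eventually divide_nonpos_neg)
  moreover have "at c within {a..c} \<noteq> bot"
    using assms(2) by (simp add: at_within_Icc_at_left)
  ultimately show ?thesis by (rule tendsto_lowerbound)
qed

text \<open>Continuous convergence on a compact set is uniform: points violating the estimate for
  infinitely many indices would accumulate. The hypothesis speaks of a subsequence \<open>r\<close>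
  because the violating indices form one.\<close>

lemma uniform_from_sequential:
  fixes G :: "nat \<Rightarrow> 'a::metric_space \<Rightarrow> real"
  assumes X: "compact X" and g: "continuous_on X g"
    and seq: "\<And>r p q. strict_mono r \<Longrightarrow> (\<And>n. q n \<in> X) \<Longrightarrow> q \<longlonglongrightarrow> p \<Longrightarrow> p \<in> X \<Longrightarrow> (\<lambda>n. G (r n) (q n)) \<longlonglongrightarrow> g p"
    and e: "e > 0"
  shows "\<exists>N. \<forall>n\<ge>N. \<forall>p\<in>X. \<bar>G n p - g p\<bar> < e"
proof (rule ccontr)
  assume "\<not> ?thesis"
  then have "\<forall>N. \<exists>n\<ge>N. \<exists>p\<in>X. \<bar>G n p - g p\<bar> \<ge> e" by (meson not_le)
  then have "\<forall>N. \<exists>n>N. \<exists>p\<in>X. \<bar>G n p - g p\<bar> \<ge> e" by (meson Suc_le_lessD)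
  then have "\<exists>r::nat\<Rightarrow>nat. strict_mono r \<and> (\<forall>n. \<exists>p\<in>X. \<bar>G (r n) p - g p\<bar> \<ge> e)"
    using infinite_enumerate[of "{n. \<exists>p\<in>X. \<bar>G n p - g p\<bar> \<ge> e}"]
    by (simp add: infinite_nat_iff_unbounded)
  then obtain r :: "nat \<Rightarrow> nat" and q where r: "strict_mono r" "\<And>n. q n \<in> X" "\<And>n. \<bar>G (r n) (q n) - g (q n)\<bar> \<ge> e"
    by metis
  obtain p s where s: "p \<in> X" "strict_mono s" "(q \<circ> s) \<longlonglongrightarrow> p"
    using X r(2) unfolding compact_def by metis
  have 1: "(\<lambda>n. G ((r \<circ> s) n) ((q \<circ> s) n)) \<longlonglongrightarrow> g p"
    using seq[of "r \<circ> s" "q \<circ> s" p, OF strict_mono_o[OF r(1) s(2)] _ s(3,1)] r(2) by simp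
  have 2: "(\<lambda>n. g ((q \<circ> s) n)) \<longlonglongrightarrow> g p"
    by (rule continuous_on_tendsto_compose[OF g s(3) s(1)]) (simp add: r(2))
  have "(\<lambda>n. \<bar>G ((r \<circ> s) n) ((q \<circ> s) n) - g ((q \<circ> s) n)\<bar>) \<longlonglongrightarrow> \<bar>g p - g p\<bar>"
    by (intro tendsto_intros 1 2)
  then have "e \<le> \<bar>g p - g p\<bar>"
    by (rule LIMSEQ_le_const) (use r in auto)
  with e show False by simp
qed

section \<open>Truncation to the interval, and functions on the whole plane\<close>

definition clip :: "real \<Rightarrow> real \<Rightarrow> real" where
  "clip L x = max 0 (min L x)"

lemma clip_mem [simp]: "0 \<le> L \<Longrightarrow> clip L x \<in> {0..L}"
  by (auto simp: clip_def)

lemma clip_id [simp]: "x \<in> {0..L} \<Longrightarrow> clip L x = x"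
  by (auto simp: clip_def)

lemma continuous_on_clip [continuous_intros]:
  "continuous_on S f \<Longrightarrow> continuous_on S (\<lambda>x. clip L (f x))"
  unfolding clip_def by (intro continuous_intros)

lemma continuous_on_UNIV_compose:
  "continuous_on UNIV f \<Longrightarrow> continuous_on S g \<Longrightarrow> continuous_on S (\<lambda>x. f (g x))"
  by (rule continuous_on_compose2) auto

lemma continuous_on_tendsto_UNIV:
  "continuous_on UNIV f \<Longrightarrow> (g \<longlongrightarrow> l) F \<Longrightarrow> ((\<lambda>x. f (g x)) \<longlongrightarrow> f l) F"
  by (rule continuous_on_tendsto_compose) auto

lemma continuous_limit_of_bound:
  fixes F :: "'a::topological_space \<Rightarrow> real"
  assumes "\<And>n. continuous_on S (u n)" "e \<longlonglongrightarrow> 0" "\<And>n z. z \<in> S \<Longrightarrow> \<bar>u n z - F z\<bar> \<le> e n"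
  shows "continuous_on S F"
proof (rule uniform_limit_theorem)
  show "\<forall>\<^sub>F n in sequentially. continuous_on S (u n)" using assms(1) by simp
  show "uniform_limit S u F sequentially"
  proof (rule uniform_limitI)
    fix d :: real assume "0 < d"
    then have "\<forall>\<^sub>F n in sequentially. e n < d" using order_tendstoD(2)[OF assms(2)] by simp
    then show "\<forall>\<^sub>F n in sequentially. \<forall>x\<in>S. dist (u n x) (F x) < d"
      by (rule eventually_mono) (auto simp: dist_real_def intro: le_less_trans[OF assms(3)])
  qed
qed simp

lemma abs_integral_le:
  fixes f :: "real \<Rightarrow> real"
  assumes "f integrable_on {0..c}" "0 \<le> c" "\<And>y. y \<in> {0..c} \<Longrightarrow> \<bar>f y\<bar> \<le> B"
  shows "\<bar>integral {0..c} f\<bar> \<le> B * c"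
proof -
  have "norm (integral {0..c} f) \<le> integral {0..c} (\<lambda>_. B)"
    by (rule integral_norm_bound_integral) (use assms in auto)
  then show ?thesis using assms(2) by (simp add: mult.commute)
qed

lemma continuous_on_integral_clip:
  fixes f :: "real \<Rightarrow> real"
  assumes "f integrable_on {0..L}" "0 \<le> L"
  shows "continuous_on UNIV (\<lambda>y. integral {0..clip L y} f)"
proof -
  have "continuous_on {0..L} (\<lambda>x. integral {0..x} f)"
    by (rule indefinite_integral_continuous_1[OF assms(1)])
  then show ?thesis
    by (rule continuous_on_compose2) (use assms(2) clip_mem in \<open>auto intro!: continuous_intros simp del: atLeastAtMost_iff\<close>)
qed

section \<open>Characteristics\<close>

text \<open>Characteristics as graphs over \<open>x\<close>: the value is the time at which the
  characteristic entering at time \<open>s\<close> at the inflow end reaches \<open>y\<close>. The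
  clipped upper limit makes the integral equation meaningful on the whole line, with constant
  continuation beyond both ends.\<close>

definition flow :: "real \<Rightarrow> (real \<times> real \<Rightarrow> real) \<Rightarrow> real \<Rightarrow> real \<Rightarrow> real" where
  "flow L a = (SOME \<theta>. \<forall>s. continuous_on UNIV (\<theta> s) \<and>
     (\<forall>y. \<theta> s y = s + integral {0..clip L y} (\<lambda>\<eta>. a (\<theta> s \<eta>, \<eta>))))"

text \<open>The entry time of the characteristic through \<open>(t, x)\<close>; it is negative if
  the characteristic entered before time 0.\<close>

definition label :: "real \<Rightarrow> (real \<times> real \<Rightarrow> real) \<Rightarrow> real \<times> real \<Rightarrow> real" where
  "label L a = (\<lambda>(t, x). THE s. flow L a s x = t)"

text \<open>\<open>a\<close> is the reciprocal of a propagation speed. The smallness of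
  \<open>K * L\<close> makes the Picard map of the characteristics a contraction on all of
  \<open>{0..L}\<close> at once, and is the source of the factors 2 in the estimates of flow and
  label.\<close>

locale speed_field =
  fixes L A K :: real and a :: "real \<times> real \<Rightarrow> real"
  assumes L_pos: "0 < L" and A_nonneg: "0 \<le> A" and K_nonneg: "0 \<le> K" and KL: "4 * (K * L) \<le> 1"
    and cont: "continuous_on UNIV a" and pos: "0 < a p" and le: "a p \<le> A"
    and lip: "\<bar>a (t, x) - a (t', x)\<bar> \<le> K * \<bar>t - t'\<bar>"
begin

abbreviation "th \<equiv> flow L a"
abbreviation "lab \<equiv> label L a"

lemma along_cont: "continuous_on S \<theta> \<Longrightarrow> continuous_on S (\<lambda>\<eta>. a (\<theta> \<eta>, \<eta>))"
  by (intro continuous_on_UNIV_compose[OF cont] continuous_intros)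

lemma along_integrable: "continuous_on {0..c} \<theta> \<Longrightarrow> (\<lambda>\<eta>. a (\<theta> \<eta>, \<eta>)) integrable_on {0..c}"
  by (intro integrable_continuous_interval along_cont)

lemma along_diff:
  assumes c: "0 \<le> c" "c \<le> L" and "continuous_on {0..c} \<theta>" "continuous_on {0..c} \<theta>'"
    and "\<And>\<eta>. \<eta> \<in> {0..c} \<Longrightarrow> \<bar>\<theta> \<eta> - \<theta>' \<eta>\<bar> \<le> d"
  shows "\<bar>integral {0..c} (\<lambda>\<eta>. a (\<theta> \<eta>, \<eta>)) - integral {0..c} (\<lambda>\<eta>. a (\<theta>' \<eta>, \<eta>))\<bar> \<le> d / 4"
proof -
  have d: "0 \<le> d" using assms(5)[of 0] c by auto
  have "integral {0..c} (\<lambda>\<eta>. a (\<theta> \<eta>, \<eta>)) - integral {0..c} (\<lambda>\<eta>. a (\<theta>' \<eta>, \<eta>))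
      = integral {0..c} (\<lambda>\<eta>. a (\<theta> \<eta>, \<eta>) - a (\<theta>' \<eta>, \<eta>))"
    by (intro integral_diff[symmetric] along_integrable assms)
  also have "\<bar>\<dots>\<bar> \<le> K * d * c"
  proof (rule abs_integral_le)
    fix y assume y: "y \<in> {0..c}"
    have "\<bar>a (\<theta> y, y) - a (\<theta>' y, y)\<bar> \<le> K * \<bar>\<theta> y - \<theta>' y\<bar>" by (rule lip)
    also have "\<dots> \<le> K * d" using K_nonneg assms(5)[OF y] by (rule mult_left_mono[rotated])
    finally show "\<bar>a (\<theta> y, y) - a (\<theta>' y, y)\<bar> \<le> K * d" .
  qed (use c assms in \<open>auto intro!: integrable_diff along_integrable\<close>)
  also have "K * d * c \<le> K * d * L" using c K_nonneg d by (intro mult_left_mono) auto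
  also have "\<dots> = (K * L) * d" by simp
  also have "\<dots> \<le> (1 / 4) * d" using KL d by (intro mult_right_mono) auto
  finally show ?thesis by simp
qed

text \<open>Picard iteration for all labels simultaneously. The first guess
  \<open>\<lambda>s y. s\<close> is unbounded in \<open>s\<close>, but one step moves it by at most
  \<open>A * L\<close>.\<close>

lemma flow_exists:
  "\<exists>\<theta>. \<forall>s. continuous_on UNIV (\<theta> s) \<and>
     (\<forall>y. \<theta> s y = s + integral {0..clip L y} (\<lambda>\<eta>. a (\<theta> s \<eta>, \<eta>)))"
proof -
  define T where "T \<theta> s y = s + integral {0..clip L y} (\<lambda>\<eta>. a (\<theta> s \<eta>, \<eta>))" for \<theta> :: "real \<Rightarrow> real \<Rightarrow> real" and s y
  define P where "P \<theta> \<longleftrightarrow> (\<forall>s. continuous_on UNIV (\<theta> s))" for \<theta> :: "real \<Rightarrow> real \<Rightarrow> real"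
  have L: "0 \<le> L" using L_pos by simp
  obtain F e where "P F" "T F = F"
  proof (rule contraction_fixed_point[of P T "\<lambda>s y. s" "1/4" P "A * L"])
    fix \<theta> assume "P \<theta>"
    then show "P (T \<theta>)" unfolding P_def T_def
      by (intro allI continuous_intros continuous_on_integral_clip along_integrable L)
        (auto intro: continuous_on_subset)
  next
    show "P (\<lambda>s y. s)" by (simp add: P_def)
  next
    fix F u and e :: "nat \<Rightarrow> real" assume u: "\<And>n. P (u n)" "e \<longlonglongrightarrow> 0" "\<And>n i z. \<bar>u n i z - F i z\<bar> \<le> e n"
    show "P F" unfolding P_def
    proof
      fix s show "continuous_on UNIV (F s)"
        by (rule continuous_limit_of_bound[of UNIV "\<lambda>n. u n s" e]) (use u in \<open>auto simp: P_def\<close>)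
    qed
  next
    fix f g d i z assume *: "P f" "P g" "\<And>i z. \<bar>f i z - g i z\<bar> \<le> d"
    have "\<bar>T f i z - T g i z\<bar> \<le> d / 4"
      unfolding T_def add_diff_cancel_left
      by (rule along_diff) (use * clip_mem[OF L, of z] in \<open>auto simp: P_def intro: continuous_on_subset\<close>)
    then show "\<bar>T f i z - T g i z\<bar> \<le> 1 / 4 * d" by simp
  next
    fix i z
    have c: "clip L z \<in> {0..L}" using L by (rule clip_mem)
    have "\<bar>integral {0..clip L z} (\<lambda>\<eta>. a (i, \<eta>))\<bar> \<le> A * clip L z"
      by (rule abs_integral_le) (use c pos le in \<open>auto intro!: along_integrable simp: abs_of_pos\<close>)
    also have "\<dots> \<le> A * L" using c A_nonneg by (intro mult_left_mono) auto
    finally show "\<bar>T (\<lambda>s y. s) i z - i\<bar> \<le> A * L" by (simp add: T_def)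
  qed auto
  then show ?thesis unfolding P_def T_def by (intro exI[of _ F]) (metis (no_types, lifting))
qed

lemma flow_cont: "continuous_on S (th s)"
  and flow_eq_clip: "th s y = s + integral {0..clip L y} (\<lambda>\<eta>. a (th s \<eta>, \<eta>))"
  using someI_ex[OF flow_exists, folded flow_def] continuous_on_subset by blast+

lemma flow_eq: "y \<in> {0..L} \<Longrightarrow> th s y = s + integral {0..y} (\<lambda>\<eta>. a (th s \<eta>, \<eta>))"
  using flow_eq_clip[of s y] by simp

lemma flow_0 [simp]: "th s 0 = s"
  using flow_eq[of 0 s] L_pos by simp

text \<open>Entering later means arriving later by the same amount, up to a factor between 1/2 and
  3/2. So the map from labels to arrival times is bi-Lipschitz; existence, uniqueness and regularity
  of labels rest on this.\<close>

lemma flow_diff: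
  assumes "y \<in> {0..L}"
  shows "\<bar>(th s y - th s' y) - (s - s')\<bar> \<le> \<bar>s - s'\<bar> / 2"
proof -
  have step: "\<bar>(th s y - th s' y) - (s - s')\<bar> \<le> m / 4"
    if "y \<in> {0..L}" "\<And>\<eta>. \<eta> \<in> {0..L} \<Longrightarrow> \<bar>th s \<eta> - th s' \<eta>\<bar> \<le> m" for y m
  proof -
    have "\<bar>integral {0..y} (\<lambda>\<eta>. a (th s \<eta>, \<eta>)) - integral {0..y} (\<lambda>\<eta>. a (th s' \<eta>, \<eta>))\<bar> \<le> m / 4"
      by (rule along_diff) (use that flow_cont in auto)
    then show ?thesis using flow_eq[OF that(1), of s] flow_eq[OF that(1), of s'] by simp
  qed
  have "\<bar>th s y - th s' y\<bar> \<le> 2 * \<bar>s - s'\<bar>" if "y \<in> {0..L}" for y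
  proof (rule sup_absorb[of L "\<lambda>y. th s y - th s' y"])
    fix y m assume "y \<in> {0..L}" "\<And>\<eta>. \<eta> \<in> {0..L} \<Longrightarrow> \<bar>th s \<eta> - th s' \<eta>\<bar> \<le> m"
    from step[OF this] show "\<bar>th s y - th s' y\<bar> \<le> \<bar>s - s'\<bar> + m / 4" by linarith
  qed (use L_pos that in \<open>auto intro!: continuous_intros flow_cont\<close>)
  \<comment> \<open>The crude bound obtained by absorption, inserted once more as \<open>m\<close>,
    gives the sharper one.\<close>
  from step[OF assms this] show ?thesis by simp
qed

lemma flow_lip_label: "y \<in> {0..L} \<Longrightarrow> \<bar>th s y - th s' y\<bar> \<le> 2 * \<bar>s - s'\<bar>"
  by (drule flow_diff[of y s s']) argo

lemma flow_expand: "y \<in> {0..L} \<Longrightarrow> \<bar>s - s'\<bar> \<le> 2 * \<bar>th s y - th s' y\<bar>"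
  by (drule flow_diff[of y s s']) argo

lemma flow_deriv:
  assumes "y \<in> {0..L}"
  shows "(th s has_real_derivative a (th s y, y)) (at y within {0..L})"
proof -
  have "((\<lambda>y. s + integral {0..y} (\<lambda>\<eta>. a (th s \<eta>, \<eta>))) has_real_derivative 0 + a (th s y, y)) (at y within {0..L})"
    by (intro derivative_intros integral_has_real_derivative along_cont flow_cont assms)
  then have "((\<lambda>y. s + integral {0..y} (\<lambda>\<eta>. a (th s \<eta>, \<eta>))) has_real_derivative a (th s y, y)) (at y within {0..L})"
    by simp
  then show ?thesis
    by (rule has_field_derivative_transform_within[where d = 1]) (use assms flow_eq in auto)
qed

lemma flow_increment:
  assumes "0 \<le> y" "y < y'" "y' \<le> L"
  shows "0 < th s y' - th s y" "th s y' - th s y \<le> A * (y' - y)"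
proof -
  have d: "(th s has_real_derivative a (th s z, z)) (at z)" if "y < z" "z < y'" for z
    using flow_deriv[of z s] at_within_Icc_at[of 0 z L] that assms by auto
  obtain l z where z: "y < z" "z < y'" "DERIV (th s) z :> l" "th s y' - th s y = (y' - y) * l"
    using MVT[OF assms(2) flow_cont] d real_differentiable_def by metis
  have l: "l = a (th s z, z)" using d z DERIV_unique by blast
  show "0 < th s y' - th s y" using z l pos assms by simp
  show "th s y' - th s y \<le> A * (y' - y)"
    using z l le assms by (simp add: mult.commute)
qed

lemma flow_mono: "0 \<le> y \<Longrightarrow> y \<le> y' \<Longrightarrow> y' \<le> L \<Longrightarrow> th s y \<le> th s y'"
  using flow_increment(1)[of y y' s] by (cases "y = y'") auto

lemma flow_lip: "y \<in> {0..L} \<Longrightarrow> y' \<in> {0..L} \<Longrightarrow> \<bar>th s y - th s y'\<bar> \<le> A * \<bar>y - y'\<bar>"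
  using flow_increment[of y y' s] flow_increment[of y' y s]
  by (cases y y' rule: linorder_cases) auto

text \<open>Intermediate value theorem in the label: a characteristic needs a time between 0 and
  \<open>A * L\<close> to reach \<open>x\<close>.\<close>

lemma flow_surj:
  assumes "x \<in> {0..L}"
  shows "\<exists>s. th s x = t"
proof -
  have b: "s \<le> th s x \<and> th s x \<le> s + A * L" for s
    using flow_mono[of 0 x s] flow_lip[of x 0 s] assms mult_left_mono[of x L A] A_nonneg by auto
  have c: "continuous_on UNIV (\<lambda>s. th s x)"
  proof (rule lipschitz_on_continuous_on[of 2], rule lipschitz_onI)
    fix s s' show "dist (th s x) (th s' x) \<le> 2 * dist s s'"
      using flow_lip_label[OF assms] by (simp add: dist_real_def)
  qed simp
  have "\<exists>s. t - A * L \<le> s \<and> s \<le> t \<and> th s x = t"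
    by (rule IVT') (use b[of t] b[of "t - A * L"] A_nonneg L_pos c in \<open>auto intro: continuous_on_subset\<close>)
  then show ?thesis by blast
qed

lemma flow_inj: "x \<in> {0..L} \<Longrightarrow> th s x = th s' x \<Longrightarrow> s = s'"
  using flow_expand[of x s s'] by simp

lemma label_flow [simp]: "x \<in> {0..L} \<Longrightarrow> lab (th s x, x) = s"
  unfolding label_def by (auto intro!: the_equality intro: flow_inj[of x])

lemma flow_label [simp]: "x \<in> {0..L} \<Longrightarrow> th (lab (t, x)) x = t"
  using flow_surj[of x t] by (metis label_flow)

lemma label_0 [simp]: "lab (t, 0) = t"
  using label_flow[of 0 t] L_pos by simp

lemma label_le: "x \<in> {0..L} \<Longrightarrow> lab (t, x) \<le> t"
  using flow_mono[of 0 x "lab (t, x)"] by simp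

lemma label_ge: "x \<in> {0..L} \<Longrightarrow> t - A * L \<le> lab (t, x)"
  using flow_lip[of x 0 "lab (t, x)"] mult_left_mono[of x L A] A_nonneg by auto

text \<open>A move in \<open>x\<close> is compared with following the characteristic of
  \<open>(t', x')\<close>, along which time changes by at most
  \<open>A * \<bar>x - x'\<bar>\<close>.\<close>

lemma label_lip:
  assumes "x \<in> {0..L}" "x' \<in> {0..L}"
  shows "\<bar>lab (t, x) - lab (t', x')\<bar> \<le> 2 * \<bar>t - t'\<bar> + 2 * A * \<bar>x - x'\<bar>"
proof -
  have "\<bar>lab (t, x) - lab (t', x')\<bar> \<le> 2 * \<bar>th (lab (t, x)) x - th (lab (t', x')) x\<bar>"
    by (rule flow_expand[OF assms(1)])
  also have "\<dots> = 2 * \<bar>(t - t') - (th (lab (t', x')) x - th (lab (t', x')) x')\<bar>"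
    using assms by simp
  also have "\<dots> \<le> 2 * (\<bar>t - t'\<bar> + A * \<bar>x - x'\<bar>)"
    using flow_lip[OF assms, of "lab (t', x')"] by argo
  finally show ?thesis by (simp add: algebra_simps)
qed

lemma flow_perturb:
  assumes b: "speed_field L A K b" and d: "\<And>t x. \<bar>a (t, x) - b (t, x)\<bar> \<le> d" and y: "y \<in> {0..L}"
  shows "\<bar>th s y - flow L b s y\<bar> \<le> 2 * (L * d)"
proof -
  interpret b: speed_field L A K b by (rule b)
  show ?thesis
  proof (rule sup_absorb[of L "\<lambda>y. th s y - b.th s y"])
    fix y m assume y: "y \<in> {0..L}" and m: "\<And>\<eta>. \<eta> \<in> {0..L} \<Longrightarrow> \<bar>th s \<eta> - b.th s \<eta>\<bar> \<le> m"
    have 1: "\<bar>integral {0..y} (\<lambda>\<eta>. a (th s \<eta>, \<eta>)) - integral {0..y} (\<lambda>\<eta>. a (b.th s \<eta>, \<eta>))\<bar> \<le> m / 4"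
      by (rule along_diff) (use y m flow_cont b.flow_cont in auto)
    have "integral {0..y} (\<lambda>\<eta>. a (b.th s \<eta>, \<eta>)) - integral {0..y} (\<lambda>\<eta>. b (b.th s \<eta>, \<eta>))
      = integral {0..y} (\<lambda>\<eta>. a (b.th s \<eta>, \<eta>) - b (b.th s \<eta>, \<eta>))"
      by (intro integral_diff[symmetric] along_integrable b.along_integrable b.flow_cont)
    also have "\<bar>\<dots>\<bar> \<le> d * y"
      using y d by (intro abs_integral_le integrable_diff along_integrable b.along_integrable b.flow_cont) auto
    also have "d * y \<le> L * d"
      using y order_trans[OF abs_ge_zero d[of 0 0]] by (simp add: mult.commute[of L] mult_left_mono)
    finally show "\<bar>th s y - b.th s y\<bar> \<le> L * d + m / 4"
      using 1 flow_eq[OF y, of s] b.flow_eq[OF y, of s] by linarith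
  qed (use L_pos y in \<open>auto intro!: continuous_intros flow_cont b.flow_cont\<close>)
qed

lemma label_perturb:
  assumes b: "speed_field L A K b" and d: "\<And>t x. \<bar>a (t, x) - b (t, x)\<bar> \<le> d" and x: "x \<in> {0..L}"
  shows "\<bar>lab (t, x) - label L b (t, x)\<bar> \<le> 4 * (L * d)"
proof -
  interpret b: speed_field L A K b by (rule b)
  have "\<bar>lab (t, x) - b.lab (t, x)\<bar> \<le> 2 * \<bar>th (b.lab (t, x)) x - t\<bar>"
    using flow_expand[OF x, of "lab (t, x)" "b.lab (t, x)"] x by (simp add: abs_minus_commute)
  moreover have "\<bar>th (b.lab (t, x)) x - t\<bar> \<le> 2 * (L * d)"
    using flow_perturb[OF b d x, of "b.lab (t, x)"] x by simp
  ultimately show ?thesis by argo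
qed

text \<open>The constant is 2 * 4 + 2: the label moves by \<open>4 * (L * d)\<close>, which the flow
  at most doubles, and the flow itself changes by \<open>2 * (L * d)\<close>. It reappears in the
  constant \<open>D\<close> of the iteration.\<close>

lemma flow_label_perturb:
  assumes b: "speed_field L A K b" and d: "\<And>t x. \<bar>a (t, x) - b (t, x)\<bar> \<le> d"
    and x: "x \<in> {0..L}" and y: "y \<in> {0..L}"
  shows "\<bar>th (lab (t, x)) y - flow L b (label L b (t, x)) y\<bar> \<le> 10 * (L * d)"
proof -
  have "\<bar>th (lab (t, x)) y - th (label L b (t, x)) y\<bar> \<le> 8 * (L * d)"
    using flow_lip_label[OF y, of "lab (t, x)" "label L b (t, x)"] label_perturb[OF b d x, of t]
    by argo
  then show ?thesis
    using flow_perturb[OF b d y, of "label L b (t, x)"] by linarith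
qed

end

section \<open>Transport along characteristics\<close>

definition half_C1 :: "real \<Rightarrow> (real \<times> real \<Rightarrow> real) \<Rightarrow> (real \<times> real \<Rightarrow> real) \<Rightarrow> bool" where
  "half_C1 M g g' \<longleftrightarrow> continuous_on UNIV g \<and> continuous_on UNIV g' \<and> (\<forall>p. \<bar>g' p\<bar> \<le> M) \<and>
     (\<forall>t x. 0 < t \<longrightarrow> ((\<lambda>t. g (t, x)) has_real_derivative g' (t, x)) (at t)) \<and>
     (\<forall>t x. t \<le> 0 \<longrightarrow> g (t, x) = g (0, x))"

lemma half_C1D:
  assumes "half_C1 M g g'"
  shows "continuous_on UNIV g" "continuous_on UNIV g'" "\<bar>g' p\<bar> \<le> M" "0 \<le> M"
    "0 < t \<Longrightarrow> ((\<lambda>t. g (t, x)) has_real_derivative g' (t, x)) (at t)"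
    "t \<le> 0 \<Longrightarrow> g (t, x) = g (0, x)"
  using assms order_trans[OF abs_ge_zero, of "g' undefined" M] unfolding half_C1_def by blast+

lemma half_C1_deriv:
  assumes "half_C1 M g g'" "t \<noteq> 0"
  shows "((\<lambda>t. g (t, x)) has_real_derivative (if 0 < t then g' (t, x) else 0)) (at t)"
proof (cases "0 < t")
  case True then show ?thesis using half_C1D(5)[OF assms(1)] by simp
next
  case False
  with assms have t: "t < 0" by simp
  have "((\<lambda>t. g (0, x)) has_real_derivative 0) (at t)" by simp
  then have "((\<lambda>t. g (t, x)) has_real_derivative 0) (at t)"
  proof (rule has_field_derivative_transform_within[where d = "-t"])
    fix u assume "dist u t < - t"
    then have "u \<le> 0" unfolding dist_real_def by linarith
    then show "g (0, x) = g (u, x)" by (rule half_C1D(6)[OF assms(1), symmetric])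
  qed (use t in auto)
  then show ?thesis using False by simp
qed

lemma half_C1_lip:
  assumes "half_C1 M g g'"
  shows "\<bar>g (t, x) - g (t', x)\<bar> \<le> M * \<bar>t - t'\<bar>"
proof -
  have pos: "\<bar>g (u, x) - g (v, x)\<bar> \<le> M * (v - u)" if "0 \<le> u" "u < v" for u v
  proof -
    have c: "continuous_on {u..v} (\<lambda>t. g (t, x))"
      by (intro continuous_on_UNIV_compose[OF half_C1D(1)[OF assms]] continuous_intros)
    have d: "((\<lambda>t. g (t, x)) has_real_derivative g' (z, x)) (at z)" if "u < z" for z
      using half_C1D(5)[OF assms, of z] that \<open>0 \<le> u\<close> by simp
    have df: "(\<lambda>t. g (t, x)) differentiable (at z)" if "u < z" for z
      unfolding real_differentiable_def using d[OF that] by blast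
    obtain l z where z: "u < z" "z < v" "DERIV (\<lambda>t. g (t, x)) z :> l" "g (v, x) - g (u, x) = (v - u) * l"
      using MVT[OF \<open>u < v\<close> c] df by blast
    have "l = g' (z, x)" using d z DERIV_unique by blast
    then have "\<bar>l\<bar> \<le> M" using half_C1D(3)[OF assms] by simp
    then have "(v - u) * \<bar>l\<bar> \<le> (v - u) * M" using that by (intro mult_left_mono) auto
    moreover have "\<bar>g (u, x) - g (v, x)\<bar> = (v - u) * \<bar>l\<bar>"
      using that by (subst abs_minus_commute) (simp add: z(4) abs_mult)
    ultimately show ?thesis by (simp add: mult.commute)
  qed
  have M: "0 \<le> M" by (rule half_C1D(4)[OF assms])
  have max: "g (u, x) = g (max 0 u, x)" for u using half_C1D(6)[OF assms, of u x] by (simp add: max_def)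
  have "\<bar>g (max 0 t, x) - g (max 0 t', x)\<bar> \<le> M * \<bar>max 0 t - max 0 t'\<bar>"
    using pos[of "max 0 t" "max 0 t'"] pos[of "max 0 t'" "max 0 t"]
    by (cases "max 0 t" "max 0 t'" rule: linorder_cases) (auto simp: abs_minus_commute)
  also have "\<dots> \<le> M * \<bar>t - t'\<bar>" using M by (intro mult_left_mono) auto
  finally show ?thesis by (simp only: max[symmetric])
qed

lemma linear_ode_solution:
  fixes q \<alpha> :: "real \<Rightarrow> real"
  assumes q: "\<And>y. y \<in> {0..L} \<Longrightarrow> (q has_real_derivative \<alpha> y * q y) (at y within {0..L})"
    and \<alpha>: "continuous_on {0..L} \<alpha>" and y: "y \<in> {0..L}"
  shows "q y = q 0 * exp (integral {0..y} \<alpha>)"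
proof -
  have d: "((\<lambda>y. q y * exp (- integral {0..y} \<alpha>)) has_real_derivative 0) (at y within {0..L})"
    if "y \<in> {0..L}" for y
  proof -
    have "((\<lambda>y. q y * exp (- integral {0..y} \<alpha>)) has_real_derivative
      (\<alpha> y * q y) * exp (- integral {0..y} \<alpha>) + (exp (- integral {0..y} \<alpha>) * - \<alpha> y) * q y) (at y within {0..L})"
      by (intro derivative_intros q integral_has_real_derivative \<alpha> that)
    then show ?thesis by (simp add: algebra_simps)
  qed
  obtain c where c: "\<And>y. y \<in> {0..L} \<Longrightarrow> q y * exp (- integral {0..y} \<alpha>) = c"
    using has_field_derivative_zero_constant[of "{0..L}", OF _ d] by auto
  have "q 0 = c" using c[of 0] y by simp
  then show ?thesis using c[OF y] by (simp add: exp_minus field_simps)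
qed

definition along :: "real \<Rightarrow> (real \<times> real \<Rightarrow> real) \<Rightarrow> (real \<times> real \<Rightarrow> real) \<Rightarrow> real \<Rightarrow> real \<Rightarrow> real" where
  "along L a g s \<eta> = (if 0 < flow L a s \<eta> then g (flow L a s \<eta>, \<eta>) else 0)"

text \<open>The derivative of the flow with respect to its label, as the exponential solution of the
  variational equation \<open>j' = a' j\<close>.\<close>

definition jac :: "real \<Rightarrow> (real \<times> real \<Rightarrow> real) \<Rightarrow> (real \<times> real \<Rightarrow> real) \<Rightarrow> real \<Rightarrow> real \<Rightarrow> real" where
  "jac L a a' s y = exp (integral {0..y} (along L a a' s))"

text \<open>The method of characteristics for \<open>u\<^sub>x + a u\<^sub>t = F\<close> with inflow
  datum \<open>u (s, 0) = V s\<close>.\<close>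

definition transport :: "real \<Rightarrow> (real \<times> real \<Rightarrow> real) \<Rightarrow> (real \<Rightarrow> real) \<Rightarrow> (real \<times> real \<Rightarrow> real) \<Rightarrow> real \<times> real \<Rightarrow> real" where
  "transport L a V F = (\<lambda>(t, x). let s = label L a (t, x) in
     V s + integral {0..x} (\<lambda>\<eta>. F (flow L a s \<eta>, \<eta>)))"

text \<open>The time derivative of \<open>transport\<close>: the derivative in the label, divided by
  the derivative of the flow in the label. The rates \<open>a'\<close>, \<open>V'\<close>,
  \<open>F'\<close> are free arguments, since the fibre map is applied to candidates not known to be
  derivatives.\<close>

definition transport_rate :: "real \<Rightarrow> (real \<times> real \<Rightarrow> real) \<Rightarrow> (real \<times> real \<Rightarrow> real) \<Rightarrow> (real \<Rightarrow> real)
    \<Rightarrow> (real \<times> real \<Rightarrow> real) \<Rightarrow> real \<times> real \<Rightarrow> real" where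
  "transport_rate L a a' V' F' = (\<lambda>(t, x). let s = label L a (t, x) in
     (V' s + integral {0..x} (\<lambda>\<eta>. along L a F' s \<eta> * jac L a a' s \<eta>)) / jac L a a' s x)"

section \<open>Differentiability of the transported function in time\<close>

context speed_field
begin

text \<open>Arrival times increase strictly with the position, so the line \<open>t = 0\<close> is
  crossed at most once.\<close>

lemma zero_set_finite: "finite {\<eta> \<in> {0..L}. th s \<eta> = 0}"
proof (cases "\<exists>z\<in>{0..L}. th s z = 0")
  case True
  then obtain z where z: "z \<in> {0..L}" "th s z = 0" by blast
  have "\<eta> = z" if "\<eta> \<in> {0..L}" "th s \<eta> = 0" for \<eta>
    using flow_increment(1)[of z \<eta> s] flow_increment(1)[of \<eta> z s] z that
    by (cases \<eta> z rule: linorder_cases) auto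
  then have "{\<eta> \<in> {0..L}. th s \<eta> = 0} \<subseteq> {z}" by blast
  then show ?thesis by (rule finite_subset) simp
next
  case False
  then have "{\<eta> \<in> {0..L}. th s \<eta> = 0} = {}" by blast
  then show ?thesis by (metis finite.emptyI)
qed

text \<open>The jump at the crossing is approximated by the continuous cut-offs
  \<open>min 1 (real n * max 0 (th s \<eta>))\<close>, which converge pointwise and
  boundedly.\<close>

lemma along_mult_integrable:
  assumes g: "continuous_on UNIV g" "\<And>p. \<bar>g p\<bar> \<le> C" and h: "continuous_on {0..L} h"
  shows "(\<lambda>\<eta>. along L a g s \<eta> * h \<eta>) integrable_on {0..L}"
proof -
  obtain H where H: "\<And>\<eta>. \<eta> \<in> {0..L} \<Longrightarrow> \<bar>h \<eta>\<bar> \<le> H"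
    using compact_imp_bounded[OF compact_continuous_image[OF h compact_Icc]]
    by (auto simp: bounded_iff simp del: atLeastAtMost_iff)
  define u where "u n \<eta> = g (th s \<eta>, \<eta>) * min 1 (real n * max 0 (th s \<eta>)) * h \<eta>" for n \<eta>
  show ?thesis
  proof (rule bounded_convergence(1)[of u 0 L "C * H" "{}"])
    show "u n integrable_on {0..L}" for n
      unfolding u_def
      by (intro integrable_continuous_interval continuous_intros continuous_on_UNIV_compose[OF g(1)] flow_cont h)
  next
    fix n y assume y: "y \<in> {0..L}"
    have "\<bar>g (th s y, y)\<bar> * \<bar>min 1 (real n * max 0 (th s y))\<bar> * \<bar>h y\<bar> \<le> C * 1 * H"
      using g(2)[of "(th s y, y)"] H[OF y] order_trans[OF abs_ge_zero g(2)]
      by (intro mult_mono) (auto simp: min_def)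
    then show "\<bar>u n y\<bar> \<le> C * H" by (simp add: u_def abs_mult)
  next
    fix y assume "y \<in> {0..L} - {}"
    show "(\<lambda>n. u n y) \<longlonglongrightarrow> along L a g s y * h y"
    proof (cases "0 < th s y")
      case True
      obtain N where N: "1 < real N * th s y" using True ex_less_of_nat_mult by blast
      have "u n y = g (th s y, y) * h y" if "n \<ge> N" for n
      proof -
        have "real N * th s y \<le> real n * th s y" using that True by (intro mult_right_mono) auto
        then have "1 < real n * th s y" using N by linarith
        then have "min 1 (real n * max 0 (th s y)) = 1" using True by (simp add: max_def min_def)
        then show ?thesis by (simp add: u_def)
      qed
      then have "\<forall>\<^sub>F n in sequentially. u n y = along L a g s y * h y"
        using True by (auto simp: along_def eventually_sequentially)
      then show ?thesis by (simp add: tendsto_eventually)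
    next
      case False
      then show ?thesis by (simp add: u_def along_def max_def)
    qed
  qed auto
qed

lemma along_le: "(\<And>p. \<bar>g p\<bar> \<le> C) \<Longrightarrow> \<bar>along L a g s \<eta>\<bar> \<le> C"
  by (auto simp: along_def intro: order_trans[OF abs_ge_zero])

end

locale speed_field_C1 = speed_field +
  fixes a' :: "real \<times> real \<Rightarrow> real"
  assumes cont': "continuous_on UNIV a'" and bound': "\<bar>a' p\<bar> \<le> K"
begin

abbreviation "j \<equiv> jac L a a'"

lemma along_rate_integrable: "c \<in> {0..L} \<Longrightarrow> along L a a' s integrable_on {0..c}"
  by (rule integrable_on_subinterval[of _ "{0..L}"])
    (use along_mult_integrable[OF cont' bound', of "\<lambda>_. 1" s] in auto)

lemma jac_exponent: "y \<in> {0..L} \<Longrightarrow> \<bar>integral {0..y} (along L a a' s)\<bar> \<le> K * y"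
  by (rule abs_integral_le[OF along_rate_integrable]) (auto intro: along_le bound')

lemma jac_cont: "continuous_on {0..L} (j s)"
  unfolding jac_def
  by (intro continuous_intros indefinite_integral_continuous_1 along_rate_integrable) (use L_pos in auto)

lemma jac_pos: "0 < j s y" by (simp add: jac_def)

lemma jac_bounds:
  assumes "y \<in> {0..L}" shows "j s y \<le> 2" "1 / 2 \<le> j s y"
proof -
  have "K * y \<le> K * L" using assms K_nonneg by (intro mult_left_mono) auto
  then have "\<bar>integral {0..y} (along L a a' s)\<bar> \<le> 1 / 4"
    using jac_exponent[OF assms, of s] KL by simp
  then have *: "exp (integral {0..y} (along L a a' s)) \<le> exp (1 / 4)"
    "exp (- (1 / 4)) \<le> exp (integral {0..y} (along L a a' s))" by auto
  have "exp (1 / 4 :: real) \<le> 1 + 1 / 4 + (1 / 4)\<^sup>2" by (rule exp_bound) auto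
  moreover have "1 + - (1 / 4) \<le> exp (- (1 / 4) :: real)" by (rule exp_ge_add_one_self)
  ultimately show "j s y \<le> 2" "1 / 2 \<le> j s y"
    using * unfolding jac_def power2_eq_square by linarith+
qed

lemma rate_mult_jac_integrable:
  assumes "continuous_on UNIV g" "\<And>p. \<bar>g p\<bar> \<le> C" "c \<in> {0..L}"
  shows "(\<lambda>\<eta>. along L a g s \<eta> * j s \<eta>) integrable_on {0..c}"
  by (rule integrable_on_subinterval[OF along_mult_integrable[OF assms(1,2) jac_cont]]) (use assms in auto)

text \<open>The difference quotient in the label solves a linear equation in \<open>y\<close> whose
  coefficient is a divided difference of \<open>a\<close>, so it is an explicit exponential. Bounded
  convergence in the exponent gives the limit; only the crossing of \<open>t = 0\<close>, where
  \<open>a\<close> may have a kink, is left out.\<close>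

lemma flow_label_DERIV:
  assumes C1: "half_C1 K a a'" and y: "y \<in> {0..L}"
  shows "((\<lambda>s. th s y) has_real_derivative j s y) (at s)"
  unfolding DERIV_sequentially
proof (intro allI impI)
  fix h :: "nat \<Rightarrow> real" assume h: "\<forall>n. h n \<noteq> 0" "h \<longlonglongrightarrow> 0"
  define \<alpha> where "\<alpha> n \<eta> = (a (th (s + h n) \<eta>, \<eta>) - a (th s \<eta>, \<eta>)) / (th (s + h n) \<eta> - th s \<eta>)" for n \<eta>
  define q where "q n \<eta> = (th (s + h n) \<eta> - th s \<eta>) / h n" for n \<eta>
  have ne: "th (s + h n) \<eta> \<noteq> th s \<eta>" if "\<eta> \<in> {0..L}" for n \<eta>
    using flow_inj[OF that, of "s + h n" s] h(1) by auto
  have \<alpha>_cont: "continuous_on {0..L} (\<alpha> n)" for n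
    unfolding \<alpha>_def by (intro continuous_intros along_cont flow_cont) (use ne in auto)
  have dq: "(q n has_real_derivative \<alpha> n \<eta> * q n \<eta>) (at \<eta> within {0..L})" if "\<eta> \<in> {0..L}" for n \<eta>
  proof -
    have "(q n has_real_derivative (a (th (s + h n) \<eta>, \<eta>) - a (th s \<eta>, \<eta>)) / h n) (at \<eta> within {0..L})"
      unfolding q_def by (rule DERIV_cdivide[OF DERIV_diff[OF flow_deriv[OF that] flow_deriv[OF that]]])
    moreover have "(a (th (s + h n) \<eta>, \<eta>) - a (th s \<eta>, \<eta>)) / h n = \<alpha> n \<eta> * q n \<eta>"
      using ne[OF that, of n] by (simp add: \<alpha>_def q_def)
    ultimately show ?thesis by simp
  qed
  have q: "q n y = exp (integral {0..y} (\<alpha> n))" for n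
    using linear_ode_solution[OF dq \<alpha>_cont y] h(1) by (simp add: q_def)
  have "(\<lambda>n. integral {0..y} (\<alpha> n)) \<longlonglongrightarrow> integral {0..y} (along L a a' s)"
  proof (rule bounded_convergence(2)[of _ _ _ K, OF _ _ zero_set_finite[of s]])
    show "\<alpha> n integrable_on {0..y}" for n
      by (rule integrable_continuous_interval, rule continuous_on_subset[OF \<alpha>_cont]) (use y in auto)
  next
    fix n \<eta> assume \<eta>: "\<eta> \<in> {0..y}"
    then have "0 < \<bar>th (s + h n) \<eta> - th s \<eta>\<bar>" using ne[of \<eta> n] y by auto
    then show "\<bar>\<alpha> n \<eta>\<bar> \<le> K" using lip[of "th (s + h n) \<eta>" \<eta> "th s \<eta>"]
      by (simp add: \<alpha>_def abs_divide pos_divide_le_eq)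
  next
    fix \<eta> assume "\<eta> \<in> {0..y} - {\<eta> \<in> {0..L}. th s \<eta> = 0}"
    then have \<eta>: "\<eta> \<in> {0..L}" "th s \<eta> \<noteq> 0" using y by auto
    have "(\<lambda>n. 2 * \<bar>h n\<bar>) \<longlonglongrightarrow> 0" using h(2) by (intro tendsto_mult_right_zero tendsto_rabs_zero)
    then have "(\<lambda>n. th (s + h n) \<eta>) \<longlonglongrightarrow> th s \<eta>"
      by (rule tendsto_of_bound) (use flow_lip_label[OF \<eta>(1), of "s + h _" s] in simp)
    then show "(\<lambda>n. \<alpha> n \<eta>) \<longlonglongrightarrow> along L a a' s \<eta>"
      unfolding \<alpha>_def along_def
      by (rule DERIV_sequence[OF half_C1_deriv[OF C1 \<eta>(2)]]) (rule ne[OF \<eta>(1)])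
  qed
  then show "(\<lambda>n. (th (s + h n) y - th s y) / h n) \<longlonglongrightarrow> j s y"
    using tendsto_exp unfolding jac_def q[unfolded q_def] by blast
qed

text \<open>Differentiation under the integral by bounded convergence: the Lipschitz constants of
  \<open>F\<close> and of the flow dominate the difference quotients, and the chain rule can fail
  only at the crossing.\<close>

lemma integral_along_DERIV:
  assumes C1: "half_C1 K a a'" and F: "half_C1 M F F'" and y: "y \<in> {0..L}"
  shows "((\<lambda>s. integral {0..y} (\<lambda>\<eta>. F (th s \<eta>, \<eta>))) has_real_derivative
     integral {0..y} (\<lambda>\<eta>. along L a F' s \<eta> * j s \<eta>)) (at s)"
  unfolding DERIV_sequentially
proof (intro allI impI)
  fix h :: "nat \<Rightarrow> real" assume h: "\<forall>n. h n \<noteq> 0" "h \<longlonglongrightarrow> 0"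
  have Fc: "continuous_on UNIV F" by (rule half_C1D(1)[OF F])
  have int: "(\<lambda>\<eta>. F (th s \<eta>, \<eta>)) integrable_on {0..y}" for s
    by (intro integrable_continuous_interval continuous_on_UNIV_compose[OF Fc] continuous_intros flow_cont)
  define Q where "Q n \<eta> = (F (th (s + h n) \<eta>, \<eta>) - F (th s \<eta>, \<eta>)) / h n" for n \<eta>
  have "(\<lambda>n. integral {0..y} (Q n)) \<longlonglongrightarrow> integral {0..y} (\<lambda>\<eta>. along L a F' s \<eta> * j s \<eta>)"
  proof (rule bounded_convergence(2)[of _ _ _ "2 * M", OF _ _ zero_set_finite[of s]])
    show "Q n integrable_on {0..y}" for n
      unfolding Q_def by (intro integrable_on_divide integrable_diff int)
  next
    fix n \<eta> assume "\<eta> \<in> {0..y}"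
    then have \<eta>: "\<eta> \<in> {0..L}" using y by auto
    have M: "0 \<le> M" by (rule half_C1D(4)[OF F])
    have "\<bar>F (th (s + h n) \<eta>, \<eta>) - F (th s \<eta>, \<eta>)\<bar> \<le> M * \<bar>th (s + h n) \<eta> - th s \<eta>\<bar>"
      by (rule half_C1_lip[OF F])
    also have "\<dots> \<le> M * (2 * \<bar>h n\<bar>)"
      using flow_lip_label[OF \<eta>, of "s + h n" s] M by (intro mult_left_mono) auto
    finally show "\<bar>Q n \<eta>\<bar> \<le> 2 * M"
      using h(1) by (simp add: Q_def abs_divide pos_divide_le_eq mult_ac)
  next
    fix \<eta> assume "\<eta> \<in> {0..y} - {\<eta> \<in> {0..L}. th s \<eta> = 0}"
    then have \<eta>: "\<eta> \<in> {0..L}" "th s \<eta> \<noteq> 0" using y by auto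
    have ne: "th (s + h n) \<eta> \<noteq> th s \<eta>" for n
      using flow_inj[OF \<eta>(1), of "s + h n" s] h(1) by auto
    have 1: "(\<lambda>n. (th (s + h n) \<eta> - th s \<eta>) / h n) \<longlonglongrightarrow> j s \<eta>"
      using flow_label_DERIV[OF C1 \<eta>(1), of s] h unfolding DERIV_sequentially by blast
    have "(\<lambda>n. s + h n) \<longlonglongrightarrow> s" using tendsto_add[OF tendsto_const h(2), of s] by simp
    then have "(\<lambda>n. th (s + h n) \<eta>) \<longlonglongrightarrow> th s \<eta>"
      using DERIV_isCont[OF flow_label_DERIV[OF C1 \<eta>(1)]] isCont_tendsto_compose by blast
    then have "(\<lambda>n. (F (th (s + h n) \<eta>, \<eta>) - F (th s \<eta>, \<eta>)) / (th (s + h n) \<eta> - th s \<eta>)) \<longlonglongrightarrow> along L a F' s \<eta>"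
      unfolding along_def by (rule DERIV_sequence[OF half_C1_deriv[OF F \<eta>(2)]]) (rule ne)
    from tendsto_mult[OF this 1] show "(\<lambda>n. Q n \<eta>) \<longlonglongrightarrow> along L a F' s \<eta> * j s \<eta>"
      using ne by (simp add: Q_def)
  qed
  moreover have "integral {0..y} (Q n) = (integral {0..y} (\<lambda>\<eta>. F (th (s + h n) \<eta>, \<eta>)) - integral {0..y} (\<lambda>\<eta>. F (th s \<eta>, \<eta>))) / h n" for n
    unfolding Q_def by (simp add: integral_diff[OF int int] divide_inverse)
  ultimately show "(\<lambda>n. (integral {0..y} (\<lambda>\<eta>. F (th (s + h n) \<eta>, \<eta>)) - integral {0..y} (\<lambda>\<eta>. F (th s \<eta>, \<eta>))) / h n)
      \<longlonglongrightarrow> integral {0..y} (\<lambda>\<eta>. along L a F' s \<eta> * j s \<eta>)" by simp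
qed

lemma label_DERIV:
  assumes C1: "half_C1 K a a'" and x: "x \<in> {0..L}"
  shows "((\<lambda>t. lab (t, x)) has_real_derivative inverse (j (lab (t, x)) x)) (at t)"
proof (rule DERIV_inverse_function[of "\<lambda>s. th s x" _ _ _ "t - 1" "t + 1"])
  show "((\<lambda>s. th s x) has_real_derivative j (lab (t, x)) x) (at (lab (t, x)))"
    by (rule flow_label_DERIV[OF C1 x])
  show "isCont (\<lambda>t. lab (t, x)) t"
  proof -
    have "continuous_on UNIV (\<lambda>t. lab (t, x))"
    proof (rule lipschitz_on_continuous_on[of 2], rule lipschitz_onI)
      fix t t' show "dist (lab (t, x)) (lab (t', x)) \<le> 2 * dist t t'"
        using label_lip[OF x x, of t t'] by (simp add: dist_real_def)
    qed simp
    then show ?thesis by (simp add: continuous_on_eq_continuous_at)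
  qed
qed (use x jac_pos[of "lab (t, x)" x] in auto)

lemma transport_DERIV:
  assumes C1: "half_C1 K a a'" and F: "half_C1 M F F'" and x: "x \<in> {0..L}"
    and V: "\<And>s. (V has_real_derivative V' s) (at s)"
  shows "((\<lambda>t. transport L a V F (t, x)) has_real_derivative transport_rate L a a' V' F' (t, x)) (at t)"
proof -
  have "((\<lambda>s. V s + integral {0..x} (\<lambda>\<eta>. F (th s \<eta>, \<eta>))) has_real_derivative
     V' s + integral {0..x} (\<lambda>\<eta>. along L a F' s \<eta> * j s \<eta>)) (at s)" for s
    by (intro derivative_intros V integral_along_DERIV[OF C1 F x])
  from DERIV_chain2[OF this label_DERIV[OF C1 x]]
  show ?thesis by (simp add: transport_def transport_rate_def Let_def divide_inverse)
qed

end

text \<open>Continuous convergence. It is by definition stable under evaluation at converging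
  points, which is what integrands along characteristics need when the characteristics move with the
  coefficients.\<close>

definition cconv :: "(nat \<Rightarrow> 'a::topological_space \<Rightarrow> real) \<Rightarrow> ('a \<Rightarrow> real) \<Rightarrow> bool" where
  "cconv G g \<longleftrightarrow> (\<forall>p q. p \<longlonglongrightarrow> q \<longrightarrow> (\<lambda>n. G n (p n)) \<longlonglongrightarrow> g q)"

lemma cconvD: "cconv G g \<Longrightarrow> p \<longlonglongrightarrow> q \<Longrightarrow> (\<lambda>n. G n (p n)) \<longlonglongrightarrow> g q"
  by (simp add: cconv_def)

lemma cconv_const: "continuous_on UNIV g \<Longrightarrow> cconv (\<lambda>_. g) g"
  by (auto simp: cconv_def intro: continuous_on_tendsto_UNIV)

lemma cconv_bound:
  fixes g :: "'a::topological_space \<Rightarrow> real"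
  assumes "continuous_on UNIV g" "e \<longlonglongrightarrow> 0" "\<And>n p. \<bar>G n p - g p\<bar> \<le> e n"
  shows "cconv G g"
  unfolding cconv_def
proof (intro allI impI)
  fix p and q :: 'a assume p: "p \<longlonglongrightarrow> q"
  have "(\<lambda>n. G n (p n) - g (p n)) \<longlonglongrightarrow> 0"
    by (rule Lim_null_comparison[OF _ assms(2)]) (use assms(3) in auto)
  from tendsto_add[OF this continuous_on_tendsto_UNIV[OF assms(1) p]]
  show "(\<lambda>n. G n (p n)) \<longlonglongrightarrow> g q" by simp
qed

text \<open>Off the crossing the sign of the arrival time is eventually constant, so the case
  distinction in \<open>along\<close> stabilises.\<close>

lemma along_tendsto:
  assumes "(\<lambda>n. flow L (an n) (s n) \<eta>) \<longlonglongrightarrow> flow L a s0 \<eta>" "flow L a s0 \<eta> \<noteq> 0" "cconv G g"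
  shows "(\<lambda>n. along L (an n) (G n) (s n) \<eta>) \<longlonglongrightarrow> along L a g s0 \<eta>"
proof (cases "0 < flow L a s0 \<eta>")
  case True
  have "\<forall>\<^sub>F n in sequentially. 0 < flow L (an n) (s n) \<eta>" using order_tendstoD(1)[OF assms(1) True] .
  then have "\<forall>\<^sub>F n in sequentially. along L (an n) (G n) (s n) \<eta> = G n (flow L (an n) (s n) \<eta>, \<eta>)"
    by (rule eventually_mono) (simp add: along_def)
  moreover have "(\<lambda>n. G n (flow L (an n) (s n) \<eta>, \<eta>)) \<longlonglongrightarrow> along L a g s0 \<eta>"
    using cconvD[OF assms(3) tendsto_Pair[OF assms(1) tendsto_const]] True by (simp add: along_def)
  ultimately show ?thesis by (simp add: tendsto_cong)
next
  case False
  then have "\<forall>\<^sub>F n in sequentially. flow L (an n) (s n) \<eta> < 0"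
    using order_tendstoD(2)[OF assms(1), of 0] assms(2) by simp
  then have "\<forall>\<^sub>F n in sequentially. along L (an n) (G n) (s n) \<eta> = 0"
    by (rule eventually_mono) (simp add: along_def)
  then show ?thesis using False by (simp add: tendsto_cong along_def)
qed

text \<open>Joint continuity in the coefficients and the point, without a modulus. The speeds
  converge uniformly, so labels and flows converge with an explicit error; the rates converge only
  continuously, and every integrand converges away from the single crossing of the limiting
  characteristic.\<close>

lemma transport_rate_tendsto:
  assumes fn: "\<And>n. speed_field_C1 L A K (an n) (an' n)" and f: "speed_field_C1 L A K a a'"
    and sup: "\<And>n t x. \<bar>an n (t, x) - a (t, x)\<bar> \<le> e n" and e: "e \<longlonglongrightarrow> 0"
    and a': "cconv an' a'" and F': "cconv Fn' F'" and V': "cconv Vn' V'"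
    and Fc: "\<And>n. continuous_on UNIV (Fn' n)" and Fb: "\<And>n p. \<bar>Fn' n p\<bar> \<le> C"
    and t: "tn \<longlonglongrightarrow> t" and x: "xn \<longlonglongrightarrow> x" "\<And>n. xn n \<in> {0..L}"
  shows "(\<lambda>n. transport_rate L (an n) (an' n) (Vn' n) (Fn' n) (tn n, xn n)) \<longlonglongrightarrow> transport_rate L a a' V' F' (t, x)"
proof -
  interpret f: speed_field_C1 L A K a a' by (rule f)
  define sn where "sn n = label L (an n) (tn n, xn n)" for n
  define s where "s = label L a (t, x)"
  have xL: "x \<in> {0..L}" using closed_sequentially[OF closed_atLeastAtMost x(2) x(1)] .
  have fn': "speed_field L A K (an n)" for n using fn[of n] by (simp add: speed_field_C1_def)
  have Le: "(\<lambda>n. c * (L * e n)) \<longlonglongrightarrow> 0" for c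
    by (intro tendsto_mult_right_zero e)
  have "(\<lambda>n. 4 * (L * e n) + (2 * \<bar>tn n - t\<bar> + 2 * A * \<bar>xn n - x\<bar>)) \<longlonglongrightarrow> 0 + (2 * \<bar>t - t\<bar> + 2 * A * \<bar>x - x\<bar>)"
    by (intro tendsto_intros Le t x)
  then have "(\<lambda>n. 4 * (L * e n) + (2 * \<bar>tn n - t\<bar> + 2 * A * \<bar>xn n - x\<bar>)) \<longlonglongrightarrow> 0" by simp
  then have sn: "sn \<longlonglongrightarrow> s"
  proof (rule tendsto_of_bound)
    fix n
    show "\<bar>sn n - s\<bar> \<le> 4 * (L * e n) + (2 * \<bar>tn n - t\<bar> + 2 * A * \<bar>xn n - x\<bar>)"
      using speed_field.label_perturb[OF fn' f.speed_field_axioms sup x(2), of n "tn n" n]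
        f.label_lip[OF x(2) xL, of "tn n" n t]
      unfolding sn_def s_def by linarith
  qed
  have "(\<lambda>n. 2 * (L * e n) + 2 * \<bar>sn n - s\<bar>) \<longlonglongrightarrow> 0 + 2 * \<bar>s - s\<bar>"
    by (intro tendsto_intros Le sn)
  then have "(\<lambda>n. 2 * (L * e n) + 2 * \<bar>sn n - s\<bar>) \<longlonglongrightarrow> 0" by simp
  then have th: "(\<lambda>n. flow L (an n) (sn n) \<eta>) \<longlonglongrightarrow> flow L a s \<eta>" if \<eta>: "\<eta> \<in> {0..L}" for \<eta>
  proof (rule tendsto_of_bound)
    fix n
    show "\<bar>flow L (an n) (sn n) \<eta> - flow L a s \<eta>\<bar> \<le> 2 * (L * e n) + 2 * \<bar>sn n - s\<bar>"
      using speed_field.flow_perturb[OF fn' f.speed_field_axioms sup \<eta>, of n "sn n"]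
        f.flow_lip_label[OF \<eta>, of "sn n" s] by linarith
  qed
  have al: "(\<lambda>n. along L (an n) (G n) (sn n) \<eta>) \<longlonglongrightarrow> along L a g s \<eta>"
    if "cconv G g" "\<eta> \<in> {0..L} - {\<eta> \<in> {0..L}. flow L a s \<eta> = 0}" for \<eta> G g
    by (rule along_tendsto[OF th _ that(1)]) (use that(2) in auto)
  have jm: "(\<lambda>n. jac L (an n) (an' n) (sn n) (yn n)) \<longlonglongrightarrow> jac L a a' s y"
    if "yn \<longlonglongrightarrow> y" "\<And>n. yn n \<in> {0..L}" for yn y
    unfolding jac_def
  proof (rule tendsto_exp, rule bounded_convergence_moving[OF _ _ f.zero_set_finite[of s] al[OF a'] that])
    show "along L (an n) (an' n) (sn n) integrable_on {0..L}" for n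
      by (rule speed_field_C1.along_rate_integrable[OF fn]) (use f.L_pos in auto)
    show "\<bar>along L (an n) (an' n) (sn n) \<eta>\<bar> \<le> K" for n \<eta>
      by (rule speed_field.along_le[OF fn' speed_field_C1.bound'[OF fn]])
  qed
  have "(\<lambda>n. integral {0..xn n} (\<lambda>\<eta>. along L (an n) (Fn' n) (sn n) \<eta> * jac L (an n) (an' n) (sn n) \<eta>))
    \<longlonglongrightarrow> integral {0..x} (\<lambda>\<eta>. along L a F' s \<eta> * jac L a a' s \<eta>)"
  proof (rule bounded_convergence_moving[OF _ _ f.zero_set_finite[of s] _ x])
    show "(\<lambda>\<eta>. along L (an n) (Fn' n) (sn n) \<eta> * jac L (an n) (an' n) (sn n) \<eta>) integrable_on {0..L}" for n
      by (rule speed_field_C1.rate_mult_jac_integrable[OF fn Fc Fb]) (use f.L_pos in auto)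
  next
    fix n \<eta> assume \<eta>: "\<eta> \<in> {0..L}"
    have "\<bar>along L (an n) (Fn' n) (sn n) \<eta>\<bar> \<le> C" by (rule speed_field.along_le[OF fn' Fb])
    then have "\<bar>along L (an n) (Fn' n) (sn n) \<eta>\<bar> * \<bar>jac L (an n) (an' n) (sn n) \<eta>\<bar> \<le> C * 2"
      using speed_field_C1.jac_bounds(1)[OF fn \<eta>, of n "sn n"]
        speed_field_C1.jac_pos[OF fn, of n "sn n" \<eta>] order_trans[OF abs_ge_zero Fb]
      by (intro mult_mono) auto
    then show "\<bar>along L (an n) (Fn' n) (sn n) \<eta> * jac L (an n) (an' n) (sn n) \<eta>\<bar> \<le> C * 2"
      by (simp add: abs_mult)
  next
    fix \<eta> assume \<eta>: "\<eta> \<in> {0..L} - {\<eta> \<in> {0..L}. flow L a s \<eta> = 0}"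
    show "(\<lambda>n. along L (an n) (Fn' n) (sn n) \<eta> * jac L (an n) (an' n) (sn n) \<eta>)
      \<longlonglongrightarrow> along L a F' s \<eta> * jac L a a' s \<eta>"
      by (intro tendsto_mult al[OF F' \<eta>] jm tendsto_const) (use \<eta> in auto)
  qed
  moreover have "(\<lambda>n. Vn' n (sn n)) \<longlonglongrightarrow> V' s" by (rule cconvD[OF V' sn])
  moreover have "(\<lambda>n. jac L (an n) (an' n) (sn n) (xn n)) \<longlonglongrightarrow> jac L a a' s x" by (rule jm[OF x])
  ultimately show ?thesis
    unfolding transport_rate_def Let_def case_prod_conv sn_def[symmetric] s_def[symmetric]
    by (intro tendsto_divide tendsto_add) (use f.jac_pos[of s x] in auto)
qed

lemma (in speed_field) transport_continuous:
  assumes V: "continuous_on UNIV V" and F: "continuous_on UNIV F" "\<And>p. \<bar>F p\<bar> \<le> C"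
    and t: "tn \<longlonglongrightarrow> t" and x: "xn \<longlonglongrightarrow> x" "\<And>n. xn n \<in> {0..L}"
  shows "(\<lambda>n. transport L a V F (tn n, xn n)) \<longlonglongrightarrow> transport L a V F (t, x)"
proof -
  define sn where "sn n = lab (tn n, xn n)" for n
  define s where "s = lab (t, x)"
  have xL: "x \<in> {0..L}" using closed_sequentially[OF closed_atLeastAtMost x(2) x(1)] .
  have "(\<lambda>n. 2 * \<bar>tn n - t\<bar> + 2 * A * \<bar>xn n - x\<bar>) \<longlonglongrightarrow> 2 * \<bar>t - t\<bar> + 2 * A * \<bar>x - x\<bar>"
    by (intro tendsto_intros t x)
  then have "(\<lambda>n. 2 * \<bar>tn n - t\<bar> + 2 * A * \<bar>xn n - x\<bar>) \<longlonglongrightarrow> 0" by simp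
  then have sn: "sn \<longlonglongrightarrow> s"
    by (rule tendsto_of_bound) (unfold sn_def s_def, rule label_lip[OF x(2) xL])
  have "(\<lambda>n. 2 * \<bar>sn n - s\<bar>) \<longlonglongrightarrow> 2 * \<bar>s - s\<bar>" by (intro tendsto_intros sn)
  then have "(\<lambda>n. 2 * \<bar>sn n - s\<bar>) \<longlonglongrightarrow> 0" by simp
  then have th: "(\<lambda>n. th (sn n) \<eta>) \<longlonglongrightarrow> th s \<eta>" if "\<eta> \<in> {0..L}" for \<eta>
    by (rule tendsto_of_bound) (rule flow_lip_label[OF that])
  have "(\<lambda>n. integral {0..xn n} (\<lambda>\<eta>. F (th (sn n) \<eta>, \<eta>))) \<longlonglongrightarrow> integral {0..x} (\<lambda>\<eta>. F (th s \<eta>, \<eta>))"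
    by (rule bounded_convergence_moving[where N = "{}" and C = C, OF _ _ _ _ x])
      (auto intro!: integrable_continuous_interval continuous_on_UNIV_compose[OF F(1)] continuous_intros flow_cont
        F(2) continuous_on_tendsto_UNIV[OF F(1)] tendsto_Pair th)
  then show ?thesis
    unfolding transport_def Let_def case_prod_conv sn_def[symmetric] s_def[symmetric]
    by (intro tendsto_add continuous_on_tendsto_UNIV[OF V] sn)
qed

section \<open>An antiderivative on the line, and elementary estimates\<close>

lemma antiderivative_exists:
  fixes Q :: "real \<Rightarrow> real"
  assumes "continuous_on UNIV Q"
  shows "\<exists>W. W 0 = 0 \<and> (\<forall>s. (W has_real_derivative Q s) (at s))"
proof -
  define W where "W u = (LBINT y=ereal 0..ereal u. Q y)" for u
  have "W 0 = 0" unfolding W_def by (rule interval_integral_endpoints_same)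
  moreover have "(W has_real_derivative Q s) (at s)" for s :: real
  proof -
    define c where "c = \<bar>s\<bar> + 1"
    have c: "- c \<le> 0" "0 \<le> c" "- c < s" "s < c" unfolding c_def by linarith+
    have "(W has_vector_derivative Q s) (at s within {-c..c})"
      unfolding W_def
      by (rule interval_integral_FTC2[OF c(1,2) continuous_on_subset[OF assms subset_UNIV]])
        (use c in linarith)+
    then have "(W has_vector_derivative Q s) (at s)"
      unfolding at_within_Icc_at[OF c(3,4)] .
    then show ?thesis unfolding has_real_derivative_iff_has_vector_derivative .
  qed
  ultimately show ?thesis by blast
qed

lemma abs_exp_diff_le:
  fixes u v :: real
  assumes "u \<le> 1/2" "v \<le> 1/2"
  shows "\<bar>exp u - exp v\<bar> \<le> 2 * \<bar>u - v\<bar>"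
proof -
  have half: "exp (1/2 :: real) \<le> 2"
  proof -
    have "exp (1/2 :: real) \<le> 1 + 1/2 + (1/2)\<^sup>2" by (rule exp_bound) auto
    then show ?thesis unfolding power2_eq_square by linarith
  qed
  have *: "exp u - exp v \<le> 2 * (u - v)" if "v \<le> u" "u \<le> 1/2" for u v :: real
  proof -
    have "1 - exp (v - u) \<le> u - v" using exp_ge_add_one_self[of "v - u"] by linarith
    then have "exp u * (1 - exp (v - u)) \<le> exp u * (u - v)" by (intro mult_left_mono) simp_all
    also have "\<dots> \<le> 2 * (u - v)"
      using that half by (intro mult_right_mono) (auto intro: order_trans[of _ "exp (1/2)"])
    finally show ?thesis by (simp add: algebra_simps mult_exp_exp)
  qed
  show ?thesis using *[of u v] *[of v u] assms by (cases "u \<le> v") auto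
qed

lemma exp_le_one_plus_double:
  fixes u :: real
  assumes "0 \<le> u" "u \<le> 1/2"
  shows "exp u \<le> 1 + 2 * u"
  using abs_exp_diff_le[of u 0] assms by simp

text \<open>The majorant is an exact derivative. After multiplication by
  \<open>exp (- \<Gamma> * x)\<close>, a source of size \<open>\<Gamma> * c\<close> contributes at
  most the fraction \<open>1 - exp (- \<Gamma> * x)\<close> of \<open>c\<close>.\<close>

lemma exp_weighted_integral_le:
  fixes g :: "real \<Rightarrow> real"
  assumes g: "g integrable_on {0..x}" "\<And>y. y \<in> {0..x} \<Longrightarrow> \<bar>g y\<bar> \<le> exp (\<Gamma> * y) * (\<Gamma> * c)" and x: "0 \<le> x"
  shows "\<bar>integral {0..x} g\<bar> \<le> (exp (\<Gamma> * x) - 1) * c"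
proof -
  have "((\<lambda>y. exp (\<Gamma> * y) * (\<Gamma> * c)) has_integral exp (\<Gamma> * x) * c - exp (\<Gamma> * 0) * c) {0..x}"
  proof (rule fundamental_theorem_of_calculus[OF x])
    fix y
    have "((\<lambda>y. exp (\<Gamma> * y) * c) has_real_derivative exp (\<Gamma> * y) * (\<Gamma> * c)) (at y within {0..x})"
      by (auto intro!: derivative_eq_intros)
    then show "((\<lambda>y. exp (\<Gamma> * y) * c) has_vector_derivative exp (\<Gamma> * y) * (\<Gamma> * c)) (at y within {0..x})"
      by (simp add: has_real_derivative_iff_has_vector_derivative)
  qed
  then have h: "((\<lambda>y. exp (\<Gamma> * y) * (\<Gamma> * c)) has_integral (exp (\<Gamma> * x) - 1) * c) {0..x}"
    by (simp add: left_diff_distrib)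
  have "norm (integral {0..x} g) \<le> integral {0..x} (\<lambda>y. exp (\<Gamma> * y) * (\<Gamma> * c))"
    by (rule integral_norm_bound_integral) (use g has_integral_integrable[OF h] in auto)
  also have "\<dots> = (exp (\<Gamma> * x) - 1) * c" by (rule integral_unique[OF h])
  finally show ?thesis by simp
qed

text \<open>The expression is \<open>(\<Gamma> - c) * u + c * (- v)\<close>, with non-negative
  weights of total \<Gamma>. This is where the sign of the damping enters: the zeroth-order coupling
  causes no growth of the sup norm.\<close>

lemma damped_le:
  fixes u v c d \<Gamma> :: real
  assumes "0 \<le> c" "c \<le> \<Gamma>" "\<bar>u\<bar> \<le> d" "\<bar>v\<bar> \<le> d"
  shows "\<bar>\<Gamma> * u - c * (u + v)\<bar> \<le> \<Gamma> * d"
proof -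
  have "\<bar>\<Gamma> * u - c * (u + v)\<bar> = \<bar>(\<Gamma> - c) * u + c * (- v)\<bar>" by (simp add: algebra_simps)
  also have "\<dots> \<le> \<bar>(\<Gamma> - c) * u\<bar> + \<bar>c * (- v)\<bar>" by (rule abs_triangle_ineq)
  also have "\<dots> = (\<Gamma> - c) * \<bar>u\<bar> + c * \<bar>v\<bar>" using assms by (simp add: abs_mult)
  also have "\<dots> \<le> (\<Gamma> - c) * d + c * d"
    using assms by (intro add_mono mult_left_mono) auto
  finally show ?thesis by (simp add: algebra_simps)
qed

lemma abs_mult_le: "\<bar>u\<bar> \<le> a \<Longrightarrow> \<bar>v\<bar> \<le> b \<Longrightarrow> \<bar>u * v\<bar> \<le> a * (b::real)"
  unfolding abs_mult by (intro mult_mono) auto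

lemma abs_mult_diff_le:
  fixes u v u' v' :: real
  assumes "\<bar>u - u'\<bar> \<le> a" "\<bar>v\<bar> \<le> b" "\<bar>u'\<bar> \<le> c" "\<bar>v - v'\<bar> \<le> d"
  shows "\<bar>u * v - u' * v'\<bar> \<le> a * b + c * d"
proof -
  have "u * v - u' * v' = (u - u') * v + u' * (v - v')" by (simp add: algebra_simps)
  then show ?thesis
    using abs_mult_le[OF assms(1,2)] abs_mult_le[OF assms(3,4)]
      abs_triangle_ineq[of "(u - u') * v" "u' * (v - v')"] by linarith
qed

lemma linear_form_le:
  fixes p q u v d P :: real
  assumes "\<bar>p\<bar> + \<bar>q\<bar> \<le> P" "\<bar>u\<bar> \<le> d" "\<bar>v\<bar> \<le> d"
  shows "\<bar>p * u + q * v\<bar> \<le> P * d"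
proof -
  have d: "0 \<le> d" using assms(2) by linarith
  have "\<bar>p * u + q * v\<bar> \<le> \<bar>p\<bar> * \<bar>u\<bar> + \<bar>q\<bar> * \<bar>v\<bar>"
    using abs_triangle_ineq[of "p * u" "q * v"] by (simp add: abs_mult)
  also have "\<dots> \<le> \<bar>p\<bar> * d + \<bar>q\<bar> * d" using assms by (intro add_mono mult_left_mono) auto
  also have "\<dots> \<le> P * d" using assms(1) d by (simp add: distrib_right[symmetric] mult_right_mono)
  finally show ?thesis .
qed

lemma product_rule_rearrange:
  fixes x s s' b b' u v :: real
  shows "x - ((s' * b + b' * s) * u + v * (s * b)) = x - s * b * v - (s' * b + s * b') * u"
  by (simp add: algebra_simps)

text \<open>Uniqueness is stated on an initial piece \<open>{0..c}\<close>, because the explicit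
  formula for a characteristic coming from the past holds only up to its crossing of
  \<open>t = 0\<close>.\<close>

lemma (in speed_field) flow_unique:
  assumes c: "0 \<le> c" "c \<le> L" and \<theta>: "continuous_on {0..c} \<theta>"
    and eq: "\<And>y. y \<in> {0..c} \<Longrightarrow> \<theta> y = s + integral {0..y} (\<lambda>\<eta>. a (\<theta> \<eta>, \<eta>))" and y: "y \<in> {0..c}"
  shows "th s y = \<theta> y"
proof -
  have "\<bar>th s y - \<theta> y\<bar> \<le> 2 * 0"
  proof (rule sup_absorb[of c "\<lambda>y. th s y - \<theta> y"])
    fix y m assume y: "y \<in> {0..c}" and m: "\<And>\<eta>. \<eta> \<in> {0..c} \<Longrightarrow> \<bar>th s \<eta> - \<theta> \<eta>\<bar> \<le> m"
    have "\<bar>integral {0..y} (\<lambda>\<eta>. a (th s \<eta>, \<eta>)) - integral {0..y} (\<lambda>\<eta>. a (\<theta> \<eta>, \<eta>))\<bar> \<le> m / 4"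
      by (rule along_diff) (use y m c flow_cont \<theta> in \<open>auto intro: continuous_on_subset\<close>)
    then show "\<bar>th s y - \<theta> y\<bar> \<le> 0 + m / 4"
      using flow_eq[of y s] eq[OF y] y c by simp
  qed (use c y \<theta> in \<open>auto intro!: continuous_intros flow_cont\<close>)
  then show ?thesis by simp
qed

context speed_field_C1
begin

text \<open>The ratio of \<open>jac\<close> at \<open>\<eta>\<close> and at \<open>x\<close>.
  Written as one exponential it stays within order \<open>K * L\<close> of 1, which the separate
  bounds 2 and 1/2 for \<open>jac\<close> would not show; in the iteration \<open>K\<close> is
  proportional to \<open>M\<close>.\<close>

definition iota :: "real \<Rightarrow> real \<Rightarrow> real \<Rightarrow> real" where
  "iota s x \<eta> = exp (integral {0..\<eta>} (along L a a' s) - integral {0..x} (along L a a' s))"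

lemma transport_rate_eq:
  assumes x: "x \<in> {0..L}"
  shows "transport_rate L a a' V' F' (t, x) = V' (lab (t, x)) * iota (lab (t, x)) x 0
    + integral {0..x} (\<lambda>\<eta>. along L a F' (lab (t, x)) \<eta> * iota (lab (t, x)) x \<eta>)"
proof -
  let ?s = "lab (t, x)"
  have i: "iota ?s x \<eta> = j ?s \<eta> / j ?s x" for \<eta> by (simp add: iota_def jac_def exp_diff)
  have "integral {0..x} (\<lambda>\<eta>. along L a F' ?s \<eta> * iota ?s x \<eta>)
    = integral {0..x} (\<lambda>\<eta>. along L a F' ?s \<eta> * j ?s \<eta>) / j ?s x"
    unfolding i by (simp add: divide_inverse mult.assoc[symmetric])
  moreover have "iota ?s x 0 = 1 / j ?s x" by (simp add: i) (simp add: jac_def)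
  ultimately show ?thesis by (simp add: transport_rate_def Let_def add_divide_distrib)
qed

lemma iota_exponent:
  assumes "x \<in> {0..L}" "\<eta> \<in> {0..L}"
  shows "\<bar>integral {0..\<eta>} (along L a a' s) - integral {0..x} (along L a a' s)\<bar> \<le> 2 * (K * L)"
proof -
  have "K * \<eta> \<le> K * L" "K * x \<le> K * L" using assms K_nonneg by (auto intro!: mult_left_mono)
  then show ?thesis
    using jac_exponent[OF assms(1), of s] jac_exponent[OF assms(2), of s] by argo
qed

lemma iota_bound:
  assumes "x \<in> {0..L}" "\<eta> \<in> {0..L}"
  shows "\<bar>iota s x \<eta>\<bar> \<le> 1 + 4 * (K * L)"
proof -
  have "exp (integral {0..\<eta>} (along L a a' s) - integral {0..x} (along L a a' s)) \<le> exp (2 * (K * L))"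
    using iota_exponent[OF assms, of s] by simp
  also have "\<dots> \<le> 1 + 2 * (2 * (K * L))"
    using KL K_nonneg L_pos by (intro exp_le_one_plus_double) auto
  finally show ?thesis by (simp add: iota_def)
qed

lemma rate_mult_iota_integrable:
  assumes "continuous_on UNIV g" "\<And>p. \<bar>g p\<bar> \<le> C" "x \<in> {0..L}"
  shows "(\<lambda>\<eta>. along L a g s \<eta> * iota s x \<eta>) integrable_on {0..x}"
proof -
  have "(\<lambda>\<eta>. along L a g s \<eta> * j s \<eta> / j s x) integrable_on {0..x}"
    by (intro integrable_on_divide rate_mult_jac_integrable[OF assms])
  then show ?thesis by (simp add: iota_def jac_def exp_diff)
qed

end

section \<open>The iteration\<close>

text \<open>\<open>M\<close> bounds the iterates and their time derivatives, and \<open>\<epsilon>0\<close> bounds the data. \<open>D\<close> is chosen so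
  that \<open>D M\<close> dominates the errors by which the nonlinear iteration misses the factors
  \<open>1 - (1 - \<kappa>) exp (- \<Gamma> L)\<close> and \<open>1 - (1 - \<kappa>') exp (- \<Gamma> L)\<close>.\<close>

locale riemann_system =
  fixes L c0 B P \<Gamma> Ca C3 D M \<kappa> \<kappa>' \<epsilon>0 :: real
    and p q \<kappa>s :: "bool \<Rightarrow> real"
    and b b' :: "bool \<Rightarrow> real \<times> real \<Rightarrow> real"
    and h h' :: "bool \<Rightarrow> real \<Rightarrow> real"
    and f0 f0' q0 :: "bool \<Rightarrow> real \<Rightarrow> real"
  assumes L_pos: "0 < L" and c0: "0 < c0" and B: "0 < B" and P: "0 \<le> P" "\<bar>p k\<bar> + \<bar>q k\<bar> \<le> P"
    and \<Gamma>: "\<Gamma> = 2 / c0 * B" and Ca: "Ca = 4 / c0\<^sup>2 * P" and C3: "C3 = 2 * (Ca * B + 2 / c0)"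
    and D: "D = 9 * L * Ca + (C3 + (3 * \<Gamma> + C3) * (10 * L * Ca)) / \<Gamma>"
    and M: "0 < M" "M \<le> 1" and \<kappa>: "0 \<le> \<kappa>" "\<bar>\<kappa>s k\<bar> \<le> \<kappa>" "\<kappa> \<le> \<kappa>'" "\<kappa>' < 1"
    and b: "half_C1 M (b k) (b' k)" and b_range: "0 \<le> b k z" "b k z \<le> B"
    and h: "continuous_on UNIV (h k)" "continuous_on UNIV (h' k)"
      "0 < s \<Longrightarrow> (h k has_real_derivative h' k s) (at s)" "s \<le> 0 \<Longrightarrow> h k s = h k 0"
      "\<bar>h k s\<bar> \<le> \<epsilon>0" "\<bar>h' k s\<bar> \<le> \<epsilon>0"
    and f0: "x \<in> {0..L} \<Longrightarrow> (f0 k has_real_derivative f0' k x) (at x within {0..L})"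
      "x \<in> {0..L} \<Longrightarrow> \<bar>f0 k x\<bar> + \<epsilon>0 \<le> M"
    and q0: "continuous_on {0..L} (q0 k)" "x \<in> {0..L} \<Longrightarrow> exp (\<Gamma> * L) * \<bar>q0 k x\<bar> \<le> \<epsilon>0"
    and init_pde: "x \<in> {0..L} \<Longrightarrow> (c0 + p k * f0 k x + q k * f0 (\<not> k) (L - x)) * f0' k x
      = - b k (0, x) * (f0 k x + f0 (\<not> k) (L - x)) - q0 k x"
    and compat0: "f0 k 0 = h k 0 + \<kappa>s k * f0 (\<not> k) L"
    and compat1: "q0 k 0 = h' k 0 + \<kappa>s k * q0 (\<not> k) L"
    and sm_V: "\<kappa> * M + 2 * \<epsilon>0 + 2 / c0 * L * \<epsilon>0 \<le> \<kappa>' * M"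
    and sm_P: "2 * (P * M) \<le> c0" and sm_Ca: "4 * (Ca * M * L) \<le> 1"
    and sm_D: "D * M < (1 - \<kappa>') * exp (- \<Gamma> * L)"
begin

section \<open>Frozen coefficients: bounds, Lipschitz constants and differences\<close>

lemma \<Gamma>_pos: "0 < \<Gamma>" using \<Gamma> c0 B by simp
lemma Ca_nonneg: "0 \<le> Ca" using Ca c0 P by simp
lemma C3_nonneg: "0 \<le> C3" using C3 Ca_nonneg c0 B by simp
lemma \<epsilon>0_nonneg: "0 \<le> \<epsilon>0" using order_trans[OF abs_ge_zero h(5)] .
lemma CaM_nonneg: "0 \<le> Ca * M" using Ca_nonneg M by simp

text \<open>The speed of invariant \<open>k\<close> towards its outflow end. Each invariant is
  parametrised from its own inflow end, so the other one is read at \<open>L - x\<close>.\<close>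

definition den :: "(bool \<Rightarrow> real \<times> real \<Rightarrow> real) \<Rightarrow> bool \<Rightarrow> real \<times> real \<Rightarrow> real" where
  "den f k = (\<lambda>(t, x). c0 + p k * f k (t, x) + q k * f (\<not> k) (t, L - x))"

definition spd :: "(bool \<Rightarrow> real \<times> real \<Rightarrow> real) \<Rightarrow> bool \<Rightarrow> real \<times> real \<Rightarrow> real" where
  "spd f k = (\<lambda>z. 1 / den f k z)"

definition spd' :: "(bool \<Rightarrow> real \<times> real \<Rightarrow> real) \<Rightarrow> (bool \<Rightarrow> real \<times> real \<Rightarrow> real) \<Rightarrow> bool \<Rightarrow> real \<times> real \<Rightarrow> real" where
  "spd' f r k = (\<lambda>(t, x). - (spd f k (t, x))\<^sup>2 * (p k * r k (t, x) + q k * r (\<not> k) (t, L - x)))"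

definition src :: "(bool \<Rightarrow> real \<times> real \<Rightarrow> real) \<Rightarrow> bool \<Rightarrow> real \<times> real \<Rightarrow> real" where
  "src f k = (\<lambda>(t, x). \<Gamma> * f k (t, x) - spd f k (t, x) * b k (t, x) * (f k (t, x) + f (\<not> k) (t, L - x)))"

definition src' :: "(bool \<Rightarrow> real \<times> real \<Rightarrow> real) \<Rightarrow> (bool \<Rightarrow> real \<times> real \<Rightarrow> real) \<Rightarrow> bool \<Rightarrow> real \<times> real \<Rightarrow> real" where
  "src' f r k = (\<lambda>(t, x). \<Gamma> * r k (t, x) - spd f k (t, x) * b k (t, x) * (r k (t, x) + r (\<not> k) (t, L - x))
     - (spd' f r k (t, x) * b k (t, x) + spd f k (t, x) * b' k (t, x)) * (f k (t, x) + f (\<not> k) (t, L - x)))"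

text \<open>The integrating factor turns \<open>f\<^sub>x + a f\<^sub>t + \<Gamma> f = src\<close>
  into a pure transport equation for \<open>exp (\<Gamma> * x) * f\<close>.\<close>

definition wsrc :: "(bool \<Rightarrow> real \<times> real \<Rightarrow> real) \<Rightarrow> bool \<Rightarrow> real \<times> real \<Rightarrow> real" where
  "wsrc f k = (\<lambda>(t, x). exp (\<Gamma> * clip L x) * src f k (t, x))"

definition wsrc' :: "(bool \<Rightarrow> real \<times> real \<Rightarrow> real) \<Rightarrow> (bool \<Rightarrow> real \<times> real \<Rightarrow> real) \<Rightarrow> bool \<Rightarrow> real \<times> real \<Rightarrow> real" where
  "wsrc' f r k = (\<lambda>(t, x). exp (\<Gamma> * clip L x) * src' f r k (t, x))"

text \<open>Lipschitz in time rather than differentiable, so that the class is closed under uniform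
  limits. The Lipschitz constant equals the bound imposed on the rates.\<close>

definition adm :: "(bool \<Rightarrow> real \<times> real \<Rightarrow> real) \<Rightarrow> bool" where
  "adm f \<longleftrightarrow> (\<forall>k. continuous_on UNIV (f k) \<and> (\<forall>z. \<bar>f k z\<bar> \<le> M) \<and>
     (\<forall>t t' x. \<bar>f k (t, x) - f k (t', x)\<bar> \<le> M * \<bar>t - t'\<bar>) \<and>
     (\<forall>t x. t \<le> 0 \<longrightarrow> f k (t, x) = f0 k (clip L x)))"

text \<open>In the past a rate is frozen at \<open>q0\<close>, the time derivative which the
  equation and the initial datum force at \<open>t = 0\<close>, although the iterates are constant
  there.\<close>

definition adm_rate :: "(bool \<Rightarrow> real \<times> real \<Rightarrow> real) \<Rightarrow> bool" where
  "adm_rate r \<longleftrightarrow> (\<forall>k. continuous_on UNIV (r k) \<and> (\<forall>z. \<bar>r k z\<bar> \<le> M) \<and>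
     (\<forall>t x. t \<le> 0 \<longrightarrow> r k (t, x) = q0 k (clip L x)))"

lemma admD:
  assumes "adm f"
  shows "continuous_on UNIV (f k)" "\<bar>f k z\<bar> \<le> M" "\<bar>f k (t, x) - f k (t', x)\<bar> \<le> M * \<bar>t - t'\<bar>"
    "t \<le> 0 \<Longrightarrow> f k (t, x) = f0 k (clip L x)"
  using assms unfolding adm_def by blast+

lemma adm_rateD:
  assumes "adm_rate r"
  shows "continuous_on UNIV (r k)" "\<bar>r k z\<bar> \<le> M" "t \<le> 0 \<Longrightarrow> r k (t, x) = q0 k (clip L x)"
  using assms unfolding adm_rate_def by blast+

lemma adm_past: "adm f \<Longrightarrow> t \<le> 0 \<Longrightarrow> f k (t, x) = f k (0, x)"
  using admD(4)[of f t k x] admD(4)[of f 0 k x] by simp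

lemma half_C1_adm:
  assumes "adm f" "adm_rate r" "\<And>k t x. 0 < t \<Longrightarrow> ((\<lambda>t. f k (t, x)) has_real_derivative r k (t, x)) (at t)"
  shows "half_C1 M (f k) (r k)"
  unfolding half_C1_def
proof (intro conjI allI impI)
  fix t x :: real assume "t \<le> 0"
  then show "f k (t, x) = f k (0, x)" by (rule adm_past[OF assms(1)])
qed (use admD(1,2)[OF assms(1)] adm_rateD(1,2)[OF assms(2)] assms(3) in auto)

lemma den_bounds:
  assumes "adm f"
  shows "c0 / 2 \<le> den f k z" "den f k z \<le> 3 / 2 * c0"
proof -
  obtain t x where z: "z = (t, x)" by (cases z)
  have "\<bar>p k * f k (t, x) + q k * f (\<not> k) (t, L - x)\<bar> \<le> P * M"
    by (intro linear_form_le P admD[OF assms])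
  then show "c0 / 2 \<le> den f k z" "den f k z \<le> 3 / 2 * c0"
    using sm_P by (auto simp: den_def z abs_le_iff)
qed

lemma den_pos: "adm f \<Longrightarrow> 0 < den f k z"
  using den_bounds(1)[of f k z] c0 by linarith

lemma den_cont: "adm f \<Longrightarrow> continuous_on UNIV (den f k)"
  unfolding den_def case_prod_beta
  by (intro continuous_intros continuous_on_UNIV_compose[OF admD(1)])

lemma spd_cont: "adm f \<Longrightarrow> continuous_on UNIV (spd f k)"
  unfolding spd_def by (intro continuous_intros den_cont ballI less_imp_neq[symmetric] den_pos)

lemma spd_bounds:
  assumes "adm f"
  shows "0 < spd f k z" "spd f k z \<le> 2 / c0"
proof -
  show "0 < spd f k z" using den_pos[OF assms] by (simp add: spd_def)
  have "1 / den f k z \<le> 1 / (c0 / 2)"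
    using den_bounds(1)[OF assms] c0 by (intro divide_left_mono) (auto intro!: mult_pos_pos den_pos assms)
  then show "spd f k z \<le> 2 / c0" by (simp add: spd_def)
qed

lemma spd_diff:
  assumes "adm f" "adm g" "\<bar>den f k z - den g k z'\<bar> \<le> P * d"
  shows "\<bar>spd f k z - spd g k z'\<bar> \<le> Ca * d"
proof -
  have d: "spd f k z - spd g k z' = spd f k z * spd g k z' * - (den f k z - den g k z')"
    using den_pos[OF assms(1), of k z] den_pos[OF assms(2), of k z'] by (simp add: spd_def field_simps)
  have "\<bar>spd f k z * spd g k z'\<bar> \<le> 2 / c0 * (2 / c0)"
    using spd_bounds[OF assms(1), of k z] spd_bounds[OF assms(2), of k z'] by (intro abs_mult_le) auto
  then have "\<bar>spd f k z * spd g k z' * - (den f k z - den g k z')\<bar> \<le> 2 / c0 * (2 / c0) * (P * d)"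
    by (rule abs_mult_le) (use assms(3) in auto)
  then show ?thesis unfolding d Ca power2_eq_square by simp
qed

lemma den_diff:
  assumes "\<And>k t x. \<bar>f k (t, x) - g k (t, x)\<bar> \<le> d"
  shows "\<bar>den f k z - den g k z\<bar> \<le> P * d"
proof -
  obtain t x where z: "z = (t, x)" by (cases z)
  have "den f k z - den g k z = p k * (f k (t, x) - g k (t, x)) + q k * (f (\<not> k) (t, L - x) - g (\<not> k) (t, L - x))"
    by (simp add: den_def z algebra_simps)
  then show ?thesis using linear_form_le[OF P(2) assms assms] by metis
qed

lemma den_lip:
  assumes "adm f"
  shows "\<bar>den f k (t, x) - den f k (t', x)\<bar> \<le> P * (M * \<bar>t - t'\<bar>)"
proof -
  have "den f k (t, x) - den f k (t', x)
    = p k * (f k (t, x) - f k (t', x)) + q k * (f (\<not> k) (t, L - x) - f (\<not> k) (t', L - x))"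
    by (simp add: den_def algebra_simps)
  then show ?thesis using linear_form_le[OF P(2) admD(3)[OF assms] admD(3)[OF assms]] by metis
qed

lemma speed_field_spd: "adm f \<Longrightarrow> speed_field L (2 / c0) (Ca * M) (spd f k)"
proof
  fix t t' x assume f: "adm f"
  show "\<bar>spd f k (t, x) - spd f k (t', x)\<bar> \<le> Ca * M * \<bar>t - t'\<bar>"
    using spd_diff[OF f f den_lip[OF f]] by (simp add: mult.assoc)
qed (use L_pos c0 CaM_nonneg sm_Ca spd_cont spd_bounds in \<open>auto simp: mult.assoc\<close>)

lemma spd'_bound:
  assumes "adm f" "adm_rate r"
  shows "\<bar>spd' f r k z\<bar> \<le> Ca * M"
proof -
  obtain t x where z: "z = (t, x)" by (cases z)
  have "\<bar>- (spd f k (t, x))\<^sup>2\<bar> \<le> 2 / c0 * (2 / c0)"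
    using spd_bounds[OF assms(1), of k "(t, x)"]
    unfolding power2_eq_square abs_minus_cancel by (intro abs_mult_le) auto
  then have "\<bar>spd' f r k z\<bar> \<le> 2 / c0 * (2 / c0) * (P * M)"
    unfolding z spd'_def case_prod_conv
    by (intro abs_mult_le linear_form_le P adm_rateD[OF assms(2)])
  then show ?thesis unfolding Ca power2_eq_square by simp
qed

lemma spd'_cont: "adm f \<Longrightarrow> adm_rate r \<Longrightarrow> continuous_on UNIV (spd' f r k)"
  unfolding spd'_def case_prod_beta prod.collapse
  by (intro continuous_intros continuous_on_UNIV_compose[OF adm_rateD(1)] spd_cont)

lemma speed_field_C1_spd: "adm f \<Longrightarrow> adm_rate r \<Longrightarrow> speed_field_C1 L (2 / c0) (Ca * M) (spd f k) (spd' f r k)"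
  by (intro speed_field_C1.intro speed_field_spd speed_field_C1_axioms.intro spd'_cont spd'_bound)

lemma spd'_diff:
  assumes f: "adm f" and "\<bar>r1 k (t, x) - r2 k (t, x)\<bar> \<le> d" "\<bar>r1 (\<not> k) (t, L - x) - r2 (\<not> k) (t, L - x)\<bar> \<le> d"
  shows "\<bar>spd' f r1 k (t, x) - spd' f r2 k (t, x)\<bar> \<le> Ca * d"
proof -
  have eq: "spd' f r1 k (t, x) - spd' f r2 k (t, x) = - (spd f k (t, x))\<^sup>2 *
      (p k * (r1 k (t, x) - r2 k (t, x)) + q k * (r1 (\<not> k) (t, L - x) - r2 (\<not> k) (t, L - x)))"
    by (simp add: spd'_def algebra_simps)
  have "\<bar>- (spd f k (t, x))\<^sup>2\<bar> \<le> 2 / c0 * (2 / c0)"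
    using spd_bounds[OF f, of k "(t, x)"]
    unfolding power2_eq_square abs_minus_cancel by (intro abs_mult_le) auto
  then have "\<bar>spd' f r1 k (t, x) - spd' f r2 k (t, x)\<bar> \<le> 2 / c0 * (2 / c0) * (P * d)"
    unfolding eq by (intro abs_mult_le linear_form_le P assms)
  then show ?thesis unfolding Ca power2_eq_square by simp
qed

lemma spd_b_bounds:
  assumes "adm f" shows "0 \<le> spd f k z * b k z" "spd f k z * b k z \<le> \<Gamma>"
proof -
  show "0 \<le> spd f k z * b k z" using spd_bounds(1)[OF assms, of k z] b_range(1)[of k z] by simp
  show "spd f k z * b k z \<le> \<Gamma>" unfolding \<Gamma>
    using spd_bounds[OF assms, of k z] b_range[of k z] c0 by (intro mult_mono) auto
qed

lemma src_bound: "adm f \<Longrightarrow> \<bar>src f k z\<bar> \<le> \<Gamma> * M"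
  by (cases z) (auto simp: src_def intro!: damped_le spd_b_bounds admD)

lemma sum_bound: "adm f \<Longrightarrow> \<bar>f k z + f k' z'\<bar> \<le> 2 * M"
  using admD(2)[of f k z] admD(2)[of f k' z'] by linarith

text \<open>The damping terms keep the exact factor \<Gamma>. Each remaining term is a rate of the
  speed or of \<open>b\<close>, multiplied by a sum of invariants; both factors are of order
  \<open>M\<close>, so the excess is quadratic.\<close>

lemma src'_bound:
  assumes "adm f" "adm_rate r"
  shows "\<bar>src' f r k z\<bar> \<le> \<Gamma> * (M + C3 / \<Gamma> * M\<^sup>2)"
proof -
  obtain t x where z: "z = (t, x)" by (cases z)
  have 1: "\<bar>\<Gamma> * r k (t, x) - spd f k (t, x) * b k (t, x) * (r k (t, x) + r (\<not> k) (t, L - x))\<bar> \<le> \<Gamma> * M"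
    by (intro damped_le spd_b_bounds assms adm_rateD)
  have "\<bar>spd' f r k (t, x) * b k (t, x)\<bar> \<le> Ca * M * B"
    using b_range[of k "(t, x)"] by (intro abs_mult_le spd'_bound assms) auto
  moreover have "\<bar>spd f k (t, x) * b' k (t, x)\<bar> \<le> 2 / c0 * M"
    using half_C1D(3)[OF b] spd_bounds[OF assms(1), of k "(t, x)"] by (intro abs_mult_le) auto
  ultimately have "\<bar>spd' f r k (t, x) * b k (t, x) + spd f k (t, x) * b' k (t, x)\<bar> \<le> Ca * M * B + 2 / c0 * M"
    by linarith
  then have "\<bar>(spd' f r k (t, x) * b k (t, x) + spd f k (t, x) * b' k (t, x)) * (f k (t, x) + f (\<not> k) (t, L - x))\<bar>
    \<le> (Ca * M * B + 2 / c0 * M) * (2 * M)"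
    by (intro abs_mult_le sum_bound assms)
  with 1 have "\<bar>src' f r k z\<bar> \<le> \<Gamma> * M + (Ca * M * B + 2 / c0 * M) * (2 * M)"
    unfolding z src'_def case_prod_conv by linarith
  also have "\<dots> = \<Gamma> * (M + C3 / \<Gamma> * M\<^sup>2)"
    using \<Gamma>_pos c0 by (simp add: C3 field_simps power2_eq_square)
  finally show ?thesis .
qed

lemma src_lip:
  assumes "adm f"
  shows "\<bar>src f k (t, x) - src f k (t', x)\<bar> \<le> (3 * \<Gamma> + C3) * M * \<bar>t - t'\<bar>"
proof -
  let ?d = "\<bar>t - t'\<bar>"
  have sb: "\<bar>spd f k (t, x) * b k (t, x) - spd f k (t', x) * b k (t', x)\<bar> \<le> Ca * (M * ?d) * B + 2 / c0 * (M * ?d)"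
    using b_range[of k "(t, x)"] spd_bounds[OF assms, of k "(t', x)"]
    by (intro abs_mult_diff_le spd_diff[OF assms assms den_lip[OF assms]] half_C1_lip[OF b]) auto
  have ff: "\<bar>(f k (t, x) + f (\<not> k) (t, L - x)) - (f k (t', x) + f (\<not> k) (t', L - x))\<bar> \<le> 2 * (M * ?d)"
    using admD(3)[OF assms, of k t x t'] admD(3)[OF assms, of "\<not> k" t "L - x" t'] by linarith
  have "\<bar>spd f k (t, x) * b k (t, x) * (f k (t, x) + f (\<not> k) (t, L - x)) -
      spd f k (t', x) * b k (t', x) * (f k (t', x) + f (\<not> k) (t', L - x))\<bar>
    \<le> (Ca * (M * ?d) * B + 2 / c0 * (M * ?d)) * (2 * M) + \<Gamma> * (2 * (M * ?d))"
    using spd_b_bounds[OF assms, of k "(t', x)"] by (intro abs_mult_diff_le sb ff sum_bound assms) auto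
  moreover have "\<bar>\<Gamma> * f k (t, x) - \<Gamma> * f k (t', x)\<bar> \<le> \<Gamma> * (M * ?d)"
    using admD(3)[OF assms, of k t x t'] \<Gamma>_pos by (simp add: right_diff_distrib[symmetric] abs_mult)
  ultimately have "\<bar>src f k (t, x) - src f k (t', x)\<bar> \<le>
      \<Gamma> * (M * ?d) + ((Ca * (M * ?d) * B + 2 / c0 * (M * ?d)) * (2 * M) + \<Gamma> * (2 * (M * ?d)))"
    unfolding src_def case_prod_conv by linarith
  also have "\<dots> = (3 * \<Gamma> + C3 * M) * (M * ?d)" by (simp add: C3 algebra_simps)
  also have "\<dots> \<le> (3 * \<Gamma> + C3 * 1) * (M * ?d)"
    using C3_nonneg M by (intro mult_right_mono add_mono mult_left_mono) auto
  finally show ?thesis by (simp add: mult.assoc)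
qed

lemma src_diff:
  assumes "adm f" "adm g" "\<And>k t x. \<bar>f k (t, x) - g k (t, x)\<bar> \<le> d"
  shows "\<bar>src f k z - src g k z\<bar> \<le> (\<Gamma> + C3 * M) * d"
proof -
  obtain t x where z: "z = (t, x)" by (cases z)
  have d: "0 \<le> d" using order_trans[OF abs_ge_zero assms(3)] .
  have eq: "src f k z - src g k z = (\<Gamma> * (f k (t, x) - g k (t, x))
      - spd f k (t, x) * b k (t, x) * ((f k (t, x) - g k (t, x)) + (f (\<not> k) (t, L - x) - g (\<not> k) (t, L - x))))
      - (spd f k (t, x) - spd g k (t, x)) * b k (t, x) * (g k (t, x) + g (\<not> k) (t, L - x))"
    by (simp add: src_def z algebra_simps)
  have "\<bar>\<Gamma> * (f k (t, x) - g k (t, x)) - spd f k (t, x) * b k (t, x) *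
      ((f k (t, x) - g k (t, x)) + (f (\<not> k) (t, L - x) - g (\<not> k) (t, L - x)))\<bar> \<le> \<Gamma> * d"
    by (intro damped_le spd_b_bounds assms)
  moreover have "\<bar>(spd f k (t, x) - spd g k (t, x)) * b k (t, x) * (g k (t, x) + g (\<not> k) (t, L - x))\<bar>
      \<le> Ca * d * B * (2 * M)"
    using b_range[of k "(t, x)"] by (intro abs_mult_le sum_bound spd_diff assms den_diff) auto
  ultimately have "\<bar>src f k z - src g k z\<bar> \<le> \<Gamma> * d + Ca * d * B * (2 * M)"
    unfolding eq by linarith
  also have "\<dots> = (\<Gamma> + (2 * (Ca * B)) * M) * d" by (simp add: algebra_simps)
  also have "\<dots> \<le> (\<Gamma> + C3 * M) * d"
    using d M c0 C3 by (intro mult_right_mono add_left_mono) auto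
  finally show ?thesis .
qed

lemma src'_diff:
  assumes f: "adm f" and r: "\<bar>r1 k (t, x) - r2 k (t, x)\<bar> \<le> d" "\<bar>r1 (\<not> k) (t, L - x) - r2 (\<not> k) (t, L - x)\<bar> \<le> d"
  shows "\<bar>src' f r1 k (t, x) - src' f r2 k (t, x)\<bar> \<le> (\<Gamma> + C3 * M) * d"
proof -
  have d: "0 \<le> d" using order_trans[OF abs_ge_zero r(1)] .
  have eq: "src' f r1 k (t, x) - src' f r2 k (t, x) = (\<Gamma> * (r1 k (t, x) - r2 k (t, x))
      - spd f k (t, x) * b k (t, x) * ((r1 k (t, x) - r2 k (t, x)) + (r1 (\<not> k) (t, L - x) - r2 (\<not> k) (t, L - x))))
      - (spd' f r1 k (t, x) - spd' f r2 k (t, x)) * b k (t, x) * (f k (t, x) + f (\<not> k) (t, L - x))"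
    by (simp add: src'_def algebra_simps)
  have "\<bar>\<Gamma> * (r1 k (t, x) - r2 k (t, x)) - spd f k (t, x) * b k (t, x) *
      ((r1 k (t, x) - r2 k (t, x)) + (r1 (\<not> k) (t, L - x) - r2 (\<not> k) (t, L - x)))\<bar> \<le> \<Gamma> * d"
    by (intro damped_le spd_b_bounds f r)
  moreover have "\<bar>(spd' f r1 k (t, x) - spd' f r2 k (t, x)) * b k (t, x) * (f k (t, x) + f (\<not> k) (t, L - x))\<bar>
      \<le> Ca * d * B * (2 * M)"
    using b_range[of k "(t, x)"] by (intro abs_mult_le sum_bound spd'_diff f r) auto
  ultimately have "\<bar>src' f r1 k (t, x) - src' f r2 k (t, x)\<bar> \<le> \<Gamma> * d + Ca * d * B * (2 * M)"
    unfolding eq by linarith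
  also have "\<dots> = (\<Gamma> + (2 * (Ca * B)) * M) * d" by (simp add: algebra_simps)
  also have "\<dots> \<le> (\<Gamma> + C3 * M) * d"
    using d M c0 C3 by (intro mult_right_mono add_left_mono) auto
  finally show ?thesis .
qed

lemma wsrc_cont:
  assumes "adm f" shows "continuous_on UNIV (wsrc f k)"
  unfolding wsrc_def src_def case_prod_beta prod.collapse
  by (intro continuous_intros continuous_on_UNIV_compose[OF admD(1)[OF assms]] spd_cont assms half_C1D(1)[OF b])

lemma wsrc'_cont:
  assumes "adm f" "adm_rate r" shows "continuous_on UNIV (wsrc' f r k)"
  unfolding wsrc'_def src'_def case_prod_beta prod.collapse
  by (intro continuous_intros continuous_on_UNIV_compose[OF admD(1)[OF assms(1)]]
    continuous_on_UNIV_compose[OF adm_rateD(1)[OF assms(2)]] spd_cont spd'_cont assms half_C1D(1,2)[OF b])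

lemma exp_clip_le: "exp (\<Gamma> * clip L x) \<le> exp (\<Gamma> * L)"
  using \<Gamma>_pos L_pos by (simp add: clip_def)

lemma wsrc_bound: "adm f \<Longrightarrow> \<bar>wsrc f k z\<bar> \<le> exp (\<Gamma> * L) * (\<Gamma> * M)"
  unfolding wsrc_def case_prod_beta prod.collapse
  by (intro abs_mult_le src_bound) (simp_all only: abs_exp_cancel exp_clip_le)

lemma wsrc'_bound: "adm f \<Longrightarrow> adm_rate r \<Longrightarrow> \<bar>wsrc' f r k z\<bar> \<le> exp (\<Gamma> * L) * (\<Gamma> * (M + C3 / \<Gamma> * M\<^sup>2))"
  unfolding wsrc'_def case_prod_beta prod.collapse
  by (intro abs_mult_le src'_bound) (simp_all only: abs_exp_cancel exp_clip_le)

lemma spd_DERIV: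
  assumes f: "adm f" and d: "\<And>k t x. 0 < t \<Longrightarrow> ((\<lambda>t. f k (t, x)) has_real_derivative r k (t, x)) (at t)" and t: "0 < t"
  shows "((\<lambda>t. spd f k (t, x)) has_real_derivative spd' f r k (t, x)) (at t)"
proof -
  have "((\<lambda>t. den f k (t, x)) has_real_derivative p k * r k (t, x) + q k * r (\<not> k) (t, L - x)) (at t)"
    unfolding den_def case_prod_conv by (auto intro!: derivative_eq_intros d t)
  then have "((\<lambda>t. inverse (den f k (t, x))) has_real_derivative
      - (inverse (den f k (t, x)) * (p k * r k (t, x) + q k * r (\<not> k) (t, L - x)) * inverse (den f k (t, x)))) (at t)"
    by (rule DERIV_inverse') (use den_pos[OF f, of k "(t, x)"] in auto)
  then show ?thesis by (simp add: spd_def spd'_def inverse_eq_divide power2_eq_square mult_ac)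
qed

lemma half_C1_spd:
  assumes f: "adm f" and r: "adm_rate r"
    and d: "\<And>k t x. 0 < t \<Longrightarrow> ((\<lambda>t. f k (t, x)) has_real_derivative r k (t, x)) (at t)"
  shows "half_C1 (Ca * M) (spd f k) (spd' f r k)"
  unfolding half_C1_def
proof (intro conjI allI impI)
  fix t x :: real assume "t \<le> 0"
  then have "f k (t, x) = f k (0, x)" for k x by (rule adm_past[OF f])
  then show "spd f k (t, x) = spd f k (0, x)" by (simp add: spd_def den_def)
qed (use spd_cont[OF f] spd'_cont[OF f r] spd'_bound[OF f r] spd_DERIV[OF f d] in auto)

lemma half_C1_wsrc:
  assumes f: "adm f" and r: "adm_rate r"
    and d: "\<And>k t x. 0 < t \<Longrightarrow> ((\<lambda>t. f k (t, x)) has_real_derivative r k (t, x)) (at t)"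
  shows "half_C1 (exp (\<Gamma> * L) * (\<Gamma> * (M + C3 / \<Gamma> * M\<^sup>2))) (wsrc f k) (wsrc' f r k)"
  unfolding half_C1_def
proof (intro conjI allI impI)
  fix t x :: real assume t: "t \<le> 0"
  then have "f k (t, x) = f k (0, x)" for k x by (rule adm_past[OF f])
  moreover have "b k (t, x) = b k (0, x)" by (rule half_C1D(6)[OF b t])
  ultimately show "wsrc f k (t, x) = wsrc f k (0, x)" by (simp add: wsrc_def src_def spd_def den_def)
next
  fix t x :: real assume t: "0 < t"
  have "((\<lambda>t. src f k (t, x)) has_real_derivative src' f r k (t, x)) (at t)"
    using DERIV_diff[OF DERIV_cmult[OF d[OF t, of k x], of \<Gamma>]
        DERIV_mult[OF DERIV_mult[OF spd_DERIV[OF f d t, of k x] half_C1D(5)[OF b t, of k x]]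
          DERIV_add[OF d[OF t, of k x] d[OF t, of "\<not> k" "L - x"]]]]
    unfolding src_def src'_def case_prod_conv
    by (rule DERIV_cong) (assumption | rule product_rule_rearrange)+
  then show "((\<lambda>t. wsrc f k (t, x)) has_real_derivative wsrc' f r k (t, x)) (at t)"
    unfolding wsrc_def wsrc'_def case_prod_conv by (rule DERIV_cmult)
qed (rule wsrc_cont[OF f] wsrc'_cont[OF f r] wsrc'_bound[OF f r])+

section \<open>Continuation into the past and one step of the iteration\<close>

definition init :: "bool \<Rightarrow> real \<times> real \<Rightarrow> real" where
  "init k = (\<lambda>(t, x). f0 k (clip L x))"

lemma f0_cont: "continuous_on {0..L} (f0 k)"
  by (rule DERIV_continuous_on) (rule f0)

lemma f0_bound: "x \<in> {0..L} \<Longrightarrow> \<bar>f0 k x\<bar> \<le> M"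
  using f0(2)[of x k] \<epsilon>0_nonneg by linarith

lemma L_nonneg: "0 \<le> L" using L_pos by simp

lemma q0_bound:
  assumes "x \<in> {0..L}" shows "\<bar>q0 k x\<bar> \<le> \<epsilon>0"
proof -
  have "1 * \<bar>q0 k x\<bar> \<le> exp (\<Gamma> * L) * \<bar>q0 k x\<bar>"
    using \<Gamma>_pos L_pos by (intro mult_right_mono) auto
  then show ?thesis using q0(2)[OF assms, of k] by linarith
qed

lemma adm_init: "adm init"
  unfolding adm_def
proof (intro allI conjI)
  fix k
  show "continuous_on UNIV (init k)" unfolding init_def case_prod_beta
    by (rule continuous_on_compose2[OF f0_cont])
      (use clip_mem[OF L_nonneg] in \<open>auto intro!: continuous_intros simp del: atLeastAtMost_iff\<close>)
  fix z show "\<bar>init k z\<bar> \<le> M" using f0_bound[OF clip_mem[OF L_nonneg]] by (cases z) (simp add: init_def)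
qed (use M in \<open>auto simp: init_def\<close>)

lemma past:
  assumes f: "adm f" and t: "t \<le> 0"
  shows "spd f k (t, x) = spd init k (t', x)" "src f k (t, x) = src init k (0, x)" "wsrc f k (t, x) = wsrc init k (0, x)"
proof -
  have d: "den f k (t, x) = den init k (t'', x)" for t''
    unfolding den_def init_def case_prod_conv admD(4)[OF f t] ..
  show "spd f k (t, x) = spd init k (t', x)" by (simp add: spd_def d)
  show 1: "src f k (t, x) = src init k (0, x)"
    unfolding src_def spd_def d[of 0] case_prod_conv admD(4)[OF f t] half_C1D(6)[OF b t, of k x]
    by (simp add: init_def)
  show "wsrc f k (t, x) = wsrc init k (0, x)" by (simp add: wsrc_def 1)
qed

text \<open>\<open>A0\<close> is the time a characteristic with the initial speeds needs to travel from \<open>0\<close> to \<open>x\<close>,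
  so the characteristic through \<open>(0, x)\<close> carries the label \<open>- A0 x\<close>. The correction \<open>W\<close> on negative
  labels turns the initial datum into boundary data for the extension which is constant in \<open>t \<le> 0\<close>;
  compatibility makes the extended boundary datum \<open>C\<^sup>1\<close>.\<close>

definition A0 :: "bool \<Rightarrow> real \<Rightarrow> real" where
  "A0 k = flow L (spd init k) 0"

definition Y0 :: "bool \<Rightarrow> real \<Rightarrow> real" where
  "Y0 k \<sigma> = the_inv_into {0..L} (A0 k) (max 0 (min (A0 k L) \<sigma>))"

definition Q :: "bool \<Rightarrow> real \<Rightarrow> real" where
  "Q k s = exp (\<Gamma> * Y0 k (- s)) * q0 k (Y0 k (- s))"

definition W :: "bool \<Rightarrow> real \<Rightarrow> real" where
  "W k = (SOME W. W 0 = 0 \<and> (\<forall>s. (W has_real_derivative Q k s) (at s)))"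

definition V :: "(bool \<Rightarrow> real \<times> real \<Rightarrow> real) \<Rightarrow> bool \<Rightarrow> real \<Rightarrow> real" where
  "V f k s = h k s + \<kappa>s k * f (\<not> k) (s, L) + W k (min s 0)"

text \<open>For \<open>s < 0\<close> the first two terms take their values at time 0, and
  compatibility of the rates makes their sum equal to \<open>Q k 0\<close>, so that
  \<open>Q k s\<close> remains. In this form continuity is visible for every candidate rate.\<close>

definition V' :: "(bool \<Rightarrow> real \<times> real \<Rightarrow> real) \<Rightarrow> bool \<Rightarrow> real \<Rightarrow> real" where
  "V' r k s = h' k (max 0 s) + \<kappa>s k * r (\<not> k) (max 0 s, L) + (Q k (min s 0) - Q k 0)"

text \<open>\<open>max 0 t\<close> freezes the result in the past, where the transported function
  itself need not be constant in time.\<close>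

definition solve :: "(bool \<Rightarrow> real \<times> real \<Rightarrow> real) \<Rightarrow> bool \<Rightarrow> real \<times> real \<Rightarrow> real" where
  "solve f k = (\<lambda>(t, x). exp (- \<Gamma> * clip L x) * transport L (spd f k) (V f k) (wsrc f k) (max 0 t, clip L x))"

definition rate :: "(bool \<Rightarrow> real \<times> real \<Rightarrow> real) \<Rightarrow> (bool \<Rightarrow> real \<times> real \<Rightarrow> real) \<Rightarrow> bool \<Rightarrow> real \<times> real \<Rightarrow> real" where
  "rate f r k = (\<lambda>(t, x). exp (- \<Gamma> * clip L x) *
     transport_rate L (spd f k) (spd' f r k) (V' r k) (wsrc' f r k) (max 0 t, clip L x))"

sublocale f0: speed_field L "2 / c0" "Ca * M" "spd init k" for k
  by (rule speed_field_spd[OF adm_init])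

lemma spd_init_time: "spd init k (t, x) = spd init k (0, x)"
  by (simp add: spd_def den_def init_def)

lemma A0_eq: "y \<in> {0..L} \<Longrightarrow> A0 k y = integral {0..y} (\<lambda>\<eta>. spd init k (0, \<eta>))"
  using f0.flow_eq[of y k 0] unfolding A0_def spd_init_time[of k "flow L _ _ _"] by simp

lemma A0_0 [simp]: "A0 k 0 = 0" by (simp add: A0_def)

lemma A0_mono: "0 \<le> y \<Longrightarrow> y \<le> y' \<Longrightarrow> y' \<le> L \<Longrightarrow> A0 k y \<le> A0 k y'"
  unfolding A0_def by (rule f0.flow_mono)

lemma A0_strict: "0 \<le> y \<Longrightarrow> y < y' \<Longrightarrow> y' \<le> L \<Longrightarrow> A0 k y < A0 k y'"
  unfolding A0_def using f0.flow_increment(1)[of y y' k 0] by simp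

lemma A0_inj: "inj_on (A0 k) {0..L}"
  by (rule inj_onI) (metis A0_strict atLeastAtMost_iff less_irrefl linorder_less_linear)

lemma A0_cont: "continuous_on S (A0 k)"
  unfolding A0_def by (rule f0.flow_cont)

lemma A0_image: "max 0 (min (A0 k L) \<sigma>) \<in> A0 k ` {0..L}"
proof -
  have "\<exists>x\<ge>0. x \<le> L \<and> A0 k x = max 0 (min (A0 k L) \<sigma>)"
    by (rule IVT') (use A0_mono[of 0 L k] L_pos in \<open>auto intro: A0_cont\<close>)
  then show ?thesis by (auto intro: image_eqI[OF sym])
qed

lemma Y0_mem: "Y0 k \<sigma> \<in> {0..L}"
  unfolding Y0_def by (rule the_inv_into_into[OF A0_inj A0_image order_refl])

lemma Y0_A0: "x \<in> {0..L} \<Longrightarrow> Y0 k (A0 k x) = x"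
  using A0_mono[of 0 x k] A0_mono[of x L k] unfolding Y0_def
  by (simp add: the_inv_into_f_f[OF A0_inj])

lemma Y0_0 [simp]: "Y0 k 0 = 0"
  using Y0_A0[of 0 k] L_pos by simp

lemma Y0_cont: "continuous_on UNIV (Y0 k)"
  unfolding Y0_def
proof (rule continuous_on_compose2[of "A0 k ` {0..L}" "the_inv_into {0..L} (A0 k)" _ "\<lambda>\<sigma>. max 0 (min (A0 k L) \<sigma>)"])
  show "continuous_on (A0 k ` {0..L}) (the_inv_into {0..L} (A0 k))"
    by (rule continuous_on_inv_into[OF A0_cont compact_Icc A0_inj])
qed (use A0_image in \<open>auto intro!: continuous_intros\<close>)

lemma Q_cont: "continuous_on UNIV (Q k)"
proof -
  have 1: "continuous_on UNIV (\<lambda>s. Y0 k (- s))"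
    by (intro continuous_on_UNIV_compose[OF Y0_cont] continuous_intros)
  have "continuous_on UNIV (\<lambda>s. q0 k (Y0 k (- s)))"
    by (rule continuous_on_compose2[OF q0(1) 1]) (use Y0_mem in blast)
  then show ?thesis unfolding Q_def using 1 by (intro continuous_intros)
qed

lemma Q_bound: "\<bar>Q k s\<bar> \<le> \<epsilon>0"
proof -
  have "exp (\<Gamma> * Y0 k (- s)) \<le> exp (\<Gamma> * L)" using Y0_mem[of k "- s"] \<Gamma>_pos by simp
  then have "exp (\<Gamma> * Y0 k (- s)) * \<bar>q0 k (Y0 k (- s))\<bar> \<le> exp (\<Gamma> * L) * \<bar>q0 k (Y0 k (- s))\<bar>"
    by (rule mult_right_mono) simp
  also have "\<dots> \<le> \<epsilon>0" by (rule q0(2)[OF Y0_mem])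
  finally show ?thesis by (simp add: Q_def abs_mult)
qed

lemma Q_0 [simp]: "Q k 0 = q0 k 0" by (simp add: Q_def)

lemma Q_A0: "x \<in> {0..L} \<Longrightarrow> Q k (- A0 k x) = exp (\<Gamma> * x) * q0 k x"
  by (simp add: Q_def Y0_A0)

lemma W_0 [simp]: "W k 0 = 0" and W_DERIV: "(W k has_real_derivative Q k s) (at s)"
  using someI_ex[OF antiderivative_exists[OF Q_cont[of k]], folded W_def] by auto

lemma W_lip: "\<bar>W k s - W k s'\<bar> \<le> \<epsilon>0 * \<bar>s - s'\<bar>"
proof -
  have "\<bar>W k s - W k s'\<bar> \<le> \<epsilon>0 * (s' - s)" if "s < s'" for s s'
  proof -
    have "\<exists>z>s. z < s' \<and> W k s' - W k s = (s' - s) * Q k z"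
      by (rule MVT2[OF that]) (rule W_DERIV)
    then obtain z where "W k s' - W k s = (s' - s) * Q k z" by blast
    then show ?thesis
      using that Q_bound[of k z] mult_left_mono[OF Q_bound[of k z], of "s' - s"]
      by (subst abs_minus_commute) (simp add: abs_mult mult.commute)
  qed
  from this[of s s'] this[of s' s] show ?thesis
    by (cases s s' rule: linorder_cases) (auto simp: abs_minus_commute)
qed

lemma h_half_C1: "half_C1 \<epsilon>0 (\<lambda>(t, x). h k t) (\<lambda>(t, x). h' k t)"
  unfolding half_C1_def case_prod_beta fst_conv snd_conv
  by (intro conjI allI impI continuous_on_UNIV_compose[OF h(1)] continuous_on_UNIV_compose[OF h(2)]
    continuous_intros h(6)) (fact h(3,4))+

lemma h_lip: "\<bar>h k s - h k s'\<bar> \<le> \<epsilon>0 * \<bar>s - s'\<bar>"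
  using half_C1_lip[OF h_half_C1, of k s 0 s'] by simp

lemma W_cont: "continuous_on UNIV (W k)"
  by (rule DERIV_continuous_on) (rule W_DERIV)

lemma V_cont:
  assumes "adm f" shows "continuous_on UNIV (V f k)"
  unfolding V_def
  by (intro continuous_intros h(1) continuous_on_UNIV_compose[OF admD(1)[OF assms]] continuous_on_UNIV_compose[OF W_cont])

lemma V_lip:
  assumes "adm f" shows "\<bar>V f k s - V f k s'\<bar> \<le> \<kappa>' * M * \<bar>s - s'\<bar>"
proof -
  have 1: "\<bar>\<kappa>s k * (f (\<not> k) (s, L) - f (\<not> k) (s', L))\<bar> \<le> \<kappa> * (M * \<bar>s - s'\<bar>)"
    by (intro abs_mult_le \<kappa> admD assms)
  have "\<bar>W k (min s 0) - W k (min s' 0)\<bar> \<le> \<epsilon>0 * \<bar>min s 0 - min s' 0\<bar>" by (rule W_lip)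
  also have "\<dots> \<le> \<epsilon>0 * \<bar>s - s'\<bar>" by (intro mult_left_mono \<epsilon>0_nonneg) linarith
  finally have 2: "\<bar>W k (min s 0) - W k (min s' 0)\<bar> \<le> \<epsilon>0 * \<bar>s - s'\<bar>" .
  have "V f k s - V f k s' = (h k s - h k s') + \<kappa>s k * (f (\<not> k) (s, L) - f (\<not> k) (s', L)) + (W k (min s 0) - W k (min s' 0))"
    by (simp add: V_def algebra_simps)
  then have "\<bar>V f k s - V f k s'\<bar> \<le> \<epsilon>0 * \<bar>s - s'\<bar> + \<kappa> * (M * \<bar>s - s'\<bar>) + \<epsilon>0 * \<bar>s - s'\<bar>"
    using 1 2 h_lip[of k s s'] by linarith
  also have "\<dots> = (\<kappa> * M + 2 * \<epsilon>0) * \<bar>s - s'\<bar>" by (simp add: algebra_simps)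
  also have "\<dots> \<le> \<kappa>' * M * \<bar>s - s'\<bar>"
  proof (rule mult_right_mono)
    have "0 \<le> 2 / c0 * L * \<epsilon>0" using c0 L_pos \<epsilon>0_nonneg by simp
    then show "\<kappa> * M + 2 * \<epsilon>0 \<le> \<kappa>' * M" using sm_V by linarith
  qed simp
  finally show ?thesis .
qed

text \<open>\<open>W\<close> may grow linearly at negative labels, so the label needs a lower limit;
  characteristics arriving at \<open>t \<ge> 0\<close> have travelled for at most
  \<open>2 / c0 * L\<close>.\<close>

lemma V_bound:
  assumes "adm f" "- (2 / c0 * L) \<le> s"
  shows "\<bar>V f k s\<bar> \<le> \<kappa>' * M"
proof -
  have 1: "\<bar>\<kappa>s k * f (\<not> k) (s, L)\<bar> \<le> \<kappa> * M" by (intro abs_mult_le \<kappa> admD assms)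
  have pos: "0 \<le> 2 / c0 * L" using c0 L_pos by simp
  have "\<bar>W k (min s 0)\<bar> \<le> \<epsilon>0 * \<bar>min s 0\<bar>" using W_lip[of k "min s 0" 0] by simp
  also have "\<dots> \<le> \<epsilon>0 * (2 / c0 * L)"
    by (intro mult_left_mono \<epsilon>0_nonneg) (use assms(2) pos in linarith)
  finally have "\<bar>W k (min s 0)\<bar> \<le> 2 / c0 * L * \<epsilon>0" by (simp add: mult.commute)
  then have "\<bar>V f k s\<bar> \<le> \<epsilon>0 + \<kappa> * M + 2 / c0 * L * \<epsilon>0"
    using 1 h(5)[of k s] unfolding V_def by linarith
  then show ?thesis using sm_V \<epsilon>0_nonneg by linarith
qed

lemma V_diff:
  assumes "\<And>k t x. \<bar>f k (t, x) - g k (t, x)\<bar> \<le> d"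
  shows "\<bar>V f k s - V g k s\<bar> \<le> \<kappa> * d"
proof -
  have "V f k s - V g k s = \<kappa>s k * (f (\<not> k) (s, L) - g (\<not> k) (s, L))" by (simp add: V_def algebra_simps)
  then show ?thesis using abs_mult_le[OF \<kappa>(2) assms] by metis
qed

lemma V'_cont:
  assumes "adm_rate r" shows "continuous_on UNIV (V' r k)"
  unfolding V'_def
  by (intro continuous_intros continuous_on_UNIV_compose[OF h(2)] continuous_on_UNIV_compose[OF adm_rateD(1)[OF assms]]
    continuous_on_UNIV_compose[OF Q_cont])

lemma V'_neg: "adm_rate r \<Longrightarrow> s \<le> 0 \<Longrightarrow> V' r k s = Q k s"
  using compat1[of k] adm_rateD(3)[of r 0 "\<not> k" L] L_pos by (simp add: V'_def)

lemma V'_bound: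
  assumes r: "adm_rate r" shows "\<bar>V' r k s\<bar> \<le> \<kappa>' * M"
proof -
  have pos: "0 \<le> 2 / c0 * L * \<epsilon>0" using c0 L_pos \<epsilon>0_nonneg by simp
  have k: "0 \<le> \<kappa> * M" using \<kappa> M by simp
  show ?thesis
  proof (cases "s \<le> 0")
    case True
    show ?thesis unfolding V'_neg[OF r True]
      using Q_bound[of k s] sm_V pos \<epsilon>0_nonneg k by linarith
  next
    case False
    have "\<bar>\<kappa>s k * r (\<not> k) (s, L)\<bar> \<le> \<kappa> * M" by (intro abs_mult_le \<kappa> adm_rateD r)
    moreover have "V' r k s = h' k s + \<kappa>s k * r (\<not> k) (s, L)" using False by (simp add: V'_def)
    ultimately show ?thesis using h(6)[of k s] sm_V pos \<epsilon>0_nonneg by linarith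
  qed
qed

lemma V'_diff:
  assumes "adm_rate r1" "adm_rate r2" "0 \<le> S" "s \<le> S" "0 \<le> d"
    and d: "\<And>k t x. t \<le> S \<Longrightarrow> \<bar>r1 k (t, x) - r2 k (t, x)\<bar> \<le> d"
  shows "\<bar>V' r1 k s - V' r2 k s\<bar> \<le> \<kappa> * d"
proof -
  have "V' r1 k s - V' r2 k s = \<kappa>s k * (r1 (\<not> k) (max 0 s, L) - r2 (\<not> k) (max 0 s, L))"
    by (simp add: V'_def algebra_simps)
  moreover have "max 0 s \<le> S" using assms by simp
  ultimately show ?thesis using abs_mult_le[OF \<kappa>(2) d] by metis
qed

text \<open>Each of the three summands may have a kink at 0. The sum is differentiable there because
  compatibility makes \<open>V'\<close> continuous across 0.\<close>

lemma V_DERIV: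
  assumes f: "adm f" and r: "adm_rate r"
    and d: "\<And>k t x. 0 < t \<Longrightarrow> ((\<lambda>t. f k (t, x)) has_real_derivative r k (t, x)) (at t)"
  shows "(V f k has_real_derivative V' r k s) (at s)"
proof -
  have ne: "(V f k has_real_derivative V' r k s) (at s)" if "s \<noteq> 0" for s
  proof -
    have fh: "half_C1 M (f (\<not> k)) (r (\<not> k))" by (rule half_C1_adm[OF f r d])
    have w: "((\<lambda>s. W k (min s 0)) has_real_derivative (if s < 0 then Q k s else 0)) (at s)"
    proof (cases "s < 0")
      case True
      have "((\<lambda>s. W k (min s 0)) has_real_derivative Q k s) (at s)"
        by (rule has_field_derivative_transform_within[OF W_DERIV, where d = "-s"])
          (use True in \<open>auto simp: dist_real_def min_def\<close>)
      then show ?thesis using True by simp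
    next
      case False
      then have pos: "0 < s" using that by simp
      have "((\<lambda>s. 0) has_real_derivative 0) (at s)" by simp
      then have "((\<lambda>s. W k (min s 0)) has_real_derivative 0) (at s)"
        by (rule has_field_derivative_transform_within[where d = s])
          (use pos in \<open>auto simp: dist_real_def min_def\<close>)
      then show ?thesis using False by simp
    qed
    have "(V f k has_real_derivative (if 0 < s then h' k s else 0)
        + \<kappa>s k * (if 0 < s then r (\<not> k) (s, L) else 0) + (if s < 0 then Q k s else 0)) (at s)"
      unfolding V_def
      using half_C1_deriv[OF h_half_C1 that, of k L] half_C1_deriv[OF fh that, of L] w
      by (intro DERIV_add DERIV_cmult) auto
    moreover have "(if 0 < s then h' k s else 0)
        + \<kappa>s k * (if 0 < s then r (\<not> k) (s, L) else 0) + (if s < 0 then Q k s else 0) = V' r k s"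
      using that V'_neg[OF r, of s k] by (auto simp: V'_def not_less)
    ultimately show ?thesis by simp
  qed
  show ?thesis
  proof (cases "s = 0")
    case True
    have "isCont (V' r k) 0" using V'_cont[OF r] by (simp add: continuous_on_eq_continuous_at)
    from DERIV_from_punctured[OF V_cont[OF f] ne this] show ?thesis using True by simp
  qed (rule ne)
qed

lemma initial_flow:
  assumes f: "adm f" and x: "x \<in> {0..L}"
  shows "label L (spd f k) (0, x) = - A0 k x"
    and "y \<in> {0..x} \<Longrightarrow> flow L (spd f k) (- A0 k x) y = A0 k y - A0 k x"
proof -
  interpret f: speed_field L "2 / c0" "Ca * M" "spd f k" by (rule speed_field_spd[OF f])
  have *: "flow L (spd f k) (- A0 k x) y = A0 k y - A0 k x" if y: "y \<in> {0..x}" for y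
  proof (rule f.flow_unique[of x])
    fix y assume y: "y \<in> {0..x}"
    have "integral {0..y} (\<lambda>\<eta>. spd f k (A0 k \<eta> - A0 k x, \<eta>)) = integral {0..y} (\<lambda>\<eta>. spd init k (0, \<eta>))"
      by (rule integral_cong, rule past(1)[OF f]) (use A0_mono x y in auto)
    then show "A0 k y - A0 k x = - A0 k x + integral {0..y} (\<lambda>\<eta>. spd f k (A0 k \<eta> - A0 k x, \<eta>))"
      using A0_eq[of y k] x y by simp
  qed (use x y in \<open>auto intro!: continuous_intros A0_cont\<close>)
  show "y \<in> {0..x} \<Longrightarrow> flow L (spd f k) (- A0 k x) y = A0 k y - A0 k x" by (rule *)
  show "label L (spd f k) (0, x) = - A0 k x"
    using f.label_flow[OF x, of "- A0 k x"] *[of x] x by simp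
qed

text \<open>\<open>?Z\<close> compares the transported value with
  \<open>exp (\<Gamma> * x) * f0 k x\<close>. Its derivative vanishes by the initial form of the
  equation and the choice of \<open>Q\<close>, so it keeps its value at the corner; zeroth-order
  compatibility then matches the boundary datum with \<open>f0 k 0\<close>.\<close>

lemma solve_initial:
  assumes f: "adm f" and x: "x \<in> {0..L}" and t: "t \<le> 0"
  shows "solve f k (t, x) = f0 k x"
proof -
  let ?Z = "\<lambda>x. W k (- A0 k x) + integral {0..x} (\<lambda>\<eta>. wsrc init k (0, \<eta>)) - exp (\<Gamma> * x) * f0 k x"
  have "(?Z has_real_derivative 0) (at x within {0..L})" if x: "x \<in> {0..L}" for x
  proof -
    have a: "spd init k (0, x) * (c0 + p k * f0 k x + q k * f0 (\<not> k) (L - x)) = 1"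
      using den_pos[OF adm_init, of k "(0, x)"] x by (simp add: spd_def den_def init_def)
    have f0': "f0' k x = spd init k (0, x) * (- b k (0, x) * (f0 k x + f0 (\<not> k) (L - x)) - q0 k x)"
      unfolding init_pde[OF x, symmetric] mult.assoc[symmetric] a by simp
    have dA: "(A0 k has_real_derivative spd init k (0, x)) (at x within {0..L})"
      using f0.flow_deriv[OF x, of k 0] unfolding A0_def spd_init_time[of k "flow L _ _ _"] .
    have dI: "((\<lambda>x. integral {0..x} (\<lambda>\<eta>. wsrc init k (0, \<eta>))) has_real_derivative wsrc init k (0, x)) (at x within {0..L})"
      by (rule integral_has_real_derivative[OF _ x])
        (intro continuous_on_UNIV_compose[OF wsrc_cont[OF adm_init]] continuous_intros)
    have dE: "((\<lambda>x. exp (\<Gamma> * x)) has_real_derivative exp (\<Gamma> * x) * \<Gamma>) (at x within {0..L})"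
      by (auto intro!: derivative_eq_intros)
    have "(?Z has_real_derivative Q k (- A0 k x) * - spd init k (0, x) + wsrc init k (0, x)
       - (exp (\<Gamma> * x) * \<Gamma> * f0 k x + f0' k x * exp (\<Gamma> * x))) (at x within {0..L})"
      by (intro DERIV_diff DERIV_add DERIV_mult dI dE f0(1)[OF x] DERIV_chain2[OF W_DERIV] DERIV_minus dA)
    moreover have "Q k (- A0 k x) * - spd init k (0, x) + wsrc init k (0, x)
       - (exp (\<Gamma> * x) * \<Gamma> * f0 k x + f0' k x * exp (\<Gamma> * x)) = 0"
      unfolding Q_A0[OF x] f0' using x by (simp add: wsrc_def src_def init_def algebra_simps)
    ultimately show ?thesis by simp
  qed
  from has_field_derivative_zero_constant[of "{0..L}", OF _ this]
  obtain c where c: "\<And>x. x \<in> {0..L} \<Longrightarrow> ?Z x = c" by auto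
  have "c = - f0 k 0" using c[of 0] L_pos by simp
  with c[OF x] have Z: "W k (- A0 k x) + integral {0..x} (\<lambda>\<eta>. wsrc init k (0, \<eta>)) = exp (\<Gamma> * x) * f0 k x - f0 k 0"
    by simp
  have A: "0 \<le> A0 k x" using A0_mono[of 0 x k] x by simp
  have "integral {0..x} (\<lambda>\<eta>. wsrc f k (flow L (spd f k) (- A0 k x) \<eta>, \<eta>)) = integral {0..x} (\<lambda>\<eta>. wsrc init k (0, \<eta>))"
  proof (rule integral_cong)
    fix \<eta> assume "\<eta> \<in> {0..x}"
    then show "wsrc f k (flow L (spd f k) (- A0 k x) \<eta>, \<eta>) = wsrc init k (0, \<eta>)"
      using initial_flow(2)[OF f x] A0_mono[of \<eta> x k] x by (auto intro!: past(3)[OF f])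
  qed
  moreover have "V f k (- A0 k x) = f0 k 0 + W k (- A0 k x)"
    using h(4)[of "- A0 k x" k] admD(4)[OF f, of "- A0 k x" "\<not> k" L] compat0[of k] A L_pos
    by (simp add: V_def)
  ultimately have "transport L (spd f k) (V f k) (wsrc f k) (0, x) = exp (\<Gamma> * x) * f0 k x"
    using Z by (simp add: transport_def Let_def initial_flow(1)[OF f x])
  then show ?thesis using t x by (simp add: solve_def exp_minus)
qed

text \<open>A characteristic ending at \<open>(0, x)\<close> stays in the past, where
  \<open>along\<close> vanishes: no source, Jacobian 1, and only the boundary rate
  \<open>Q k (- A0 k x)\<close> survives.\<close>

lemma rate_initial:
  assumes f: "adm f" and r: "adm_rate r" and x: "x \<in> {0..L}" and t: "t \<le> 0"
  shows "rate f r k (t, x) = q0 k x"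
proof -
  have A: "0 \<le> A0 k x" using A0_mono[of 0 x k] x by simp
  have al: "along L (spd f k) g (- A0 k x) \<eta> = 0" if "\<eta> \<in> {0..x}" for g \<eta>
    using initial_flow(2)[OF f x that] A0_mono[of \<eta> x k] x that by (simp add: along_def)
  have "integral {0..x} (along L (spd f k) (spd' f r k) (- A0 k x)) = integral {0..x} (\<lambda>_. 0)"
    by (rule integral_cong) (rule al)
  then have j: "jac L (spd f k) (spd' f r k) (- A0 k x) x = 1" by (simp add: jac_def)
  have "integral {0..x} (\<lambda>\<eta>. along L (spd f k) (wsrc' f r k) (- A0 k x) \<eta> * jac L (spd f k) (spd' f r k) (- A0 k x) \<eta>)
    = integral {0..x} (\<lambda>_. 0)"
    by (rule integral_cong) (simp add: al)
  moreover have "V' r k (- A0 k x) = exp (\<Gamma> * x) * q0 k x"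
    using V'_neg[OF r, of "- A0 k x" k] A Q_A0[OF x] by simp
  ultimately have "transport_rate L (spd f k) (spd' f r k) (V' r k) (wsrc' f r k) (0, x) = exp (\<Gamma> * x) * q0 k x"
    by (simp add: transport_rate_def Let_def initial_flow(1)[OF f x] j)
  then show ?thesis using t x by (simp add: rate_def exp_minus)
qed

section \<open>The error budget of the contraction\<close>

lemma LCa_nonneg: "0 \<le> L * Ca" using Ca_nonneg L_pos by simp

lemma \<Gamma>D: "\<Gamma> * D = 9 * (L * Ca) * \<Gamma> + C3 + (3 * \<Gamma> + C3) * (10 * (L * Ca))"
  using \<Gamma>_pos by (simp add: D field_simps)

lemma D_ge: "9 * (L * Ca) \<le> D"
proof -
  have "0 \<le> (3 * \<Gamma> + C3) * (10 * (L * Ca))" using \<Gamma>_pos C3_nonneg L_nonneg Ca_nonneg by simp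
  then have "\<Gamma> * (9 * (L * Ca)) \<le> \<Gamma> * D" using C3_nonneg unfolding \<Gamma>D by (simp add: mult.commute)
  then show ?thesis using \<Gamma>_pos by (rule mult_left_le_imp_le)
qed

lemma D_nonneg: "0 \<le> D" using D_ge LCa_nonneg by linarith

lemma mult_D: "c \<le> \<Gamma> * D \<Longrightarrow> \<Gamma> + M * c \<le> \<Gamma> * (1 + D * M)"
  using M mult_left_mono[of c "\<Gamma> * D" M] by (simp add: algebra_simps)

text \<open>Budget for two different iterates: the change of the source at a fixed point, plus its
  time Lipschitz constant times the displacement \<open>10 * (L * Ca)\<close> of the
  characteristics, per unit of distance.\<close>

lemma D_solve: "(\<Gamma> + C3 * M) + (3 * \<Gamma> + C3) * M * (10 * (L * Ca)) \<le> \<Gamma> * (1 + D * M)"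
proof -
  have "0 \<le> 9 * (L * Ca) * \<Gamma>" using L_nonneg Ca_nonneg \<Gamma>_pos by simp
  then have "C3 + (3 * \<Gamma> + C3) * (10 * (L * Ca)) \<le> \<Gamma> * D" unfolding \<Gamma>D by linarith
  from mult_D[OF this] show ?thesis by (simp add: algebra_simps)
qed

text \<open>Budget for two rates over the same iterate: the change of the source times the bound of
  \<open>iota\<close>, plus the bound of the source times the change \<open>4 * (L * Ca)\<close> of
  \<open>iota\<close>.\<close>

lemma D_rate: "(\<Gamma> + C3 * M) * (1 + 4 * (L * Ca) * M) + (\<Gamma> + C3 * M) * M * (4 * (L * Ca)) \<le> \<Gamma> * (1 + D * M)"
proof -
  let ?X = "L * Ca"
  have "C3 * ?X * M \<le> C3 * ?X * 1"
    using C3_nonneg L_nonneg Ca_nonneg M by (intro mult_left_mono mult_nonneg_nonneg) auto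
  moreover have "0 \<le> C3 * ?X" "0 \<le> \<Gamma> * ?X" using C3_nonneg LCa_nonneg \<Gamma>_pos by auto
  ultimately have "C3 + 8 * (\<Gamma> * ?X) + 8 * (C3 * ?X * M) \<le> \<Gamma> * D"
    unfolding \<Gamma>D by (simp only: algebra_simps)
  from mult_D[OF this] show ?thesis by (simp add: algebra_simps)
qed

lemma D_rate_bound: "(\<Gamma> + C3 * M) * (1 + 4 * (L * Ca) * M) \<le> \<Gamma> * (1 + D * M)"
proof -
  have "0 \<le> (\<Gamma> + C3 * M) * M * (4 * (L * Ca))"
    using \<Gamma>_pos C3_nonneg M L_nonneg Ca_nonneg by (intro mult_nonneg_nonneg add_nonneg_nonneg) auto
  then show ?thesis using D_rate by linarith
qed

text \<open>The corresponding budget at the inflow end: the factor \<open>c\<close> comes from the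
  reflection, the errors from the displaced label or from \<open>iota\<close>.\<close>

lemma boundary_D:
  assumes "0 \<le> c" "c \<le> 1" "0 \<le> m"
  shows "c * m * (1 + 4 * (L * Ca) * M) + M * (4 * (L * Ca) * m) \<le> (c + D * M) * m"
proof -
  have "c * (4 * (L * Ca)) + 4 * (L * Ca) \<le> D"
    using assms mult_right_mono[of c 1 "4 * (L * Ca)"] LCa_nonneg D_ge by linarith
  then have "(c * (4 * (L * Ca)) + 4 * (L * Ca)) * (M * m) \<le> D * (M * m)"
    using M assms by (intro mult_right_mono) auto
  then show ?thesis by (simp add: algebra_simps)
qed

definition \<theta> :: "real \<Rightarrow> real" where
  "\<theta> c = 1 - (1 - c) * exp (- \<Gamma> * L) + D * M"

lemma \<theta>_le: "\<theta> \<kappa>' < 1" "\<theta> \<kappa> < 1" "0 \<le> \<theta> \<kappa>"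
proof -
  show 1: "\<theta> \<kappa>' < 1" using sm_D by (simp add: \<theta>_def)
  have "(1 - \<kappa>') * exp (- \<Gamma> * L) \<le> (1 - \<kappa>) * exp (- \<Gamma> * L)" using \<kappa> by (intro mult_right_mono) auto
  then show "\<theta> \<kappa> < 1" using 1 unfolding \<theta>_def by linarith
  have "(1 - \<kappa>) * exp (- \<Gamma> * L) \<le> 1 * 1" using \<kappa> \<Gamma>_pos L_pos by (intro mult_mono) auto
  then show "0 \<le> \<theta> \<kappa>" using D_nonneg M by (simp add: \<theta>_def)
qed

text \<open>Up to errors of size \<open>D * M\<close>, the value at \<open>x\<close> is an average:
  the boundary contribution \<open>c\<close> with weight \<open>exp (- \<Gamma> * x)\<close>, the
  interior contribution 1 with the remaining weight. As \<open>c \<le> 1\<close>, the average is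
  largest at \<open>x = L\<close>, where it is \<open>\<theta> c\<close>.\<close>

lemma weighted_bound:
  assumes x: "x \<in> {0..L}" and c: "c \<le> 1" and m: "0 \<le> m"
    and u: "\<bar>u\<bar> \<le> (c + D * M) * m + (exp (\<Gamma> * x) - 1) * ((1 + D * M) * m)"
  shows "\<bar>exp (- \<Gamma> * x) * u\<bar> \<le> \<theta> c * m"
proof -
  let ?e = "exp (- \<Gamma> * x)"
  have e: "?e * exp (\<Gamma> * x) = 1" by (simp add: mult_exp_exp)
  have "\<bar>?e * u\<bar> \<le> ?e * ((c + D * M) * m + (exp (\<Gamma> * x) - 1) * ((1 + D * M) * m))"
    using u by (simp add: abs_mult)
  also have "\<dots> = ?e * ((c + D * M) * m) + (?e * exp (\<Gamma> * x) - ?e) * ((1 + D * M) * m)"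
    by (simp only: distrib_left left_diff_distrib right_diff_distrib mult.assoc mult_1_left)
  also have "\<dots> = (1 + D * M - (1 - c) * ?e) * m" unfolding e by (simp add: algebra_simps)
  also have "\<dots> \<le> \<theta> c * m"
  proof (rule mult_right_mono[OF _ m])
    have "exp (- \<Gamma> * L) \<le> ?e" using x \<Gamma>_pos by simp
    then have "(1 - c) * exp (- \<Gamma> * L) \<le> (1 - c) * ?e" using c by (intro mult_left_mono) auto
    then show "1 + D * M - (1 - c) * ?e \<le> \<theta> c" by (simp add: \<theta>_def)
  qed
  finally show ?thesis .
qed

section \<open>Invariance, time derivative and contraction of one step\<close>

lemma label_range:
  assumes "adm f" "0 \<le> t" "x \<in> {0..L}"
  shows "- (2 / c0 * L) \<le> label L (spd f k) (t, x)"
  using speed_field.label_ge[OF speed_field_spd[OF assms(1)] assms(3), of t k] assms(2) by linarith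

lemma wsrc_along_integrable:
  assumes "adm f" "speed_field L A K a" shows "(\<lambda>\<eta>. wsrc f k (flow L a s \<eta>, \<eta>)) integrable_on {0..x}"
  by (intro integrable_continuous_interval continuous_on_UNIV_compose[OF wsrc_cont[OF assms(1)]] continuous_intros
    speed_field.flow_cont[OF assms(2)])

lemma wsrc_le: "\<eta> \<in> {0..L} \<Longrightarrow> \<bar>src f k (t, \<eta>)\<bar> \<le> c \<Longrightarrow> \<bar>wsrc f k (t, \<eta>)\<bar> \<le> exp (\<Gamma> * \<eta>) * c"
  by (simp add: wsrc_def abs_mult)

lemma solve_bound:
  assumes f: "adm f" shows "\<bar>solve f k z\<bar> \<le> M"
proof -
  obtain t0 x0 where z: "z = (t0, x0)" by (cases z)
  define t x where "t = max 0 t0" and "x = clip L x0"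
  have x: "x \<in> {0..L}" unfolding x_def by (rule clip_mem[OF L_nonneg])
  let ?s = "label L (spd f k) (t, x)"
  have 1: "\<bar>V f k ?s\<bar> \<le> \<kappa>' * M"
    by (rule V_bound[OF f label_range[OF f _ x]]) (simp add: t_def)
  have 2: "\<bar>integral {0..x} (\<lambda>\<eta>. wsrc f k (flow L (spd f k) ?s \<eta>, \<eta>))\<bar> \<le> (exp (\<Gamma> * x) - 1) * M"
  proof (rule exp_weighted_integral_le[OF wsrc_along_integrable[OF f speed_field_spd[OF f]]])
    fix y assume "y \<in> {0..x}"
    then show "\<bar>wsrc f k (flow L (spd f k) ?s y, y)\<bar> \<le> exp (\<Gamma> * y) * (\<Gamma> * M)"
      by (intro wsrc_le src_bound[OF f]) (use x in auto)
  qed (use x in auto)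
  have "\<bar>transport L (spd f k) (V f k) (wsrc f k) (t, x)\<bar> \<le> \<kappa>' * M + (exp (\<Gamma> * x) - 1) * M"
    using 1 2 unfolding transport_def Let_def case_prod_conv by linarith
  also have "\<dots> \<le> (\<kappa>' + D * M) * M + (exp (\<Gamma> * x) - 1) * ((1 + D * M) * M)"
    using x M D_nonneg \<Gamma>_pos by (intro add_mono mult_right_mono mult_left_mono) auto
  finally have "\<bar>solve f k z\<bar> \<le> \<theta> \<kappa>' * M"
    unfolding z solve_def case_prod_conv t_def[symmetric] x_def[symmetric]
    by (intro weighted_bound) (use x \<kappa> M in auto)
  also have "\<dots> \<le> 1 * M" using \<theta>_le(1) M by (intro mult_right_mono) auto
  finally show ?thesis by simp
qed

lemma solve_cont:
  assumes f: "adm f" shows "continuous_on UNIV (solve f k)"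
proof (rule continuous_on_sequentiallyI)
  fix u :: "nat \<Rightarrow> real \<times> real" and a assume u: "u \<longlonglongrightarrow> a"
  interpret f: speed_field L "2 / c0" "Ca * M" "spd f k" by (rule speed_field_spd[OF f])
  have t: "(\<lambda>n. max 0 (fst (u n))) \<longlonglongrightarrow> max 0 (fst a)" by (intro tendsto_intros u)
  have x: "(\<lambda>n. clip L (snd (u n))) \<longlonglongrightarrow> clip L (snd a)" unfolding clip_def by (intro tendsto_intros u)
  have "(\<lambda>n. transport L (spd f k) (V f k) (wsrc f k) (max 0 (fst (u n)), clip L (snd (u n))))
      \<longlonglongrightarrow> transport L (spd f k) (V f k) (wsrc f k) (max 0 (fst a), clip L (snd a))"
    by (rule f.transport_continuous[OF V_cont[OF f] wsrc_cont[OF f] wsrc_bound[OF f] t x clip_mem[OF L_nonneg]])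
  then show "(\<lambda>n. solve f k (u n)) \<longlonglongrightarrow> solve f k a"
    unfolding solve_def case_prod_beta by (intro tendsto_intros x)
qed

lemma cconv_f: "adm f \<Longrightarrow> e \<longlonglongrightarrow> 0 \<Longrightarrow> (\<And>n k t x. \<bar>fn n k (t, x) - f k (t, x)\<bar> \<le> e n) \<Longrightarrow> cconv (\<lambda>n. fn n k) (f k)"
  by (rule cconv_bound[OF admD(1), of f e]) auto

text \<open>The rate \<open>r\<close> stays fixed while the iterate varies: speeds, their rates and
  sources then converge continuously, and the boundary rate \<open>V' r k\<close> does not depend on
  the iterate.\<close>

lemma rate_tendsto:
  assumes fn: "\<And>n. adm (fn n)" and f: "adm f" and r: "adm_rate r" and e: "e \<longlonglongrightarrow> 0"
    and sup: "\<And>n k t x. \<bar>fn n k (t, x) - f k (t, x)\<bar> \<le> e n" and z: "zn \<longlonglongrightarrow> z"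
  shows "(\<lambda>n. rate (fn n) r k (zn n)) \<longlonglongrightarrow> rate f r k z"
proof -
  have a: "\<bar>spd (fn n) k' z - spd f k' z\<bar> \<le> Ca * e n" for n k' z
    by (rule spd_diff[OF fn f], rule den_diff, rule sup)
  have Cae: "(\<lambda>n. Ca * e n) \<longlonglongrightarrow> 0" by (intro tendsto_mult_right_zero e)
  have ca: "cconv (\<lambda>n. spd (fn n) k') (spd f k')" for k'
    by (rule cconv_bound[OF spd_cont[OF f] Cae a])
  have cf: "cconv (\<lambda>n. fn n k') (f k')" for k' by (rule cconv_f[OF f e sup])
  have cr: "cconv (\<lambda>n. r k') (r k')" for k' by (rule cconv_const[OF adm_rateD(1)[OF r]])
  have cb: "cconv (\<lambda>n. b k') (b k')" "cconv (\<lambda>n. b' k') (b' k')" for k'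
    by (rule cconv_const[OF half_C1D(1)[OF b]], rule cconv_const[OF half_C1D(2)[OF b]])
  have refl: "(\<lambda>n. (fst (p n), L - snd (p n))) \<longlonglongrightarrow> (fst q, L - snd q)" if "p \<longlonglongrightarrow> q" for p :: "nat \<Rightarrow> real \<times> real" and q
    using that by (intro tendsto_intros)
  have ca': "cconv (\<lambda>n. spd' (fn n) r k) (spd' f r k)"
    unfolding cconv_def spd'_def case_prod_beta prod.collapse
    by (intro allI impI tendsto_intros cconvD[OF ca] cconvD[OF cr] refl)
  have cs: "cconv (\<lambda>n. wsrc' (fn n) r k) (wsrc' f r k)"
    unfolding cconv_def wsrc'_def src'_def clip_def case_prod_beta prod.collapse
    by (intro allI impI tendsto_intros cconvD[OF ca] cconvD[OF ca'] cconvD[OF cr] cconvD[OF cf] cconvD[OF cb(1)] cconvD[OF cb(2)] refl)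
  have t: "(\<lambda>n. max 0 (fst (zn n))) \<longlonglongrightarrow> max 0 (fst z)" by (intro tendsto_intros z)
  have x: "(\<lambda>n. clip L (snd (zn n))) \<longlonglongrightarrow> clip L (snd z)" unfolding clip_def by (intro tendsto_intros z)
  have "(\<lambda>n. transport_rate L (spd (fn n) k) (spd' (fn n) r k) (V' r k) (wsrc' (fn n) r k) (max 0 (fst (zn n)), clip L (snd (zn n))))
    \<longlonglongrightarrow> transport_rate L (spd f k) (spd' f r k) (V' r k) (wsrc' f r k) (max 0 (fst z), clip L (snd z))"
    by (rule transport_rate_tendsto[OF speed_field_C1_spd[OF fn r] speed_field_C1_spd[OF f r] a Cae ca' cs
      cconv_const[OF V'_cont[OF r]] wsrc'_cont[OF fn r] wsrc'_bound[OF fn r] t x clip_mem[OF L_nonneg]])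
  then show ?thesis
    unfolding rate_def case_prod_beta by (intro tendsto_intros x)
qed

lemma rate_cont: "adm f \<Longrightarrow> adm_rate r \<Longrightarrow> continuous_on UNIV (rate f r k)"
  by (rule continuous_on_sequentiallyI) (rule rate_tendsto[of "\<lambda>_. f" f r "\<lambda>_. 0"], auto)

lemma wsrc'_le: "\<eta> \<in> {0..L} \<Longrightarrow> \<bar>src' f r k (t, \<eta>)\<bar> \<le> c \<Longrightarrow> \<bar>wsrc' f r k (t, \<eta>)\<bar> \<le> exp (\<Gamma> * \<eta>) * c"
  by (simp add: wsrc'_def abs_mult)

lemma along_wsrc'_le:
  assumes "adm f" "adm_rate r" "\<eta> \<in> {0..L}"
  shows "\<bar>along L a (wsrc' f r k) s \<eta>\<bar> \<le> exp (\<Gamma> * \<eta>) * ((\<Gamma> + C3 * M) * M)"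
proof -
  have "0 \<le> exp (\<Gamma> * \<eta>) * ((\<Gamma> + C3 * M) * M)" using \<Gamma>_pos C3_nonneg M by simp
  moreover have "\<bar>wsrc' f r k (t, \<eta>)\<bar> \<le> exp (\<Gamma> * \<eta>) * ((\<Gamma> + C3 * M) * M)" for t
    using wsrc'_le[OF assms(3) src'_bound[OF assms(1,2)], of k t] \<Gamma>_pos
    by (simp add: algebra_simps power2_eq_square)
  ultimately show ?thesis by (simp add: along_def)
qed

lemma rate_bound:
  assumes f: "adm f" and r: "adm_rate r" shows "\<bar>rate f r k z\<bar> \<le> M"
proof -
  obtain t0 x0 where z: "z = (t0, x0)" by (cases z)
  define t x where "t = max 0 t0" and "x = clip L x0"
  have x: "x \<in> {0..L}" unfolding x_def by (rule clip_mem[OF L_nonneg])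
  interpret f: speed_field_C1 L "2 / c0" "Ca * M" "spd f k" "spd' f r k" by (rule speed_field_C1_spd[OF f r])
  let ?s = "label L (spd f k) (t, x)"
  have i: "\<bar>f.iota ?s x \<eta>\<bar> \<le> 1 + 4 * (L * Ca) * M" if "\<eta> \<in> {0..L}" for \<eta>
    using f.iota_bound[OF x that, of ?s] by (simp add: mult_ac)
  have 0: "0 \<le> M * (4 * (L * Ca) * M)" using M LCa_nonneg by simp
  have "\<bar>V' r k ?s * f.iota ?s x 0\<bar> \<le> \<kappa>' * M * (1 + 4 * (L * Ca) * M)"
    by (intro abs_mult_le V'_bound r i) (use L_pos in auto)
  also have "\<dots> \<le> (\<kappa>' + D * M) * M"
    using boundary_D[of \<kappa>' M] \<kappa> M 0 by linarith
  finally have 1: "\<bar>V' r k ?s * f.iota ?s x 0\<bar> \<le> (\<kappa>' + D * M) * M" .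
  have 2: "\<bar>integral {0..x} (\<lambda>\<eta>. along L (spd f k) (wsrc' f r k) ?s \<eta> * f.iota ?s x \<eta>)\<bar>
    \<le> (exp (\<Gamma> * x) - 1) * ((1 + D * M) * M)"
  proof (rule exp_weighted_integral_le[OF f.rate_mult_iota_integrable[OF wsrc'_cont[OF f r] wsrc'_bound[OF f r] x]])
    fix y assume y: "y \<in> {0..x}"
    have "\<bar>along L (spd f k) (wsrc' f r k) ?s y * f.iota ?s x y\<bar>
      \<le> exp (\<Gamma> * y) * ((\<Gamma> + C3 * M) * M) * (1 + 4 * (L * Ca) * M)"
      by (intro abs_mult_le along_wsrc'_le f r i) (use x y in auto)
    also have "\<dots> = exp (\<Gamma> * y) * ((\<Gamma> + C3 * M) * (1 + 4 * (L * Ca) * M) * M)" by simp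
    also have "\<dots> \<le> exp (\<Gamma> * y) * (\<Gamma> * (1 + D * M) * M)"
      using D_rate_bound M by (intro mult_left_mono mult_right_mono) auto
    finally show "\<bar>along L (spd f k) (wsrc' f r k) ?s y * f.iota ?s x y\<bar> \<le> exp (\<Gamma> * y) * (\<Gamma> * ((1 + D * M) * M))"
      by (simp only: mult.assoc)
  qed (use x in auto)
  have "\<bar>rate f r k z\<bar> \<le> \<theta> \<kappa>' * M"
    unfolding z rate_def case_prod_conv t_def[symmetric] x_def[symmetric] f.transport_rate_eq[OF x]
    using 1 2 by (intro weighted_bound order_trans[OF abs_triangle_ineq add_mono]) (use x \<kappa> M in auto)
  also have "\<dots> \<le> 1 * M" using \<theta>_le(1) M by (intro mult_right_mono) auto
  finally show ?thesis by simp
qed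

lemma clip_clip [simp]: "clip L (clip L x) = clip L x"
  using clip_id[OF clip_mem[OF L_nonneg]] .

lemma adm_rate_rate:
  assumes f: "adm f" and r: "adm_rate r" shows "adm_rate (rate f r)"
  unfolding adm_rate_def
proof (intro allI conjI impI rate_cont rate_bound f r)
  fix k and t x :: real assume t: "t \<le> 0"
  have "rate f r k (t, x) = rate f r k (t, clip L x)" by (simp add: rate_def)
  then show "rate f r k (t, x) = q0 k (clip L x)"
    using rate_initial[OF f r clip_mem[OF L_nonneg] t] by metis
qed

lemma solve_DERIV:
  assumes f: "adm f" and r: "adm_rate r"
    and d: "\<And>k t x. 0 < t \<Longrightarrow> ((\<lambda>t. f k (t, x)) has_real_derivative r k (t, x)) (at t)" and t: "0 < t"
  shows "((\<lambda>t. solve f k (t, x)) has_real_derivative rate f r k (t, x)) (at t)"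
proof -
  interpret f: speed_field_C1 L "2 / c0" "Ca * M" "spd f k" "spd' f r k" by (rule speed_field_C1_spd[OF f r])
  have "((\<lambda>t. exp (- \<Gamma> * clip L x) * transport L (spd f k) (V f k) (wsrc f k) (t, clip L x)) has_real_derivative
    exp (- \<Gamma> * clip L x) * transport_rate L (spd f k) (spd' f r k) (V' r k) (wsrc' f r k) (t, clip L x)) (at t)"
    by (intro DERIV_cmult f.transport_DERIV[OF half_C1_spd[OF f r d] half_C1_wsrc[OF f r d]] V_DERIV[OF f r d] clip_mem L_nonneg)
  moreover have "exp (- \<Gamma> * clip L x) * transport_rate L (spd f k) (spd' f r k) (V' r k) (wsrc' f r k) (t, clip L x) = rate f r k (t, x)"
    using t by (simp add: rate_def)
  ultimately have "((\<lambda>t. exp (- \<Gamma> * clip L x) * transport L (spd f k) (V f k) (wsrc f k) (t, clip L x)) has_real_derivative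
    rate f r k (t, x)) (at t)" by simp
  then show ?thesis
    by (rule has_field_derivative_transform_within[where d = t])
      (use t in \<open>auto simp: solve_def dist_real_def\<close>)
qed

definition C1_pair :: "(bool \<Rightarrow> real \<times> real \<Rightarrow> real) \<Rightarrow> (bool \<Rightarrow> real \<times> real \<Rightarrow> real) \<Rightarrow> bool" where
  "C1_pair f r \<longleftrightarrow> adm f \<and> adm_rate r \<and> (\<forall>k t x. 0 < t \<longrightarrow> ((\<lambda>t. f k (t, x)) has_real_derivative r k (t, x)) (at t))"

text \<open>The Lipschitz bound required of \<open>solve f\<close> is not estimated directly; it
  follows from the bound on its rate through \<open>half_C1_lip\<close>.\<close>

lemma C1_pair_step:
  assumes "C1_pair f r" shows "C1_pair (solve f) (rate f r)"
proof -
  have f: "adm f" and r: "adm_rate r"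
    and d: "\<And>k t x. 0 < t \<Longrightarrow> ((\<lambda>t. f k (t, x)) has_real_derivative r k (t, x)) (at t)"
    using assms by (auto simp: C1_pair_def)
  have R: "adm_rate (rate f r)" by (rule adm_rate_rate[OF f r])
  have past: "solve f k (t, x) = f0 k (clip L x)" if "t \<le> 0" for k t x
  proof -
    have "solve f k (t, x) = solve f k (t, clip L x)" by (simp add: solve_def)
    then show ?thesis using solve_initial[OF f clip_mem[OF L_nonneg] that] by metis
  qed
  have h: "half_C1 M (solve f k) (rate f r k)" for k
    unfolding half_C1_def
    by (intro conjI allI impI solve_cont rate_cont rate_bound solve_DERIV f r d) (auto simp: past)
  have "adm (solve f)"
    unfolding adm_def by (intro allI conjI impI solve_cont solve_bound f half_C1_lip[OF h] past)
  then show ?thesis using R solve_DERIV[OF f r d] by (auto simp: C1_pair_def)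
qed

text \<open>Two iterates have different characteristics. Evaluating a boundary datum or a source at
  the displaced point costs its time Lipschitz constant, which admissibility bounds by a multiple of
  \<open>M\<close>; so the displacement ends up in the small term \<open>D * M\<close>.\<close>

lemma solve_contraction:
  assumes f: "adm f" and g: "adm g" and d: "\<And>k t x. \<bar>f k (t, x) - g k (t, x)\<bar> \<le> d"
  shows "\<bar>solve f k z - solve g k z\<bar> \<le> \<theta> \<kappa> * d"
proof -
  obtain t0 x0 where z: "z = (t0, x0)" by (cases z)
  define t x where "t = max 0 t0" and "x = clip L x0"
  have x: "x \<in> {0..L}" unfolding x_def by (rule clip_mem[OF L_nonneg])
  have d0: "0 \<le> d" using order_trans[OF abs_ge_zero d] .
  interpret f: speed_field L "2 / c0" "Ca * M" "spd f k" by (rule speed_field_spd[OF f])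
  interpret g: speed_field L "2 / c0" "Ca * M" "spd g k" by (rule speed_field_spd[OF g])
  let ?s = "label L (spd f k) (t, x)" and ?s' = "label L (spd g k) (t, x)"
  have a: "\<bar>spd f k (t, x) - spd g k (t, x)\<bar> \<le> Ca * d" for t x
    by (rule spd_diff[OF f g], rule den_diff, rule d)
  have 1: "\<bar>V f k ?s - V g k ?s'\<bar> \<le> (\<kappa> + D * M) * d"
  proof -
    have "\<bar>V f k ?s - V g k ?s\<bar> \<le> \<kappa> * d" by (rule V_diff, rule d)
    moreover have "\<bar>V g k ?s - V g k ?s'\<bar> \<le> \<kappa>' * M * (4 * (L * (Ca * d)))"
    proof -
      have "\<bar>V g k ?s - V g k ?s'\<bar> \<le> \<kappa>' * M * \<bar>?s - ?s'\<bar>" by (rule V_lip[OF g])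
      also have "\<dots> \<le> \<kappa>' * M * (4 * (L * (Ca * d)))"
        using \<kappa> M by (intro mult_left_mono f.label_perturb[OF g.speed_field_axioms a x]) auto
      finally show ?thesis .
    qed
    moreover have "\<kappa>' * M * (4 * (L * (Ca * d))) \<le> 1 * M * (4 * (L * (Ca * d)))"
      using \<kappa> M L_pos Ca_nonneg d0 by (intro mult_right_mono) auto
    moreover have "\<kappa> * d * (1 + 4 * (L * Ca) * M) + M * (4 * (L * Ca) * d) \<le> (\<kappa> + D * M) * d"
      by (rule boundary_D) (use \<kappa> d0 in auto)
    moreover have "0 \<le> \<kappa> * d * (4 * (L * Ca) * M)" using \<kappa> d0 LCa_nonneg M by simp
    ultimately show ?thesis by (simp add: algebra_simps)
  qed
  let ?F = "\<lambda>\<eta>. wsrc f k (flow L (spd f k) ?s \<eta>, \<eta>)" and ?G = "\<lambda>\<eta>. wsrc g k (flow L (spd g k) ?s' \<eta>, \<eta>)"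
  have 2: "\<bar>integral {0..x} (\<lambda>\<eta>. ?F \<eta> - ?G \<eta>)\<bar> \<le> (exp (\<Gamma> * x) - 1) * ((1 + D * M) * d)"
  proof (rule exp_weighted_integral_le)
    show "(\<lambda>\<eta>. ?F \<eta> - ?G \<eta>) integrable_on {0..x}"
      by (intro integrable_diff wsrc_along_integrable[OF f f.speed_field_axioms] wsrc_along_integrable[OF g g.speed_field_axioms])
  next
    fix y assume "y \<in> {0..x}"
    then have y: "y \<in> {0..L}" using x by auto
    let ?u = "flow L (spd f k) ?s y" and ?v = "flow L (spd g k) ?s' y"
    have "\<bar>src f k (?u, y) - src f k (?v, y)\<bar> \<le> (3 * \<Gamma> + C3) * M * \<bar>?u - ?v\<bar>" by (rule src_lip[OF f])
    also have "\<dots> \<le> (3 * \<Gamma> + C3) * M * (10 * (L * (Ca * d)))"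
      using \<Gamma>_pos C3_nonneg M
      by (intro mult_left_mono f.flow_label_perturb[OF g.speed_field_axioms a x y]) auto
    finally have "\<bar>src f k (?u, y) - src f k (?v, y)\<bar> \<le> (3 * \<Gamma> + C3) * M * (10 * (L * (Ca * d)))" .
    moreover have "\<bar>src f k (?v, y) - src g k (?v, y)\<bar> \<le> (\<Gamma> + C3 * M) * d" by (rule src_diff[OF f g d])
    ultimately have "\<bar>src f k (?u, y) - src g k (?v, y)\<bar> \<le> (3 * \<Gamma> + C3) * M * (10 * (L * (Ca * d))) + (\<Gamma> + C3 * M) * d"
      by linarith
    also have "\<dots> = ((\<Gamma> + C3 * M) + (3 * \<Gamma> + C3) * M * (10 * (L * Ca))) * d" by (simp add: algebra_simps)
    also have "\<dots> \<le> \<Gamma> * (1 + D * M) * d" by (rule mult_right_mono[OF D_solve d0])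
    finally have "exp (\<Gamma> * y) * \<bar>src f k (?u, y) - src g k (?v, y)\<bar> \<le> exp (\<Gamma> * y) * (\<Gamma> * (1 + D * M) * d)"
      by (rule mult_left_mono) simp
    moreover have "?F y - ?G y = exp (\<Gamma> * y) * (src f k (?u, y) - src g k (?v, y))"
      using y by (simp add: wsrc_def right_diff_distrib)
    ultimately show "\<bar>?F y - ?G y\<bar> \<le> exp (\<Gamma> * y) * (\<Gamma> * ((1 + D * M) * d))"
      by (simp add: abs_mult mult.assoc)
  qed (use x in auto)
  have "integral {0..x} (\<lambda>\<eta>. ?F \<eta> - ?G \<eta>) = integral {0..x} ?F - integral {0..x} ?G"
    by (intro integral_diff wsrc_along_integrable[OF f f.speed_field_axioms] wsrc_along_integrable[OF g g.speed_field_axioms])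
  then have eq: "transport L (spd f k) (V f k) (wsrc f k) (t, x) - transport L (spd g k) (V g k) (wsrc g k) (t, x)
    = (V f k ?s - V g k ?s') + integral {0..x} (\<lambda>\<eta>. ?F \<eta> - ?G \<eta>)"
    by (simp add: transport_def Let_def)
  show ?thesis
    unfolding z solve_def case_prod_conv t_def[symmetric] x_def[symmetric] right_diff_distrib[symmetric] eq
    using 1 2 by (intro weighted_bound order_trans[OF abs_triangle_ineq add_mono]) (use x \<kappa> d0 in auto)
qed

text \<open>Both rates live over the same iterate, hence on the same characteristics, and no modulus
  of continuity of the rates is needed. Characteristics only look back in time, so a comparison up
  to \<open>S\<close> closes; this matters because rates will converge uniformly only on bounded
  time intervals.\<close>

lemma rate_contraction:
  assumes f: "adm f" and r1: "adm_rate r1" and r2: "adm_rate r2" and S: "0 \<le> S" and t0: "t0 \<le> S"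
    and d: "\<And>k t x. t \<le> S \<Longrightarrow> \<bar>r1 k (t, x) - r2 k (t, x)\<bar> \<le> d"
  shows "\<bar>rate f r1 k (t0, x0) - rate f r2 k (t0, x0)\<bar> \<le> \<theta> \<kappa> * d"
proof -
  define t x where "t = max 0 t0" and "x = clip L x0"
  have x: "x \<in> {0..L}" unfolding x_def by (rule clip_mem[OF L_nonneg])
  have tS: "t \<le> S" using S t0 by (simp add: t_def)
  have d0: "0 \<le> d" using order_trans[OF abs_ge_zero d[OF t0]] .
  interpret r1: speed_field_C1 L "2 / c0" "Ca * M" "spd f k" "spd' f r1 k" by (rule speed_field_C1_spd[OF f r1])
  interpret r2: speed_field_C1 L "2 / c0" "Ca * M" "spd f k" "spd' f r2 k" by (rule speed_field_C1_spd[OF f r2])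
  let ?s = "label L (spd f k) (t, x)"
  have sS: "?s \<le> S" using r1.label_le[OF x, of t] tS by linarith
  have flS: "flow L (spd f k) ?s \<eta> \<le> S" if "\<eta> \<in> {0..x}" for \<eta>
    using r1.flow_mono[of \<eta> x ?s] x that tS by simp
  have al: "\<bar>along L (spd f k) (spd' f r1 k) ?s \<eta> - along L (spd f k) (spd' f r2 k) ?s \<eta>\<bar> \<le> Ca * d" if "\<eta> \<in> {0..x}" for \<eta>
    using spd'_diff[of f r1 k "flow L (spd f k) ?s \<eta>" \<eta> r2 d, OF f d[OF flS[OF that]] d[OF flS[OF that]]] Ca_nonneg d0
    by (auto simp: along_def)
  have ex: "\<bar>integral {0..y} (along L (spd f k) (spd' f r1 k) ?s) - integral {0..y} (along L (spd f k) (spd' f r2 k) ?s)\<bar>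
    \<le> L * Ca * d" if y: "y \<in> {0..x}" for y
  proof -
    have yL: "y \<in> {0..L}" using y x by auto
    have "\<bar>integral {0..y} (\<lambda>\<eta>. along L (spd f k) (spd' f r1 k) ?s \<eta> - along L (spd f k) (spd' f r2 k) ?s \<eta>)\<bar> \<le> Ca * d * y"
      by (rule abs_integral_le[OF integrable_diff[OF r1.along_rate_integrable[OF yL] r2.along_rate_integrable[OF yL]]])
        (use y al in auto)
    also have "\<dots> \<le> Ca * d * L" using yL Ca_nonneg d0 by (intro mult_left_mono) auto
    finally show ?thesis
      by (simp add: integral_diff[OF r1.along_rate_integrable[OF yL] r2.along_rate_integrable[OF yL]] mult_ac)
  qed
  have io: "\<bar>r1.iota ?s x \<eta> - r2.iota ?s x \<eta>\<bar> \<le> 4 * (L * Ca) * d" if \<eta>: "\<eta> \<in> {0..x}" for \<eta>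
  proof -
    have \<eta>L: "\<eta> \<in> {0..L}" using \<eta> x by auto
    have xx: "x \<in> {0..x}" using x by auto
    have K: "2 * (Ca * M * L) \<le> 1 / 2" using sm_Ca by linarith
    let ?e1 = "integral {0..\<eta>} (along L (spd f k) (spd' f r1 k) ?s) - integral {0..x} (along L (spd f k) (spd' f r1 k) ?s)"
    let ?e2 = "integral {0..\<eta>} (along L (spd f k) (spd' f r2 k) ?s) - integral {0..x} (along L (spd f k) (spd' f r2 k) ?s)"
    have "\<bar>exp ?e1 - exp ?e2\<bar> \<le> 2 * \<bar>?e1 - ?e2\<bar>"
      using r1.iota_exponent[OF x \<eta>L, of ?s] r2.iota_exponent[OF x \<eta>L, of ?s] K
      by (intro abs_exp_diff_le) (linarith+)
    moreover have "\<bar>?e1 - ?e2\<bar> \<le> L * Ca * d + L * Ca * d"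
      using order_trans[OF abs_triangle_ineq4 add_mono[OF ex[OF \<eta>] ex[OF xx]]]
      by (simp add: algebra_simps)
    ultimately show ?thesis unfolding r1.iota_def r2.iota_def by (simp add: mult_ac)
  qed
  have i: "\<bar>r1.iota ?s x \<eta>\<bar> \<le> 1 + 4 * (L * Ca) * M" if "\<eta> \<in> {0..L}" for \<eta>
    using r1.iota_bound[OF x that, of ?s] by (simp add: mult_ac)
  have 1: "\<bar>V' r1 k ?s * r1.iota ?s x 0 - V' r2 k ?s * r2.iota ?s x 0\<bar> \<le> (\<kappa> + D * M) * d"
  proof -
    have "\<bar>V' r1 k ?s * r1.iota ?s x 0 - V' r2 k ?s * r2.iota ?s x 0\<bar>
      \<le> \<kappa> * d * (1 + 4 * (L * Ca) * M) + 1 * M * (4 * (L * Ca) * d)"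
    proof (rule abs_mult_diff_le)
      have "\<kappa>' * M \<le> 1 * M" using \<kappa> M by (intro mult_right_mono) auto
      then show "\<bar>V' r2 k ?s\<bar> \<le> 1 * M" using V'_bound[OF r2, of k ?s] by linarith
    qed (use i io x L_pos V'_diff[OF r1 r2 S sS d0 d] in auto)
    also have "\<dots> \<le> (\<kappa> + D * M) * d" using boundary_D[of \<kappa> d] \<kappa> d0 by simp
    finally show ?thesis .
  qed
  let ?F = "\<lambda>\<eta>. along L (spd f k) (wsrc' f r1 k) ?s \<eta> * r1.iota ?s x \<eta>"
    and ?G = "\<lambda>\<eta>. along L (spd f k) (wsrc' f r2 k) ?s \<eta> * r2.iota ?s x \<eta>"
  have iF: "?F integrable_on {0..x}" by (rule r1.rate_mult_iota_integrable[OF wsrc'_cont[OF f r1] wsrc'_bound[OF f r1] x])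
  have iG: "?G integrable_on {0..x}" by (rule r2.rate_mult_iota_integrable[OF wsrc'_cont[OF f r2] wsrc'_bound[OF f r2] x])
  have 2: "\<bar>integral {0..x} (\<lambda>\<eta>. ?F \<eta> - ?G \<eta>)\<bar> \<le> (exp (\<Gamma> * x) - 1) * ((1 + D * M) * d)"
  proof (rule exp_weighted_integral_le[OF integrable_diff[OF iF iG]])
    fix y assume y: "y \<in> {0..x}"
    then have yL: "y \<in> {0..L}" using x by auto
    have "\<bar>along L (spd f k) (wsrc' f r1 k) ?s y - along L (spd f k) (wsrc' f r2 k) ?s y\<bar> \<le> exp (\<Gamma> * y) * ((\<Gamma> + C3 * M) * d)"
    proof -
      have "exp (\<Gamma> * y) * \<bar>src' f r1 k (flow L (spd f k) ?s y, y) - src' f r2 k (flow L (spd f k) ?s y, y)\<bar>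
        \<le> exp (\<Gamma> * y) * ((\<Gamma> + C3 * M) * d)"
        by (intro mult_left_mono src'_diff f d flS y) simp
      moreover have "0 \<le> exp (\<Gamma> * y) * ((\<Gamma> + C3 * M) * d)" using \<Gamma>_pos C3_nonneg M d0 by simp
      ultimately show ?thesis
        using yL by (auto simp: along_def wsrc'_def right_diff_distrib[symmetric] abs_mult)
    qed
    then have "\<bar>?F y - ?G y\<bar> \<le> exp (\<Gamma> * y) * ((\<Gamma> + C3 * M) * d) * (1 + 4 * (L * Ca) * M)
       + exp (\<Gamma> * y) * ((\<Gamma> + C3 * M) * M) * (4 * (L * Ca) * d)"
      by (intro abs_mult_diff_le i io y yL along_wsrc'_le f r2)
    also have "\<dots> = exp (\<Gamma> * y) * (((\<Gamma> + C3 * M) * (1 + 4 * (L * Ca) * M) + (\<Gamma> + C3 * M) * M * (4 * (L * Ca))) * d)"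
      by (simp add: algebra_simps)
    also have "\<dots> \<le> exp (\<Gamma> * y) * (\<Gamma> * (1 + D * M) * d)"
      by (intro mult_left_mono mult_right_mono D_rate d0) simp
    finally show "\<bar>?F y - ?G y\<bar> \<le> exp (\<Gamma> * y) * (\<Gamma> * ((1 + D * M) * d))" by (simp only: mult.assoc)
  qed (use x in auto)
  have eq: "transport_rate L (spd f k) (spd' f r1 k) (V' r1 k) (wsrc' f r1 k) (t, x)
      - transport_rate L (spd f k) (spd' f r2 k) (V' r2 k) (wsrc' f r2 k) (t, x)
    = (V' r1 k ?s * r1.iota ?s x 0 - V' r2 k ?s * r2.iota ?s x 0) + integral {0..x} (\<lambda>\<eta>. ?F \<eta> - ?G \<eta>)"
    unfolding r1.transport_rate_eq[OF x] r2.transport_rate_eq[OF x] integral_diff[OF iF iG] by simp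
  show ?thesis
    unfolding rate_def case_prod_conv t_def[symmetric] x_def[symmetric] right_diff_distrib[symmetric] eq
    using 1 2 by (intro weighted_bound order_trans[OF abs_triangle_ineq add_mono]) (use x \<kappa> d0 in auto)
qed

section \<open>The fixed point and its derivatives\<close>

text \<open>The first iterate must match \<open>f0\<close> and \<open>q0\<close> at time 0 and stay
  small together with its time derivative for all times. The sine achieves this at the cost of
  \<open>\<epsilon>0\<close>; the constant continuation \<open>init\<close> would in general have
  the wrong rate at \<open>t = 0\<close>.\<close>

definition start :: "bool \<Rightarrow> real \<times> real \<Rightarrow> real" where
  "start k = (\<lambda>(t, x). f0 k (clip L x) + q0 k (clip L x) * sin (max 0 t))"

definition start' :: "bool \<Rightarrow> real \<times> real \<Rightarrow> real" where
  "start' k = (\<lambda>(t, x). q0 k (clip L x) * cos (max 0 t))"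

lemma \<epsilon>0_le: "\<epsilon>0 \<le> M"
proof -
  have "0 \<in> {0..L}" using L_pos by simp
  from f0(2)[OF this, of True] show ?thesis by linarith
qed

lemma C1_pair_start: "C1_pair start start'"
proof -
  have q0c: "continuous_on UNIV (\<lambda>z::real \<times> real. q0 k (clip L (snd z)))" for k
    by (rule continuous_on_compose2[OF q0(1)])
      (use clip_mem[OF L_nonneg] in \<open>auto intro!: continuous_intros simp del: atLeastAtMost_iff\<close>)
  have f0c: "continuous_on UNIV (\<lambda>z::real \<times> real. f0 k (clip L (snd z)))" for k
    by (rule continuous_on_compose2[OF f0_cont])
      (use clip_mem[OF L_nonneg] in \<open>auto intro!: continuous_intros simp del: atLeastAtMost_iff\<close>)
  have c: "continuous_on UNIV (start k)" "continuous_on UNIV (start' k)" for k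
    unfolding start_def start'_def case_prod_beta by (intro continuous_intros q0c f0c)+
  have bd': "\<bar>start' k z\<bar> \<le> M" for k z
  proof -
    have "\<bar>q0 k (clip L (snd z)) * cos (max 0 (fst z))\<bar> \<le> \<epsilon>0 * 1"
      by (intro abs_mult_le q0_bound clip_mem L_nonneg abs_cos_le_one)
    then show ?thesis using \<epsilon>0_le by (simp add: start'_def case_prod_beta)
  qed
  have bd: "\<bar>start k z\<bar> \<le> M" for k z
  proof -
    have "\<bar>q0 k (clip L (snd z)) * sin (max 0 (fst z))\<bar> \<le> \<epsilon>0 * 1"
      by (intro abs_mult_le q0_bound clip_mem L_nonneg abs_sin_le_one)
    then show ?thesis using f0(2)[OF clip_mem[OF L_nonneg], of k "snd z"]
      by (simp add: start_def case_prod_beta)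
  qed
  have d: "((\<lambda>t. start k (t, x)) has_real_derivative start' k (t, x)) (at t)" if "0 < t" for k t x
  proof -
    have "((\<lambda>t. f0 k (clip L x) + q0 k (clip L x) * sin t) has_real_derivative q0 k (clip L x) * cos t) (at t)"
      by (auto intro!: derivative_eq_intros)
    then have "((\<lambda>t. start k (t, x)) has_real_derivative q0 k (clip L x) * cos t) (at t)"
      by (rule has_field_derivative_transform_within[where d = t])
        (use that in \<open>auto simp: start_def dist_real_def\<close>)
    then show ?thesis using that by (simp add: start'_def)
  qed
  have h: "half_C1 M (start k) (start' k)" for k
    unfolding half_C1_def by (intro conjI allI impI c bd' d) (auto simp: start_def)
  have "adm start" unfolding adm_def
    by (intro allI conjI impI c bd half_C1_lip[OF h]) (simp add: start_def)
  moreover have "adm_rate start'" unfolding adm_rate_def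
    by (intro allI conjI impI c bd') (simp add: start'_def)
  ultimately show ?thesis using d by (simp add: C1_pair_def)
qed

lemma adm_limit:
  assumes u: "\<And>n. adm (u n)" and e: "e \<longlonglongrightarrow> 0" and b: "\<And>n k z. \<bar>u n k z - F k z\<bar> \<le> e n"
  shows "adm F"
proof -
  have l: "(\<lambda>n. u n k z) \<longlonglongrightarrow> F k z" for k z
    by (rule tendsto_of_bound[OF e b])
  show ?thesis unfolding adm_def
  proof (intro allI conjI impI)
    fix k z t t' x
    show "continuous_on UNIV (F k)"
      by (rule continuous_limit_of_bound[of UNIV "\<lambda>n. u n k" e]) (use admD(1)[OF u] e b in auto)
    show "\<bar>F k z\<bar> \<le> M"
      by (rule LIMSEQ_le_const2[OF tendsto_rabs[OF l]]) (use admD(2)[OF u] in auto)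
    show "\<bar>F k (t, x) - F k (t', x)\<bar> \<le> M * \<bar>t - t'\<bar>"
      by (rule LIMSEQ_le_const2[OF tendsto_rabs[OF tendsto_diff[OF l l]]]) (use admD(3)[OF u] in auto)
    assume "t \<le> 0"
    then have "u n k (t, x) = f0 k (clip L x)" for n by (rule admD(4)[OF u])
    then show "F k (t, x) = f0 k (clip L x)" using l[of k "(t, x)"] by (simp add: LIMSEQ_const_iff)
  qed
qed

lemma adm_rate_limit:
  assumes u: "\<And>n. adm_rate (u n)" and e: "e \<longlonglongrightarrow> 0" and b: "\<And>n k z. \<bar>u n k z - F k z\<bar> \<le> e n"
  shows "adm_rate F"
proof -
  have l: "(\<lambda>n. u n k z) \<longlonglongrightarrow> F k z" for k z
    by (rule tendsto_of_bound[OF e b])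
  show ?thesis unfolding adm_rate_def
  proof (intro allI conjI impI)
    fix k z and t x :: real
    show "continuous_on UNIV (F k)"
      by (rule continuous_limit_of_bound[of UNIV "\<lambda>n. u n k" e]) (use adm_rateD(1)[OF u] e b in auto)
    show "\<bar>F k z\<bar> \<le> M"
      by (rule LIMSEQ_le_const2[OF tendsto_rabs[OF l]]) (use adm_rateD(2)[OF u] in auto)
    assume "t \<le> 0"
    then have "u n k (t, x) = q0 k (clip L x)" for n by (rule adm_rateD(3)[OF u])
    then show "F k (t, x) = q0 k (clip L x)" using l[of k "(t, x)"] by (simp add: LIMSEQ_const_iff)
  qed
qed

lemma rate_fixed_point:
  assumes \<phi>: "adm \<phi>"
  obtains r where "adm_rate r" "rate \<phi> r = r"
proof (rule contraction_fixed_point[of adm_rate "rate \<phi>" start' "\<theta> \<kappa>" adm_rate "2 * M"])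
  show s: "adm_rate start'" using C1_pair_start by (simp add: C1_pair_def)
  show "\<bar>rate \<phi> start' i z - start' i z\<bar> \<le> 2 * M" for i z
    using rate_bound[OF \<phi> s, of i z] adm_rateD(2)[OF s, of i z] by linarith
  fix f g d i z assume "adm_rate f" "adm_rate g" and d: "\<And>i z. \<bar>f i z - g i z\<bar> \<le> d"
  then show "\<bar>rate \<phi> f i z - rate \<phi> g i z\<bar> \<le> \<theta> \<kappa> * d"
    using rate_contraction[OF \<phi>, of f g "max 0 (fst z)" "fst z" d i "snd z"] by simp
next
  fix F u and e :: "nat \<Rightarrow> real"
  assume "\<And>n. adm_rate (u n)" "e \<longlonglongrightarrow> 0" "\<And>n i z. \<bar>u n i z - F i z\<bar> \<le> e n"
  then show "adm_rate F" by (rule adm_rate_limit)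
qed (use \<theta>_le in \<open>auto intro: adm_rate_rate[OF \<phi>] that\<close>)

text \<open>The rates of the iterates converge although \<open>rate f\<close> does not depend on \<open>f\<close> in a Lipschitz
  way: it is a contraction in the rate, uniformly in \<open>f\<close>, and continuous in \<open>f\<close> at the fixed rate.\<close>

lemma rates_converge:
  assumes F: "\<And>n. C1_pair (F n) (R n)" and step: "\<And>n. R (Suc n) = rate (F n) (R n)"
    and \<phi>: "adm \<phi>" and e: "e \<longlonglongrightarrow> 0" and Fe: "\<And>n k z. \<bar>F n k z - \<phi> k z\<bar> \<le> e n"
    and r: "adm_rate r" "rate \<phi> r = r" and S: "0 \<le> S" and \<eta>: "0 < \<eta>"
  shows "\<exists>N. \<forall>n\<ge>N. \<forall>k t x. t \<le> S \<longrightarrow> \<bar>R n k (t, x) - r k (t, x)\<bar> \<le> \<eta>"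
proof -
  have aF: "adm (F n)" "adm_rate (R n)" for n using F[of n] by (auto simp: C1_pair_def)
  \<comment> \<open>The recursion \<open>u \<le> \<theta> u + \<delta>\<close> has the fixed point
    \<open>\<delta> / (1 - \<theta>) = \<eta> / 2\<close>; the other half of \<eta> is left for the
    geometric term.\<close>
  define \<delta> where "\<delta> = \<eta> * (1 - \<theta> \<kappa>) / 2"
  have \<delta>: "0 < \<delta>" using \<eta> \<theta>_le by (simp add: \<delta>_def)
  have "\<exists>N. \<forall>n\<ge>N. \<forall>z\<in>{0..S} \<times> {0..L}. \<bar>rate (F n) r k z - r k z\<bar> < \<delta>" for k
  proof (rule uniform_from_sequential[OF _ _ _ \<delta>])
    fix g :: "nat \<Rightarrow> nat" and p and q :: "nat \<Rightarrow> real \<times> real"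
    assume g: "strict_mono g" and q: "q \<longlonglongrightarrow> p"
    have "(\<lambda>n. rate (F (g n)) r k (q n)) \<longlonglongrightarrow> rate \<phi> r k p"
      by (rule rate_tendsto[OF aF(1) \<phi> r(1) LIMSEQ_subseq_LIMSEQ[OF e g, unfolded o_def] Fe q])
    then show "(\<lambda>n. rate (F (g n)) r k (q n)) \<longlonglongrightarrow> r k p" using r(2) by simp
  qed (auto intro!: compact_Times intro: continuous_on_subset[OF adm_rateD(1)[OF r(1)]])
  then have "\<exists>N. \<forall>k. \<forall>n\<ge>N k. \<forall>z\<in>{0..S} \<times> {0..L}. \<bar>rate (F n) r k z - r k z\<bar> < \<delta>"
    by (intro choice allI)
  then obtain N where N: "\<And>k n z. n \<ge> N k \<Longrightarrow> z \<in> {0..S} \<times> {0..L} \<Longrightarrow> \<bar>rate (F n) r k z - r k z\<bar> < \<delta>"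
    by blast
  define N0 where "N0 = max (N True) (N False)"
  \<comment> \<open>Rates are frozen in the past and clipped in \<open>x\<close>, so the estimate on
    a compact rectangle covers all times up to \<open>S\<close>.\<close>
  have near: "\<bar>rate (F n) r k (t, x) - r k (t, x)\<bar> \<le> \<delta>" if "n \<ge> N0" "t \<le> S" for n k t x
  proof -
    have *: "rate f r k (t, x) = rate f r k (max 0 t, clip L x)" for f by (simp add: rate_def)
    have "n \<ge> N k" using that by (cases k) (auto simp: N0_def)
    moreover have "(max 0 t, clip L x) \<in> {0..S} \<times> {0..L}" using that S clip_mem[OF L_nonneg, of x] by auto
    ultimately have "\<bar>rate (F n) r k (max 0 t, clip L x) - r k (max 0 t, clip L x)\<bar> < \<delta>"
      by (rule N)
    moreover have "r k (t, x) = r k (max 0 t, clip L x)" using *[of \<phi>] unfolding r(2) .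
    ultimately show ?thesis using *[of "F n"] by linarith
  qed
  have ind: "\<bar>R (N0 + m) k (t, x) - r k (t, x)\<bar> \<le> \<theta> \<kappa> ^ m * (2 * M) + \<eta> / 2" if "t \<le> S" for m k t x
    using that
  proof (induction m arbitrary: k t x)
    case 0
    show ?case using adm_rateD(2)[OF aF(2), of N0 k "(t, x)"] adm_rateD(2)[OF r(1), of k "(t, x)"] \<eta> by simp
  next
    case (Suc m)
    have "\<bar>rate (F (N0 + m)) (R (N0 + m)) k (t, x) - rate (F (N0 + m)) r k (t, x)\<bar>
      \<le> \<theta> \<kappa> * (\<theta> \<kappa> ^ m * (2 * M) + \<eta> / 2)"
      by (rule rate_contraction[OF aF r(1) S Suc.prems Suc.IH])
    moreover have "\<bar>rate (F (N0 + m)) r k (t, x) - r k (t, x)\<bar> \<le> \<delta>" by (rule near) (use Suc in auto)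
    moreover have "\<theta> \<kappa> * (\<theta> \<kappa> ^ m * (2 * M) + \<eta> / 2) + \<delta> = \<theta> \<kappa> ^ Suc m * (2 * M) + \<eta> / 2"
      by (simp add: \<delta>_def field_simps)
    ultimately show ?case unfolding add_Suc_right step by linarith
  qed
  have "(\<lambda>m. \<theta> \<kappa> ^ m * (2 * M)) \<longlonglongrightarrow> 0"
    using \<theta>_le by (intro tendsto_mult_left_zero LIMSEQ_power_zero) auto
  then have "\<forall>\<^sub>F m in sequentially. \<theta> \<kappa> ^ m * (2 * M) < \<eta> / 2"
    by (rule order_tendstoD(2)) (use \<eta> in simp)
  then obtain m0 where m0: "\<And>m. m \<ge> m0 \<Longrightarrow> \<theta> \<kappa> ^ m * (2 * M) < \<eta> / 2"
    unfolding eventually_sequentially by blast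
  have "\<bar>R n k (t, x) - r k (t, x)\<bar> \<le> \<eta>" if "n \<ge> N0 + m0" "t \<le> S" for n k t x
  proof -
    have "N0 + (n - N0) = n" "m0 \<le> n - N0" using that(1) by auto
    then show ?thesis using ind[OF that(2), of "n - N0" k x] m0[of "n - N0"] by simp
  qed
  then show ?thesis by blast
qed

text \<open>Uniform convergence of the iterates alone says nothing about derivatives. Their rates
  converge uniformly up to each finite time to the fixed rate, so the fundamental theorem of
  calculus passes to the limit and exhibits the continuous \<open>r\<close> as time
  derivative.\<close>

theorem fixed_point_exists:
  obtains \<phi> r where "adm \<phi>" "adm_rate r" "solve \<phi> = \<phi>"
    "\<And>k t x. 0 \<le> t \<Longrightarrow> ((\<lambda>t. \<phi> k (t, x)) has_real_derivative r k (t, x)) (at t within {0..})"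
proof -
  have C1_adm: "adm f" if "\<exists>r. C1_pair f r" for f using that by (auto simp: C1_pair_def)
  have astart: "adm start" using C1_pair_start by (auto simp: C1_pair_def)
  obtain \<phi> e where \<phi>: "adm \<phi>" "solve \<phi> = \<phi>" and e: "e \<longlonglongrightarrow> 0"
    and F: "\<And>n k z. \<bar>(solve ^^ n) start k z - \<phi> k z\<bar> \<le> e n"
  proof (rule contraction_fixed_point[of "\<lambda>f. \<exists>r. C1_pair f r" solve start "\<theta> \<kappa>" adm "2 * M"])
    show "\<bar>solve start i z - start i z\<bar> \<le> 2 * M" for i z
      using solve_bound[OF astart, of i z] admD(2)[OF astart, of i z] by linarith
    fix f g d i z assume "adm f" "adm g" and d: "\<And>i z. \<bar>f i z - g i z\<bar> \<le> d"
    then show "\<bar>solve f i z - solve g i z\<bar> \<le> \<theta> \<kappa> * d"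
      by (intro solve_contraction) auto
  next
    fix F u and e :: "nat \<Rightarrow> real"
    assume "\<And>n. \<exists>r. C1_pair (u n) r" "e \<longlonglongrightarrow> 0" "\<And>n i z. \<bar>u n i z - F i z\<bar> \<le> e n"
    then show "adm F" by (intro adm_limit[of u e F] C1_adm)
  qed (use \<theta>_le in \<open>auto intro: C1_pair_step C1_pair_start C1_adm that\<close>)
  \<comment> \<open>Rates are iterated alongside the functions, each by the fibre map over the
    current iterate.\<close>
  define R where "R = rec_nat start' (\<lambda>n r. rate ((solve ^^ n) start) r)"
  have R: "R 0 = start'" "R (Suc n) = rate ((solve ^^ n) start) (R n)" for n by (simp_all add: R_def)
  have C1: "C1_pair ((solve ^^ n) start) (R n)" for n
    by (induction n) (auto simp: R C1_pair_start C1_pair_step)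
  obtain r where r: "adm_rate r" "rate \<phi> r = r" by (rule rate_fixed_point[OF \<phi>(1)])
  have "\<phi> k (t, x) = \<phi> k (0, x) + integral {0..t} (\<lambda>u. r k (u, x))" if t: "0 \<le> t" for k t x
  proof -
    let ?F = "\<lambda>n. (solve ^^ n) start"
    have aF: "adm (?F n)" "adm_rate (R n)" for n using C1[of n] by (auto simp: C1_pair_def)
    have ci: "(\<lambda>u. r k (u, x)) integrable_on {0..t}" if "adm_rate r" for r
      by (intro integrable_continuous_interval continuous_on_UNIV_compose[OF adm_rateD(1)[OF that]] continuous_intros)
    have ftc: "integral {0..t} (\<lambda>u. R n k (u, x)) = ?F n k (t, x) - ?F n k (0, x)" for n
    proof (rule integral_unique, rule fundamental_theorem_of_calculus_interior[OF t])
      show "continuous_on {0..t} (\<lambda>u. ?F n k (u, x))"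
        by (intro continuous_on_UNIV_compose[OF admD(1)[OF aF(1)]] continuous_intros)
      fix u assume "u \<in> {0<..<t}"
      then show "((\<lambda>u. ?F n k (u, x)) has_vector_derivative R n k (u, x)) (at u)"
        using C1[of n] by (simp add: C1_pair_def has_real_derivative_iff_has_vector_derivative)
    qed
    have lF: "(\<lambda>n. ?F n k z) \<longlonglongrightarrow> \<phi> k z" for z
      by (rule tendsto_of_bound[OF e F])
    have "(\<lambda>n. integral {0..t} (\<lambda>u. R n k (u, x))) \<longlonglongrightarrow> integral {0..t} (\<lambda>u. r k (u, x))"
    proof (rule LIMSEQ_I)
      fix d :: real assume d: "0 < d"
      define \<eta> where "\<eta> = d / (2 * (t + 1))"
      have \<eta>: "0 < \<eta>" using d t by (simp add: \<eta>_def)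
      obtain N where N: "\<And>n u. n \<ge> N \<Longrightarrow> u \<le> t \<Longrightarrow> \<bar>R n k (u, x) - r k (u, x)\<bar> \<le> \<eta>"
        using rates_converge[of ?F R, OF C1 R(2) \<phi>(1) e F r t \<eta>] by blast
      have "norm (integral {0..t} (\<lambda>u. R n k (u, x)) - integral {0..t} (\<lambda>u. r k (u, x))) < d" if "n \<ge> N" for n
      proof -
        have "\<bar>integral {0..t} (\<lambda>u. R n k (u, x) - r k (u, x))\<bar> \<le> \<eta> * t"
          by (rule abs_integral_le[OF integrable_diff[OF ci[OF aF(2)] ci[OF r(1)]] t]) (use N that in auto)
        also have "\<dots> < d"
        proof -
          have "\<eta> * t \<le> \<eta> * (t + 1)" using \<eta> by simp
          also have "\<eta> * (t + 1) = d / 2" using t unfolding \<eta>_def by (simp add: divide_simps)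
          finally show ?thesis using d by linarith
        qed
        finally show ?thesis by (simp add: integral_diff[OF ci[OF aF(2)] ci[OF r(1)]])
      qed
      then show "\<exists>no. \<forall>n\<ge>no. norm (integral {0..t} (\<lambda>u. R n k (u, x)) - integral {0..t} (\<lambda>u. r k (u, x))) < d"
        by blast
    qed
    moreover have "(\<lambda>n. ?F n k (t, x) - ?F n k (0, x)) \<longlonglongrightarrow> \<phi> k (t, x) - \<phi> k (0, x)"
      by (intro tendsto_diff lF)
    ultimately have "integral {0..t} (\<lambda>u. r k (u, x)) = \<phi> k (t, x) - \<phi> k (0, x)"
      unfolding ftc by (rule LIMSEQ_unique)
    then show ?thesis by simp
  qed
  note int = this
  have "((\<lambda>t. \<phi> k (t, x)) has_real_derivative r k (t, x)) (at t within {0..})" if t: "0 \<le> t" for k t x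
  proof -
    have "((\<lambda>t. \<phi> k (0, x) + integral {0..t} (\<lambda>u. r k (u, x))) has_real_derivative 0 + r k (t, x)) (at t within {0..t + 1})"
      by (intro DERIV_add DERIV_const integral_has_real_derivative
        continuous_on_UNIV_compose[OF adm_rateD(1)[OF r(1)]] continuous_intros) (use t in auto)
    then have "((\<lambda>t. \<phi> k (0, x) + integral {0..t} (\<lambda>u. r k (u, x))) has_real_derivative r k (t, x)) (at t within {0..})"
      unfolding at_within_atLeast[OF t] by simp
    then show ?thesis
      by (rule has_field_derivative_transform_within[where d = 1]) (use t int[symmetric] in auto)
  qed
  then show thesis by (rule that[OF \<phi>(1) r(1) \<phi>(2)])
qed

section \<open>Boundary condition and space derivative of the fixed point\<close>

context
  fixes \<phi> r :: "bool \<Rightarrow> real \<times> real \<Rightarrow> real"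
  assumes adm: "adm \<phi>" and admr: "adm_rate r" and fp: "solve \<phi> = \<phi>"
    and dt: "\<And>k t x. 0 \<le> t \<Longrightarrow> ((\<lambda>t. \<phi> k (t, x)) has_real_derivative r k (t, x)) (at t within {0..})"
begin

lemma fixed_boundary:
  assumes "0 \<le> t" shows "\<phi> k (t, 0) = h k t + \<kappa>s k * \<phi> (\<not> k) (t, L)"
proof -
  interpret f: speed_field L "2 / c0" "Ca * M" "spd \<phi> k" by (rule speed_field_spd[OF adm])
  have "solve \<phi> k (t, 0) = V \<phi> k t" using assms L_pos by (simp add: solve_def transport_def clip_def)
  then show ?thesis using assms by (simp add: fp V_def)
qed

lemma fixed_along_flow:
  assumes "y \<in> {0..L}" "0 \<le> flow L (spd \<phi> k) s y"
  shows "\<phi> k (flow L (spd \<phi> k) s y, y) = exp (- \<Gamma> * y) *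
    (V \<phi> k s + integral {0..y} (\<lambda>\<eta>. wsrc \<phi> k (flow L (spd \<phi> k) s \<eta>, \<eta>)))"
proof -
  interpret f: speed_field L "2 / c0" "Ca * M" "spd \<phi> k" by (rule speed_field_spd[OF adm])
  have "solve \<phi> k (flow L (spd \<phi> k) s y, y) = exp (- \<Gamma> * y) *
    (V \<phi> k s + integral {0..y} (\<lambda>\<eta>. wsrc \<phi> k (flow L (spd \<phi> k) s \<eta>, \<eta>)))"
    using assms by (simp add: solve_def transport_def Let_def)
  then show ?thesis by (simp add: fp)
qed

text \<open>The integral formula yields the derivative along characteristics, and \<open>r\<close>
  is the time derivative. An increment in \<open>x\<close> is split into a step along the
  characteristic through \<open>(t, x)\<close> and a step in time. At \<open>t = 0\<close> the
  initial equation is used instead, since there the characteristic comes from the past.\<close>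

lemma fixed_DERIV_x:
  assumes t: "0 \<le> t" and x: "x \<in> {0..L}"
  shows "((\<lambda>y. \<phi> k (t, y)) has_real_derivative
    - spd \<phi> k (t, x) * b k (t, x) * (\<phi> k (t, x) + \<phi> (\<not> k) (t, L - x)) - spd \<phi> k (t, x) * r k (t, x)) (at x within {0..L})"
proof (cases "t = 0")
  case True
  have z: "\<phi> k (0, y) = f0 k y" if "y \<in> {0..L}" for y k using admD(4)[OF adm, of 0 k y] that by simp
  have z': "\<phi> (\<not> k) (0, L - x) = f0 (\<not> k) (L - x)" using z[of "L - x"] x by simp
  have zr: "r k (0, x) = q0 k x" using adm_rateD(3)[OF admr, of 0 k x] x by simp
  have a: "spd \<phi> k (0, x) * (c0 + p k * f0 k x + q k * f0 (\<not> k) (L - x)) = 1"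
    using den_pos[OF adm, of k "(0, x)"] z[OF x] z' by (simp add: spd_def den_def)
  have "f0' k x = spd \<phi> k (0, x) * (- b k (0, x) * (f0 k x + f0 (\<not> k) (L - x)) - q0 k x)"
    unfolding init_pde[OF x, symmetric] mult.assoc[symmetric] a by simp
  then have eq: "f0' k x = - spd \<phi> k (t, x) * b k (t, x) * (\<phi> k (t, x) + \<phi> (\<not> k) (t, L - x)) - spd \<phi> k (t, x) * r k (t, x)"
    unfolding True z[OF x] z' zr by (simp add: algebra_simps)
  have "((\<lambda>y. \<phi> k (t, y)) has_real_derivative f0' k x) (at x within {0..L})"
    by (rule has_field_derivative_transform_within[OF f0(1)[OF x], where d = 1]) (use x z True in auto)
  then show ?thesis unfolding eq .
next
  case False
  then have t: "0 < t" using t by simp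
  interpret f: speed_field L "2 / c0" "Ca * M" "spd \<phi> k" by (rule speed_field_spd[OF adm])
  define s where "s = label L (spd \<phi> k) (t, x)"
  define \<tau> where "\<tau> = flow L (spd \<phi> k) s"
  have \<tau>x: "\<tau> x = t" unfolding \<tau>_def s_def using x by simp
  have d\<tau>: "(\<tau> has_real_derivative spd \<phi> k (t, x)) (at x within {0..L})"
    using f.flow_deriv[OF x, of s] \<tau>x unfolding \<tau>_def by simp
  have \<tau>lim: "(\<tau> \<longlongrightarrow> t) (at x within {0..L})"
    using DERIV_continuous[OF d\<tau>] \<tau>x by (simp add: continuous_within)
  have ev: "\<forall>\<^sub>F y in at x within {0..L}. 0 < \<tau> y" by (rule order_tendstoD(1)[OF \<tau>lim t])
  have evL: "\<forall>\<^sub>F y in at x within {0..L}. y \<in> {0..L}" by (simp add: eventually_at_filter)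
  let ?I = "\<lambda>y. exp (- \<Gamma> * y) * (V \<phi> k s + integral {0..y} (\<lambda>\<eta>. wsrc \<phi> k (\<tau> \<eta>, \<eta>)))"
  have along: "\<phi> k (\<tau> y, y) = ?I y" if "y \<in> {0..L}" "0 < \<tau> y" for y
    using fixed_along_flow[of y k s] that by (simp add: \<tau>_def)
  have Ix: "?I x = \<phi> k (t, x)" using along[OF x] \<tau>x t by simp
  have dI: "(?I has_real_derivative (exp (- \<Gamma> * x) * - \<Gamma>) * (V \<phi> k s + integral {0..x} (\<lambda>\<eta>. wsrc \<phi> k (\<tau> \<eta>, \<eta>)))
      + (0 + wsrc \<phi> k (\<tau> x, x)) * exp (- \<Gamma> * x)) (at x within {0..L})"
  proof (intro DERIV_mult DERIV_add DERIV_const)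
    show "((\<lambda>y. exp (- \<Gamma> * y)) has_real_derivative exp (- \<Gamma> * x) * - \<Gamma>) (at x within {0..L})"
      by (auto intro!: derivative_eq_intros)
    show "((\<lambda>y. integral {0..y} (\<lambda>\<eta>. wsrc \<phi> k (\<tau> \<eta>, \<eta>))) has_real_derivative wsrc \<phi> k (\<tau> x, x)) (at x within {0..L})"
      by (rule integral_has_real_derivative[OF _ x])
        (auto intro!: continuous_on_UNIV_compose[OF wsrc_cont[OF adm]] continuous_intros f.flow_cont simp: \<tau>_def)
  qed
  have e1: "(exp (- \<Gamma> * x) * - \<Gamma>) * (V \<phi> k s + integral {0..x} (\<lambda>\<eta>. wsrc \<phi> k (\<tau> \<eta>, \<eta>)))
      + (0 + wsrc \<phi> k (\<tau> x, x)) * exp (- \<Gamma> * x) = - \<Gamma> * ?I x + exp (- \<Gamma> * x) * wsrc \<phi> k (t, x)"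
    unfolding \<tau>x by (simp add: algebra_simps)
  have e2: "- \<Gamma> * ?I x + exp (- \<Gamma> * x) * wsrc \<phi> k (t, x)
      = - spd \<phi> k (t, x) * b k (t, x) * (\<phi> k (t, x) + \<phi> (\<not> k) (t, L - x))"
    unfolding Ix using x by (simp add: wsrc_def src_def mult.assoc[symmetric] mult_exp_exp)
  have "(?I has_real_derivative - spd \<phi> k (t, x) * b k (t, x) * (\<phi> k (t, x) + \<phi> (\<not> k) (t, L - x))) (at x within {0..L})"
    by (rule DERIV_cong[OF dI trans[OF e1 e2]])
  then have I: "((\<lambda>y. (?I y - ?I x) / (y - x)) \<longlongrightarrow> - spd \<phi> k (t, x) * b k (t, x) * (\<phi> k (t, x) + \<phi> (\<not> k) (t, L - x))) (at x within {0..L})"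
    unfolding has_field_derivative_iff .
  have dtat: "((\<lambda>t. \<phi> k (t, y)) has_real_derivative r k (u, y)) (at u)" if "0 < u" for u y
    using dt[of u k y] that at_within_interior[of u "{0..}"] by simp
  \<comment> \<open>The time step is taken at the moving abscissa \<open>y\<close>. Writing it as a
    rate at an intermediate time lets the joint continuity of \<open>r\<close> give the
    limit.\<close>
  have mvt: "\<exists>z. \<bar>z - t\<bar> \<le> \<bar>\<tau> y - t\<bar> \<and> \<phi> k (t, y) - \<phi> k (\<tau> y, y) = (t - \<tau> y) * r k (z, y)" if "0 < \<tau> y" for y
  proof (cases "\<tau> y" t rule: linorder_cases)
    case less
    have "\<exists>z>\<tau> y. z < t \<and> \<phi> k (t, y) - \<phi> k (\<tau> y, y) = (t - \<tau> y) * r k (z, y)"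
      by (rule MVT2[OF less]) (use that dtat in auto)
    then obtain z where "\<tau> y < z" "z < t" "\<phi> k (t, y) - \<phi> k (\<tau> y, y) = (t - \<tau> y) * r k (z, y)" by blast
    then show ?thesis by (intro exI[of _ z]) auto
  next
    case equal then show ?thesis by auto
  next
    case greater
    have "\<exists>z>t. z < \<tau> y \<and> \<phi> k (\<tau> y, y) - \<phi> k (t, y) = (\<tau> y - t) * r k (z, y)"
      by (rule MVT2[OF greater]) (use t dtat in auto)
    then obtain z where "t < z" "z < \<tau> y" "\<phi> k (\<tau> y, y) - \<phi> k (t, y) = (\<tau> y - t) * r k (z, y)" by blast
    then show ?thesis by (intro exI[of _ z]) (auto simp: algebra_simps)
  qed
  then have "\<exists>\<zeta>. \<forall>y. 0 < \<tau> y \<longrightarrow> \<bar>\<zeta> y - t\<bar> \<le> \<bar>\<tau> y - t\<bar> \<and> \<phi> k (t, y) - \<phi> k (\<tau> y, y) = (t - \<tau> y) * r k (\<zeta> y, y)"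
    by (intro choice allI) blast
  then obtain \<zeta> where \<zeta>: "\<And>y. 0 < \<tau> y \<Longrightarrow> \<bar>\<zeta> y - t\<bar> \<le> \<bar>\<tau> y - t\<bar>"
    "\<And>y. 0 < \<tau> y \<Longrightarrow> \<phi> k (t, y) - \<phi> k (\<tau> y, y) = (t - \<tau> y) * r k (\<zeta> y, y)"
    by blast
  have "((\<lambda>y. \<zeta> y - t) \<longlongrightarrow> 0) (at x within {0..L})"
  proof (rule Lim_null_comparison)
    show "\<forall>\<^sub>F y in at x within {0..L}. norm (\<zeta> y - t) \<le> \<bar>\<tau> y - t\<bar>"
      by (rule eventually_mono[OF ev]) (use \<zeta> in auto)
    show "((\<lambda>y. \<bar>\<tau> y - t\<bar>) \<longlongrightarrow> 0) (at x within {0..L})"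
      using \<tau>lim by (intro tendsto_rabs_zero) (simp add: LIM_zero_iff)
  qed
  then have "(\<zeta> \<longlongrightarrow> t) (at x within {0..L})" by (simp add: LIM_zero_iff)
  then have rl: "((\<lambda>y. r k (\<zeta> y, y)) \<longlongrightarrow> r k (t, x)) (at x within {0..L})"
    by (intro continuous_on_tendsto_UNIV[OF adm_rateD(1)[OF admr]] tendsto_Pair tendsto_ident_at)
  have "((\<lambda>y. (?I y - ?I x) / (y - x) - (\<tau> y - \<tau> x) / (y - x) * r k (\<zeta> y, y)) \<longlongrightarrow>
    - spd \<phi> k (t, x) * b k (t, x) * (\<phi> k (t, x) + \<phi> (\<not> k) (t, L - x)) - spd \<phi> k (t, x) * r k (t, x)) (at x within {0..L})"
    by (intro tendsto_diff[OF I] tendsto_mult rl) (use d\<tau> in \<open>simp add: has_field_derivative_iff\<close>)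
  moreover have "\<forall>\<^sub>F y in at x within {0..L}. (?I y - ?I x) / (y - x) - (\<tau> y - \<tau> x) / (y - x) * r k (\<zeta> y, y)
      = (\<phi> k (t, y) - \<phi> k (t, x)) / (y - x)"
    using ev evL
  proof eventually_elim
    case (elim y)
    have "\<phi> k (t, y) = ?I y + (t - \<tau> y) * r k (\<zeta> y, y)"
      using \<zeta>(2)[OF elim(1)] along[OF elim(2,1)] by linarith
    then have "\<phi> k (t, y) - \<phi> k (t, x) = (?I y - ?I x) - (\<tau> y - \<tau> x) * r k (\<zeta> y, y)"
      unfolding Ix[symmetric] \<tau>x by (simp add: algebra_simps)
    then have "(\<phi> k (t, y) - \<phi> k (t, x)) / (y - x) = ((?I y - ?I x) - (\<tau> y - \<tau> x) * r k (\<zeta> y, y)) / (y - x)"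
      by (rule arg_cong)
    then show ?case unfolding diff_divide_distrib[of "?I y - ?I x"] times_divide_eq_left by (rule sym)
  qed
  ultimately show ?thesis
    unfolding has_field_derivative_iff by (rule Lim_transform_eventually)
qed

end

end

section \<open>A maximum principle\<close>

text \<open>The quantity \<open>\<bar>z\<bar> exp (\<omega> t) / g\<close> is maximised over both
  components and the compact rectangle. A maximum above \<open>Z / \<kappa>'\<close> is excluded at
  \<open>t = 0\<close> by the initial bound, and at \<open>x = 0\<close> by the reflection, since
  \<open>g 0 = \<kappa>'\<close> and \<open>g < 1\<close>; elsewhere left derivatives contradict the
  equation. The rate \<omega> may have either sign: positive for decay, negative for uniqueness with
  a large reference slope.\<close>

lemma comparison_principle:
  fixes z zt zx s b :: "bool \<Rightarrow> real \<times> real \<Rightarrow> real" and \<kappa>s :: "bool \<Rightarrow> real"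
  assumes L: "0 < L" and S: "0 \<le> S"
    and cont: "\<And>k. continuous_on ({0..S} \<times> {0..L}) (z k)"
    and dt: "\<And>k t x. 0 < t \<Longrightarrow> t \<le> S \<Longrightarrow> x \<in> {0..L} \<Longrightarrow>
      ((\<lambda>t. z k (t, x)) has_real_derivative zt k (t, x)) (at t within {0..t})"
    and dx: "\<And>k t x. 0 < t \<Longrightarrow> t \<le> S \<Longrightarrow> 0 < x \<Longrightarrow> x \<le> L \<Longrightarrow>
      ((\<lambda>x. z k (t, x)) has_real_derivative zx k (t, x)) (at x within {0..x})"
    and s: "0 < s0" "\<And>k t x. 0 < t \<Longrightarrow> t \<le> S \<Longrightarrow> x \<in> {0..L} \<Longrightarrow> s0 \<le> s k (t, x)"
    and b: "\<And>k t x. 0 < t \<Longrightarrow> t \<le> S \<Longrightarrow> x \<in> {0..L} \<Longrightarrow> 0 \<le> b k (t, x) \<and> b k (t, x) \<le> B"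
    and eq: "\<And>k t x. 0 < t \<Longrightarrow> t \<le> S \<Longrightarrow> x \<in> {0..L} \<Longrightarrow>
      \<bar>zt k (t, x) + s k (t, x) * zx k (t, x) + b k (t, x) * (z k (t, x) + z (\<not> k) (t, L - x))\<bar>
        \<le> \<eta> * max \<bar>z k (t, x)\<bar> \<bar>z (\<not> k) (t, L - x)\<bar>"
    and \<eta>: "0 \<le> \<eta>"
    and bc: "\<And>k t. 0 < t \<Longrightarrow> t \<le> S \<Longrightarrow> z k (t, 0) = \<kappa>s k * z (\<not> k) (t, L)"
    and \<kappa>: "\<And>k. \<bar>\<kappa>s k\<bar> \<le> \<kappa>'" "0 < \<kappa>'" "\<kappa>' < 1"
    and init: "\<And>k x. x \<in> {0..L} \<Longrightarrow> \<bar>z k (0, x)\<bar> \<le> Z"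
    and m: "0 \<le> m" "B + 1 \<le> s0 * m"
    and \<omega>: "\<And>y. \<kappa>' \<le> y \<Longrightarrow> y \<le> 1 - (1 - \<kappa>') * exp (- m * L) \<Longrightarrow> \<eta> < (1 - y) - \<omega> * y"
    and tx: "t \<in> {0..S}" "x \<in> {0..L}"
  shows "\<bar>z k (t, x)\<bar> \<le> Z / \<kappa>' * exp (- \<omega> * t)"
proof -
  define g where "g x = 1 - (1 - \<kappa>') * exp (- m * x)" for x
  have g: "\<kappa>' \<le> g x" "g x \<le> 1 - (1 - \<kappa>') * exp (- m * L)" if "x \<in> {0..L}" for x
  proof -
    have "exp (- m * L) \<le> exp (- m * x)" "exp (- m * x) \<le> 1" using that m by (auto intro: mult_left_mono)
    then have "(1 - \<kappa>') * exp (- m * L) \<le> (1 - \<kappa>') * exp (- m * x)" "(1 - \<kappa>') * exp (- m * x) \<le> (1 - \<kappa>') * 1"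
      using \<kappa> by (auto intro!: mult_left_mono)
    then show "\<kappa>' \<le> g x" "g x \<le> 1 - (1 - \<kappa>') * exp (- m * L)" by (auto simp: g_def)
  qed
  have g1: "g x < 1" for x using \<kappa> by (simp add: g_def)
  have gpos: "0 < g x" if "x \<in> {0..L}" for x using g(1)[OF that] \<kappa> by linarith
  \<comment> \<open>The slope of the weight is proportional to the gap \<open>1 - g\<close>, the
    very quantity that controls how far the coupling can outweigh the damping at a maximum.\<close>
  have dg: "(g has_real_derivative m * (1 - g x)) (at x within U)" for x U
    unfolding g_def by (auto intro!: derivative_eq_intros)
  define q where "q k = (\<lambda>(t, x). \<bar>z k (t, x)\<bar> * exp (\<omega> * t) / g x)" for k
  have gc: "continuous_on U (\<lambda>p. g (snd p))" for U :: "(real \<times> real) set"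
    unfolding g_def by (intro continuous_intros)
  have qc: "continuous_on ({0..S} \<times> {0..L}) (q k)" for k
    unfolding q_def case_prod_beta prod.collapse
    by (intro continuous_intros cont gc) (use gpos in force)
  have ne: "{0..S} \<times> {0..L} \<noteq> {}" using S L by auto
  have "\<exists>p\<in>{0..S} \<times> {0..L}. \<forall>p'\<in>{0..S} \<times> {0..L}. q k p' \<le> q k p" for k
    by (rule continuous_attains_sup[OF compact_Times[OF compact_Icc compact_Icc] ne qc])
  then obtain P where P: "\<And>k. P k \<in> {0..S} \<times> {0..L}" "\<And>k p. p \<in> {0..S} \<times> {0..L} \<Longrightarrow> q k p \<le> q k (P k)"
    by metis
  \<comment> \<open>The truth value itself names the component with the larger maximum.\<close>
  define j where "j = (q False (P False) \<le> q True (P True))"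
  obtain u v where uv: "P j = (u, v)" by (cases "P j")
  have u: "0 \<le> u" "u \<le> S" and v: "v \<in> {0..L}" using P(1)[of j] uv by auto
  define Zm where "Zm = q j (u, v)"
  have "q k p \<le> q j (P j)" if "p \<in> {0..S} \<times> {0..L}" for k p
    using P(2)[OF that, of True] P(2)[OF that, of False] by (cases k; cases j) (auto simp: j_def)
  then have max: "\<bar>z k (t, x)\<bar> \<le> Zm * exp (- \<omega> * t) * g x" if "t \<in> {0..S}" "x \<in> {0..L}" for k t x
  proof -
    have "\<bar>z k (t, x)\<bar> * exp (\<omega> * t) / g x \<le> Zm"
      using \<open>\<And>p k. p \<in> {0..S} \<times> {0..L} \<Longrightarrow> q k p \<le> q j (P j)\<close>[of "(t, x)" k] that uv
      by (simp add: q_def Zm_def)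
    then have "\<bar>z k (t, x)\<bar> * exp (\<omega> * t) \<le> Zm * g x"
      using gpos[OF that(2)] by (simp add: pos_divide_le_eq)
    then show ?thesis by (simp add: exp_minus field_simps)
  qed
  have att: "\<bar>z j (u, v)\<bar> = Zm * exp (- \<omega> * u) * g v"
    using gpos[OF v] by (simp add: Zm_def q_def exp_minus)
  have Z: "0 \<le> Z" using order_trans[OF abs_ge_zero init[of 0 True]] L by simp
  have "Zm \<le> Z / \<kappa>'"
  proof (rule ccontr)
    assume "\<not> ?thesis"
    then have big: "Z / \<kappa>' < Zm" by simp
    then have Zm: "0 < Zm" using Z \<kappa> by (meson divide_nonneg_pos le_less_trans)
    define E where "E = Zm * exp (- \<omega> * u)"
    have E: "0 < E" using Zm by (simp add: E_def)
    have att': "\<bar>z j (u, v)\<bar> = E * g v" using att by (simp add: E_def)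
    have u0: "0 < u"
    proof (rule ccontr)
      assume "\<not> 0 < u"
      then have "u = 0" using u by simp
      then have "Zm * g v \<le> Z" using att init[OF v, of j] by simp
      moreover have "Zm * \<kappa>' \<le> Zm * g v" using g(1)[OF v] Zm by simp
      moreover have "Z < Zm * \<kappa>'" using big \<kappa> by (simp add: pos_divide_less_eq)
      ultimately show False by linarith
    qed
    have maxu: "\<bar>z k (u, x)\<bar> \<le> E * g x" if "x \<in> {0..L}" for k x
      using max[of u x k] u that by (simp add: E_def)
    have v0: "0 < v"
    proof (rule ccontr)
      assume "\<not> 0 < v"
      then have v: "v = 0" using v by simp
      have "E * \<kappa>' = \<bar>z j (u, 0)\<bar>" using att' v by (simp add: g_def)
      also have "\<dots> = \<bar>\<kappa>s j\<bar> * \<bar>z (\<not> j) (u, L)\<bar>" using bc[OF u0 u(2)] by (simp add: abs_mult)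
      also have "\<dots> \<le> \<kappa>' * (E * g L)" using \<kappa> maxu[of L] L by (intro mult_mono) auto
      also have "\<dots> < \<kappa>' * (E * 1)" using \<kappa> E g1 by (intro mult_strict_left_mono) auto
      finally show False by (simp add: mult.commute)
    qed
    \<comment> \<open>Multiplying by the fixed sign at the maximum point replaces the absolute value
      by a differentiable function which touches the barrier from below.\<close>
    define \<sigma> where "\<sigma> = sgn (z j (u, v))"
    have \<sigma>: "\<bar>\<sigma>\<bar> \<le> 1" "\<sigma> * z j (u, v) = E * g v"
      using att' by (auto simp: \<sigma>_def abs_sgn_eq mult.commute simp flip: abs_sgn)
    have \<sigma>le: "\<sigma> * y \<le> \<bar>y\<bar>" for y
      using \<sigma>(1) abs_ge_self[of "\<sigma> * y"] mult_right_mono[of "\<bar>\<sigma>\<bar>" 1 "\<bar>y\<bar>"] by (simp add: abs_mult)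
    have "0 \<le> \<sigma> * zt j (u, v) - Zm * (exp (- \<omega> * u) * - \<omega>) * g v"
    proof (rule left_derivative_nonneg_at_max[of "\<lambda>t. \<sigma> * z j (t, v) - Zm * exp (- \<omega> * t) * g v" _ u 0])
      have "((\<lambda>t. exp (- \<omega> * t)) has_real_derivative exp (- \<omega> * u) * - \<omega>) (at u within {0..u})"
        by (auto intro!: derivative_eq_intros)
      then show "((\<lambda>t. \<sigma> * z j (t, v) - Zm * exp (- \<omega> * t) * g v) has_real_derivative
          \<sigma> * zt j (u, v) - Zm * (exp (- \<omega> * u) * - \<omega>) * g v) (at u within {0..u})"
        by (intro DERIV_diff DERIV_cmult DERIV_cmult_right dt u0 u v)
      fix t assume "t \<in> {0..u}"
      then have "\<sigma> * z j (t, v) \<le> Zm * exp (- \<omega> * t) * g v"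
        using order_trans[OF \<sigma>le max[of t v j]] u v by simp
      then show "\<sigma> * z j (t, v) - Zm * exp (- \<omega> * t) * g v \<le> \<sigma> * z j (u, v) - Zm * exp (- \<omega> * u) * g v"
        using \<sigma>(2) by (simp add: E_def)
    qed (rule u0)
    then have 1: "- \<omega> * (E * g v) \<le> \<sigma> * zt j (u, v)" by (simp add: E_def algebra_simps)
    have "0 \<le> \<sigma> * zx j (u, v) - E * (m * (1 - g v))"
    proof (rule left_derivative_nonneg_at_max[of "\<lambda>x. \<sigma> * z j (u, x) - E * g x" _ v 0])
      show "((\<lambda>x. \<sigma> * z j (u, x) - E * g x) has_real_derivative \<sigma> * zx j (u, v) - E * (m * (1 - g v))) (at v within {0..v})"
        by (intro DERIV_diff DERIV_cmult dg dx u0 u v0) (use v in auto)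
      fix x assume "x \<in> {0..v}"
      then have "\<sigma> * z j (u, x) \<le> E * g x"
        using order_trans[OF \<sigma>le maxu[of x j]] v by simp
      then show "\<sigma> * z j (u, x) - E * g x \<le> \<sigma> * z j (u, v) - E * g v"
        using \<sigma>(2) by simp
    qed (rule v0)
    then have zxE: "E * (m * (1 - g v)) \<le> \<sigma> * zx j (u, v)" by simp
    have nn: "0 \<le> E * (m * (1 - g v))" using E m g1[of v] by simp
    have "s0 * (E * (m * (1 - g v))) \<le> s j (u, v) * (\<sigma> * zx j (u, v))"
      by (rule mult_mono[OF s(2)[OF u0 u(2) v] zxE _ nn]) (use s(2)[OF u0 u(2) v, of j] s(1) in linarith)
    \<comment> \<open>Of the factor \<open>B + 1\<close>, the part \<open>B\<close> pays for the
      coupling and the part 1 remains as the margin \<open>E * (1 - g v)\<close>.\<close>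
    moreover have "(B + 1) * (E * (1 - g v)) \<le> (s0 * m) * (E * (1 - g v))"
      using m E g1[of v] by (intro mult_right_mono) auto
    ultimately have 2: "(B + 1) * (E * (1 - g v)) \<le> s j (u, v) * (\<sigma> * zx j (u, v))"
      by (simp add: mult_ac)
    let ?w = "z (\<not> j) (u, L - v)"
    have Lv: "L - v \<in> {0..L}" using v by auto
    have gE: "E * g x \<le> E" for x
      using mult_left_mono[OF less_imp_le[OF g1[of x]] less_imp_le[OF E]] by simp
    have w: "\<bar>?w\<bar> \<le> E" by (rule order_trans[OF maxu[OF Lv] gE])
    have zE: "\<bar>z j (u, v)\<bar> \<le> E" unfolding att' by (rule gE)
    have bb: "0 \<le> b j (u, v)" "b j (u, v) \<le> B" using b[OF u0 u(2) v, of j] by auto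
    have "\<sigma> * (zt j (u, v) + s j (u, v) * zx j (u, v) + b j (u, v) * (z j (u, v) + ?w)) \<le> \<eta> * max \<bar>z j (u, v)\<bar> \<bar>?w\<bar>"
      using order_trans[OF \<sigma>le eq[OF u0 u(2) v, of j]] .
    also have "\<dots> \<le> \<eta> * E" using \<eta> w zE by (intro mult_left_mono) auto
    finally have 3: "\<sigma> * zt j (u, v) + s j (u, v) * (\<sigma> * zx j (u, v)) + b j (u, v) * (E * g v + \<sigma> * ?w) \<le> \<eta> * E"
      unfolding \<sigma>(2)[symmetric] by (simp add: algebra_simps)
    \<comment> \<open>The other component is bounded only by \<open>E\<close> here, so damping and
      coupling together may have the wrong sign, by at most
      \<open>b * E * (1 - g v)\<close>.\<close>
    have "- \<bar>?w\<bar> \<le> \<sigma> * ?w" using \<sigma>le[of "- ?w"] by simp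
    then have "b j (u, v) * (E * g v - E) \<le> b j (u, v) * (E * g v + \<sigma> * ?w)"
      using bb w by (intro mult_left_mono) auto
    moreover have "b j (u, v) * (E * (1 - g v)) \<le> B * (E * (1 - g v))"
      using bb E g1[of v] by (intro mult_right_mono) auto
    moreover have "b j (u, v) * (E * g v - E) = - (b j (u, v) * (E * (1 - g v)))"
      "(B + 1) * (E * (1 - g v)) = B * (E * (1 - g v)) + E * (1 - g v)" by (simp_all add: algebra_simps)
    ultimately have "- \<omega> * (E * g v) + E * (1 - g v) \<le> \<eta> * E" using 1 2 3 by linarith
    then have "E * ((1 - g v) - \<omega> * g v) \<le> E * \<eta>" by (simp add: algebra_simps)
    then have "(1 - g v) - \<omega> * g v \<le> \<eta>" using E by simp
    with \<omega>[OF g[OF v]] show False by linarith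
  qed
  have "\<bar>z k (t, x)\<bar> \<le> Zm * exp (- \<omega> * t) * g x" by (rule max[OF tx])
  also have "\<dots> \<le> Z / \<kappa>' * exp (- \<omega> * t) * 1"
    using \<open>Zm \<le> Z / \<kappa>'\<close> Z \<kappa> g1[of x] gpos[OF tx(2)]
    by (intro mult_mono) auto
  finally show ?thesis by simp
qed

section \<open>The initial-boundary value problem\<close>

text \<open>Coefficients of the inflow speeds: \<open>\<lambda>\<^sub>2\<close> for
  \<open>True\<close>, \<open>- \<lambda>\<^sub>1\<close> for \<open>False\<close>, as reversing the
  coordinate of the first invariant changes the sign of its speed.\<close>

definition char_coeff :: "real \<Rightarrow> real \<Rightarrow> bool \<Rightarrow> real" where
  "char_coeff \<gamma> w k = (if k then w / 2 else - w / 2)"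

text \<open>The sound speed of the background state; both \<open>\<lambda>\<^sub>2\<close> and
  \<open>- \<lambda>\<^sub>1\<close> take this value at \<open>bg_state\<close>.\<close>

definition sound :: "real \<Rightarrow> real \<Rightarrow> real" where
  "sound \<gamma> \<rho> = sqrt \<gamma> * \<rho> powr ((\<gamma> - 1) / 2)"

lemma char_speed_bg:
  assumes "\<gamma> > 1"
  shows "char_speed \<gamma> 1 (v + bg_state \<gamma> \<rho>) = - sound \<gamma> \<rho> + (\<gamma> + 1) / 2 * v $ 1 + (3 - \<gamma>) / 2 * v $ 2"
    and "char_speed \<gamma> 2 (v + bg_state \<gamma> \<rho>) = sound \<gamma> \<rho> + (3 - \<gamma>) / 2 * v $ 1 + (\<gamma> + 1) / 2 * v $ 2"
proof -
  define n where "n = sqrt \<gamma> / (\<gamma> - 1) * \<rho> powr ((\<gamma> - 1) / 2)"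
  have s: "sound \<gamma> \<rho> = (\<gamma> - 1) * n" using assms by (simp add: n_def sound_def)
  have b: "bg_state \<gamma> \<rho> $ 1 = - n" "bg_state \<gamma> \<rho> $ 2 = n"
    by (simp_all add: bg_state_def n_def Let_def vector_2)
  show "char_speed \<gamma> 1 (v + bg_state \<gamma> \<rho>) = - sound \<gamma> \<rho> + (\<gamma> + 1) / 2 * v $ 1 + (3 - \<gamma>) / 2 * v $ 2"
    unfolding char_speed_def s vector_add_component b by (simp add: field_simps)
  show "char_speed \<gamma> 2 (v + bg_state \<gamma> \<rho>) = sound \<gamma> \<rho> + (3 - \<gamma>) / 2 * v $ 1 + (\<gamma> + 1) / 2 * v $ 2"
    unfolding char_speed_def s vector_add_component b by (simp add: field_simps)
qed

lemma sound_pos: "\<gamma> > 1 \<Longrightarrow> \<rho> > 0 \<Longrightarrow> 0 < sound \<gamma> \<rho>"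
  by (simp add: sound_def)

text \<open>Both Riemann invariants seen from their own inflow end: \<open>True\<close> is the second component,
  entering at \<open>0\<close>, and \<open>False\<close> the first one, read backwards from \<open>L\<close>.\<close>

definition inflow :: "real \<Rightarrow> (real \<times> real \<Rightarrow> real^2) \<Rightarrow> bool \<Rightarrow> real \<times> real \<Rightarrow> real" where
  "inflow L \<phi> k = (\<lambda>(t, x). if k then \<phi> (t, x) $ 2 else \<phi> (t, L - x) $ 1)"

lemma C1_D_DERIV_t:
  fixes \<phi> :: "real \<times> real \<Rightarrow> real^2"
  assumes "C1_D L \<phi>" "0 \<le> t" "x \<in> {0..L}"
  shows "((\<lambda>s. \<phi> (s, x) $ i) has_real_derivative partial_t \<phi> (t, x) $ i) (at t within {0..})"
proof -
  have "(\<lambda>s. \<phi> (s, x)) differentiable (at t within {0..})"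
    using assms by (auto simp: C1_D_def dom_D_def)
  then have "((\<lambda>s. \<phi> (s, x)) has_vector_derivative partial_t \<phi> (t, x)) (at t within {0..})"
    by (simp add: vector_derivative_works partial_t_def)
  from bounded_linear.has_vector_derivative[OF bounded_linear_vec_nth this, of i]
  show ?thesis by (simp add: has_real_derivative_iff_has_vector_derivative)
qed

lemma C1_D_DERIV_x:
  fixes \<phi> :: "real \<times> real \<Rightarrow> real^2"
  assumes "C1_D L \<phi>" "0 \<le> t" "x \<in> {0..L}"
  shows "((\<lambda>y. \<phi> (t, y) $ i) has_real_derivative partial_x L \<phi> (t, x) $ i) (at x within {0..L})"
proof -
  have "(\<lambda>y. \<phi> (t, y)) differentiable (at x within {0..L})"
    using assms by (auto simp: C1_D_def dom_D_def)
  then have "((\<lambda>y. \<phi> (t, y)) has_vector_derivative partial_x L \<phi> (t, x)) (at x within {0..L})"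
    by (simp add: vector_derivative_works partial_x_def)
  from bounded_linear.has_vector_derivative[OF bounded_linear_vec_nth this, of i]
  show ?thesis by (simp add: has_real_derivative_iff_has_vector_derivative)
qed

lemma DERIV_reflect:
  fixes f :: "real \<Rightarrow> real"
  assumes "(f has_real_derivative d) (at (L - x) within {0..L})" "U \<subseteq> {0..L}"
  shows "((\<lambda>x. f (L - x)) has_real_derivative - d) (at x within U)"
proof -
  have "((\<lambda>x. L - x) has_real_derivative - 1) (at x within U)"
    by (auto intro!: derivative_eq_intros)
  moreover have "(f has_real_derivative d) (at (L - x) within (\<lambda>x. L - x) ` U)"
    by (rule DERIV_subset[OF assms(1)]) (use assms(2) in auto)
  ultimately have "(f \<circ> (\<lambda>x. L - x) has_real_derivative d * - 1) (at x within U)"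
    by (intro DERIV_image_chain)
  then show ?thesis by (simp add: o_def)
qed

lemma inflow_cont:
  assumes "C1_D L \<phi>" "T \<subseteq> {0..}"
  shows "continuous_on (T \<times> {0..L}) (inflow L \<phi> k)"
proof -
  have c: "continuous_on (dom_D L) \<phi>" using assms by (simp add: C1_D_def)
  have "continuous_on (T \<times> {0..L}) (\<lambda>z. \<phi> z $ 2)"
    by (intro continuous_intros continuous_on_subset[OF c]) (use assms in \<open>auto simp: dom_D_def\<close>)
  moreover have "continuous_on (T \<times> {0..L}) (\<lambda>z. \<phi> (fst z, L - snd z) $ 1)"
    by (intro continuous_intros continuous_on_compose2[OF c]) (use assms in \<open>auto simp: dom_D_def\<close>)
  ultimately show ?thesis by (cases k) (simp_all add: inflow_def case_prod_beta)
qed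

lemma bvp_solutionD:
  assumes "bvp_solution \<gamma> \<rho> L \<kappa>1 \<kappa>2 \<beta> \<phi>1b \<phi>2b \<phi>"
  shows "C1_D L \<phi>"
    and "0 \<le> t \<Longrightarrow> x \<in> {0..L} \<Longrightarrow> partial_t \<phi> (t, x) $ i + char_speed \<gamma> i (\<phi> (t, x) + bg_state \<gamma> \<rho>) * partial_x L \<phi> (t, x) $ i
        = \<beta> (t, x) / 2 * (\<phi> (t, x) $ 1 + \<phi> (t, x) $ 2)"
    and "0 \<le> t \<Longrightarrow> \<phi> (t, 0) $ 2 = \<phi>2b t + \<kappa>2 * \<phi> (t, 0) $ 1"
    and "0 \<le> t \<Longrightarrow> \<phi> (t, L) $ 1 = \<phi>1b t + \<kappa>1 * \<phi> (t, L) $ 2"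
  using assms unfolding bvp_solution_def dom_D_def by auto

text \<open>A Lipschitz constant of both characteristic speeds with respect to the maximum
  norm.\<close>

definition char_spread :: "real \<Rightarrow> real" where
  "char_spread \<gamma> = (\<gamma> + 1) / 2 + \<bar>3 - \<gamma>\<bar> / 2"

lemma char_speed_diff:
  assumes "\<gamma> > 1" "\<bar>v $ 1 - w $ 1\<bar> \<le> d" "\<bar>v $ 2 - w $ 2\<bar> \<le> d"
  shows "\<bar>char_speed \<gamma> i (v + u) - char_speed \<gamma> i (w + u)\<bar> \<le> char_spread \<gamma> * d"
proof -
  have 1: "\<bar>(\<gamma> + 1) / 2 * (v $ 1 - w $ 1) + (3 - \<gamma>) / 2 * (v $ 2 - w $ 2)\<bar> \<le> char_spread \<gamma> * d"
    by (rule linear_form_le) (use assms in \<open>auto simp: char_spread_def\<close>)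
  have 2: "\<bar>(3 - \<gamma>) / 2 * (v $ 1 - w $ 1) + (\<gamma> + 1) / 2 * (v $ 2 - w $ 2)\<bar> \<le> char_spread \<gamma> * d"
    by (rule linear_form_le) (use assms in \<open>auto simp: char_spread_def\<close>)
  show ?thesis
  proof (cases "i = 1")
    case True
    have "char_speed \<gamma> i (v + u) - char_speed \<gamma> i (w + u) = (\<gamma> + 1) / 2 * (v $ 1 - w $ 1) + (3 - \<gamma>) / 2 * (v $ 2 - w $ 2)"
      using True by (simp add: char_speed_def field_simps)
    then show ?thesis using 1 by simp
  next
    case False
    have "char_speed \<gamma> i (v + u) - char_speed \<gamma> i (w + u) = (3 - \<gamma>) / 2 * (v $ 1 - w $ 1) + (\<gamma> + 1) / 2 * (v $ 2 - w $ 2)"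
      using False by (simp add: char_speed_def field_simps)
    then show ?thesis using 2 by simp
  qed
qed

text \<open>Subtracting the equations leaves transport with the speed of \<phi>, and as
  inhomogeneity the speed difference times the slope of \<psi>. Thus a lower bound on speeds is
  needed for \<phi> alone and a slope bound for \<psi> alone, so a competing solution need not be
  small.\<close>

lemma bvp_difference:
  fixes \<phi> \<psi> :: "real \<times> real \<Rightarrow> real^2"
  assumes \<gamma>: "\<gamma> > 1" and L: "0 < L" and S: "0 \<le> S"
    and \<phi>: "bvp_solution \<gamma> \<rho> L \<kappa>1 \<kappa>2 \<beta> \<phi>1b \<phi>2b \<phi>" and \<psi>: "bvp_solution \<gamma> \<rho> L \<kappa>1 \<kappa>2 \<beta> \<phi>1b \<phi>2b \<psi>"
    and s0: "0 < s0"
    and speed: "\<And>t x. t \<in> {0..S} \<Longrightarrow> x \<in> {0..L} \<Longrightarrow> s0 \<le> - char_speed \<gamma> 1 (\<phi> (t, x) + bg_state \<gamma> \<rho>) \<and>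
      s0 \<le> char_speed \<gamma> 2 (\<phi> (t, x) + bg_state \<gamma> \<rho>)"
    and slope: "\<And>t x i. t \<in> {0..S} \<Longrightarrow> x \<in> {0..L} \<Longrightarrow> \<bar>partial_x L \<psi> (t, x) $ i\<bar> \<le> c" and c: "0 \<le> c"
    and \<beta>: "\<And>t x. t \<in> {0..S} \<Longrightarrow> x \<in> {0..L} \<Longrightarrow> - 2 * B \<le> \<beta> (t, x) \<and> \<beta> (t, x) \<le> 0"
    and \<kappa>: "\<bar>\<kappa>1\<bar> \<le> \<kappa>'" "\<bar>\<kappa>2\<bar> \<le> \<kappa>'" "0 < \<kappa>'" "\<kappa>' < 1"
    and init: "\<And>x i. x \<in> {0..L} \<Longrightarrow> \<bar>\<phi> (0, x) $ i - \<psi> (0, x) $ i\<bar> \<le> Z"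
    and m: "0 \<le> m" "B + 1 \<le> s0 * m"
    and \<omega>: "\<And>y. \<kappa>' \<le> y \<Longrightarrow> y \<le> 1 - (1 - \<kappa>') * exp (- m * L) \<Longrightarrow> char_spread \<gamma> * c < (1 - y) - \<omega> * y"
    and tx: "t \<in> {0..S}" "x \<in> {0..L}"
  shows "\<bar>\<phi> (t, x) $ i - \<psi> (t, x) $ i\<bar> \<le> Z / \<kappa>' * exp (- \<omega> * t)"
proof -
  define D where "D i z = \<phi> z $ i - \<psi> z $ i" for i z
  define z where "z k = (\<lambda>(t, x). if k then D 2 (t, x) else D 1 (t, L - x))" for k :: bool
  define zt where "zt k = (\<lambda>(t, x). if k then partial_t \<phi> (t, x) $ 2 - partial_t \<psi> (t, x) $ 2
     else partial_t \<phi> (t, L - x) $ 1 - partial_t \<psi> (t, L - x) $ 1)" for k :: bool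
  define zx where "zx k = (\<lambda>(t, x). if k then partial_x L \<phi> (t, x) $ 2 - partial_x L \<psi> (t, x) $ 2
     else - (partial_x L \<phi> (t, L - x) $ 1 - partial_x L \<psi> (t, L - x) $ 1))" for k :: bool
  define s where "s k = (\<lambda>(t, x). if k then char_speed \<gamma> 2 (\<phi> (t, x) + bg_state \<gamma> \<rho>)
     else - char_speed \<gamma> 1 (\<phi> (t, L - x) + bg_state \<gamma> \<rho>))" for k :: bool
  define b where "b k = (\<lambda>(t, x). - \<beta> (t, if k then x else L - x) / 2)" for k :: bool
  have zi: "z k = (\<lambda>p. inflow L \<phi> k p - inflow L \<psi> k p)" for k
    by (auto simp: z_def D_def inflow_def)
  have main: "\<bar>z k (t, x)\<bar> \<le> Z / \<kappa>' * exp (- \<omega> * t)" if tx: "t \<in> {0..S}" "x \<in> {0..L}" for k t x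
  proof (rule comparison_principle[where zt = zt and zx = zx and s = s and b = b and \<kappa>s = "\<lambda>k. if k then \<kappa>2 else \<kappa>1",
      OF L S _ _ _ s0 _ _ _ _ _ _ \<kappa>(3,4) _ m \<omega> tx])
    show "continuous_on ({0..S} \<times> {0..L}) (z k)" for k
      unfolding zi by (intro continuous_intros inflow_cont bvp_solutionD(1)[OF \<phi>] bvp_solutionD(1)[OF \<psi>]) auto
  next
    fix k and t x :: real assume t: "0 < t" "t \<le> S" and x: "x \<in> {0..L}"
    have "((\<lambda>t. D i (t, y)) has_real_derivative partial_t \<phi> (t, y) $ i - partial_t \<psi> (t, y) $ i) (at t within {0..t})"
      if "y \<in> {0..L}" for i y
      unfolding D_def using t that
      by (intro DERIV_diff DERIV_subset[OF C1_D_DERIV_t[OF bvp_solutionD(1)[OF \<phi>]]]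
        DERIV_subset[OF C1_D_DERIV_t[OF bvp_solutionD(1)[OF \<psi>]]]) auto
    then show "((\<lambda>t. z k (t, x)) has_real_derivative zt k (t, x)) (at t within {0..t})"
      using x by (cases k) (simp_all add: z_def zt_def)
  next
    fix k and t x :: real assume t: "0 < t" "t \<le> S" and x: "0 < x" "x \<le> L"
    have d: "((\<lambda>y. D i (t, y)) has_real_derivative partial_x L \<phi> (t, y) $ i - partial_x L \<psi> (t, y) $ i) (at y within {0..L})"
      if "y \<in> {0..L}" for i y
      unfolding D_def using t that
      by (intro DERIV_diff C1_D_DERIV_x bvp_solutionD(1)[OF \<phi>] bvp_solutionD(1)[OF \<psi>]) auto
    show "((\<lambda>x. z k (t, x)) has_real_derivative zx k (t, x)) (at x within {0..x})"
    proof (cases k)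
      case True
      then show ?thesis using DERIV_subset[OF d[of x 2], of "{0..x}"] x by (simp add: z_def zx_def)
    next
      case False
      then show ?thesis using DERIV_reflect[OF d[of "L - x" 1], of "{0..x}"] x by (simp add: z_def zx_def)
    qed
  next
    fix k and t x :: real assume t: "0 < t" "t \<le> S" and x: "x \<in> {0..L}"
    show "s0 \<le> s k (t, x)" using speed[of t x] speed[of t "L - x"] t x by (simp add: s_def)
    show "0 \<le> b k (t, x) \<and> b k (t, x) \<le> B" using \<beta>[of t x] \<beta>[of t "L - x"] t x by (auto simp: b_def)
    have gen: "\<bar>(partial_t \<phi> (t, y) $ i - partial_t \<psi> (t, y) $ i)
        + char_speed \<gamma> i (\<phi> (t, y) + bg_state \<gamma> \<rho>) * (partial_x L \<phi> (t, y) $ i - partial_x L \<psi> (t, y) $ i)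
        + - \<beta> (t, y) / 2 * (D 1 (t, y) + D 2 (t, y))\<bar> \<le> char_spread \<gamma> * c * max \<bar>D 1 (t, y)\<bar> \<bar>D 2 (t, y)\<bar>"
      if y: "y \<in> {0..L}" for i y
    proof -
      have "(partial_t \<phi> (t, y) $ i - partial_t \<psi> (t, y) $ i)
        + char_speed \<gamma> i (\<phi> (t, y) + bg_state \<gamma> \<rho>) * (partial_x L \<phi> (t, y) $ i - partial_x L \<psi> (t, y) $ i)
        + - \<beta> (t, y) / 2 * (D 1 (t, y) + D 2 (t, y))
        = - ((char_speed \<gamma> i (\<phi> (t, y) + bg_state \<gamma> \<rho>) - char_speed \<gamma> i (\<psi> (t, y) + bg_state \<gamma> \<rho>)) * partial_x L \<psi> (t, y) $ i)"
        using bvp_solutionD(2)[OF \<phi>, of t y i] bvp_solutionD(2)[OF \<psi>, of t y i] t y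
        by (simp add: D_def algebra_simps)
      moreover have "\<bar>(char_speed \<gamma> i (\<phi> (t, y) + bg_state \<gamma> \<rho>) - char_speed \<gamma> i (\<psi> (t, y) + bg_state \<gamma> \<rho>)) * partial_x L \<psi> (t, y) $ i\<bar>
        \<le> char_spread \<gamma> * max \<bar>D 1 (t, y)\<bar> \<bar>D 2 (t, y)\<bar> * c"
        by (intro abs_mult_le char_speed_diff \<gamma> slope) (use t y in \<open>auto simp: D_def\<close>)
      ultimately show ?thesis by (simp add: mult_ac)
    qed
    show "\<bar>zt k (t, x) + s k (t, x) * zx k (t, x) + b k (t, x) * (z k (t, x) + z (\<not> k) (t, L - x))\<bar>
        \<le> char_spread \<gamma> * c * max \<bar>z k (t, x)\<bar> \<bar>z (\<not> k) (t, L - x)\<bar>"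
    proof (cases k)
      case True
      then show ?thesis using gen[OF x, of 2]
        by (simp add: zt_def s_def zx_def b_def z_def max.commute add.commute)
    next
      case False
      then show ?thesis using gen[of "L - x" 1] x
        by (simp add: zt_def s_def zx_def b_def z_def del: minus_diff_eq)
    qed
  next
    show "0 \<le> char_spread \<gamma> * c" using c \<gamma> by (simp add: char_spread_def)
  next
    fix k and t :: real assume "0 < t" "t \<le> S"
    then show "z k (t, 0) = (if k then \<kappa>2 else \<kappa>1) * z (\<not> k) (t, L)"
      using bvp_solutionD(3,4)[OF \<phi>, of t] bvp_solutionD(3,4)[OF \<psi>, of t]
      by (simp add: z_def D_def algebra_simps)
  next
    show "\<bar>if k then \<kappa>2 else \<kappa>1\<bar> \<le> \<kappa>'" for k using \<kappa> by simp
    fix k x assume "x \<in> {0..L}"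
    then show "\<bar>z k (0, x)\<bar> \<le> Z" using init[of x 2] init[of "L - x" 1] by (simp add: z_def D_def)
  qed
  show ?thesis
    using main[OF tx, of True] main[of t "L - x" False] tx exhaust_2[of i]
    by (auto simp: z_def D_def)
qed

section \<open>Translation between inflow coordinates and vector-valued solutions\<close>

lemma partial_t_DERIV_real:
  fixes f :: "real \<times> real \<Rightarrow> real"
  assumes "C1_D L f" "0 < t" "x \<in> {0..L}"
  shows "((\<lambda>s. f (s, x)) has_real_derivative partial_t f (t, x)) (at t)"
proof -
  have "(\<lambda>s. f (s, x)) differentiable (at t within {0..})"
    using assms by (auto simp: C1_D_def dom_D_def)
  then have "((\<lambda>s. f (s, x)) has_vector_derivative partial_t f (t, x)) (at t within {0..})"
    by (simp add: vector_derivative_works partial_t_def)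
  then show ?thesis
    using assms(2) at_within_interior[of t "{0..}"]
    by (simp add: has_real_derivative_iff_has_vector_derivative)
qed

lemma C1_on_DERIV:
  fixes f :: "real \<Rightarrow> real"
  assumes "C1_on I f" "x \<in> I"
  shows "(f has_real_derivative vector_derivative f (at x within I)) (at x within I)"
  using assms by (simp add: C1_on_def vector_derivative_works has_real_derivative_iff_has_vector_derivative)

lemma at_within_Icc_nontrivial: "(x::real) \<in> {a..b} \<Longrightarrow> a < b \<Longrightarrow> at x within {a..b} \<noteq> bot"
  unfolding trivial_limit_within
  by (metis atLeastAtMost_iff connected_Icc connected_imp_perfect less_irrefl order_refl singletonD less_imp_le)

lemma at_within_atLeast_nontrivial: "(t::real) \<in> {0..} \<Longrightarrow> at t within {0..} \<noteq> bot"
  using at_within_Icc_nontrivial[of t 0 "t + 1"] at_within_atLeast[of t] by simp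

lemma C1_on_component:
  fixes f :: "real \<Rightarrow> real^2"
  assumes "C1_on {0..L} f" "0 < L"
  shows "C1_on {0..L} (\<lambda>x. f x $ i)"
proof -
  have d: "((\<lambda>x. f x $ i) has_vector_derivative vector_derivative f (at x within {0..L}) $ i) (at x within {0..L})"
    if "x \<in> {0..L}" for x
    by (rule bounded_linear.has_vector_derivative[OF bounded_linear_vec_nth])
      (use assms(1) that in \<open>simp add: C1_on_def vector_derivative_works\<close>)
  have eq: "vector_derivative (\<lambda>x. f x $ i) (at x within {0..L}) = vector_derivative f (at x within {0..L}) $ i"
    if "x \<in> {0..L}" for x
    by (rule vector_derivative_within[OF at_within_Icc_nontrivial[OF that assms(2)] d[OF that]])
  have "continuous_on {0..L} (\<lambda>x. vector_derivative f (at x within {0..L}) $ i)"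
    using assms(1) by (intro continuous_intros) (simp add: C1_on_def)
  then have "continuous_on {0..L} (\<lambda>x. vector_derivative (\<lambda>x. f x $ i) (at x within {0..L}))"
    by (rule continuous_on_eq) (rule eq[symmetric])
  then show ?thesis using differentiableI_vector[OF d] unfolding C1_on_def by blast
qed

lemma vec2_has_vector_derivative:
  fixes f g :: "real \<Rightarrow> real"
  assumes "(f has_real_derivative f') (at t within S)" "(g has_real_derivative g') (at t within S)"
  shows "((\<lambda>s. f s *\<^sub>R axis 1 1 + g s *\<^sub>R axis 2 1 :: real^2) has_vector_derivative
    f' *\<^sub>R axis 1 1 + g' *\<^sub>R axis 2 1) (at t within S)"
  using assms unfolding has_real_derivative_iff_has_vector_derivative
  by (intro has_vector_derivative_add bounded_linear.has_vector_derivative[OF bounded_linear_scaleR_left])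

lemma vec2_nth [simp]:
  "(a *\<^sub>R axis 1 1 + c *\<^sub>R axis 2 1 :: real^2) $ 1 = a" "(a *\<^sub>R axis 1 1 + c *\<^sub>R axis 2 1 :: real^2) $ 2 = c"
  by (simp_all add: axis_def)

text \<open>The map \<xi> stands for \<open>x\<close> or \<open>L - x\<close>, so that one proof
  covers the damping seen from both ends.\<close>

lemma half_C1_clipped:
  fixes \<beta> :: "real \<times> real \<Rightarrow> real"
  assumes \<beta>: "C1_D L \<beta>" and L: "0 < L"
    and bound: "\<And>t x. 0 \<le> t \<Longrightarrow> x \<in> {0..L} \<Longrightarrow> \<bar>partial_t \<beta> (t, x)\<bar> \<le> M" and \<xi>: "continuous_on UNIV \<xi>"
  shows "half_C1 M (\<lambda>(t, x). - \<beta> (max 0 t, clip L (\<xi> x)) / 2) (\<lambda>(t, x). - partial_t \<beta> (max 0 t, clip L (\<xi> x)) / 2)"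
proof -
  have mem: "(max 0 t, clip L x) \<in> dom_D L" for t x using L clip_mem[of L x] by (simp add: dom_D_def)
  have c: "continuous_on UNIV (\<lambda>z::real \<times> real. (max 0 (fst z), clip L (\<xi> (snd z))))"
    by (intro continuous_intros continuous_on_UNIV_compose[OF \<xi>])
  have cc: "continuous_on UNIV (\<lambda>z::real \<times> real. g (max 0 (fst z), clip L (\<xi> (snd z))))"
    if "continuous_on (dom_D L) g" for g :: "real \<times> real \<Rightarrow> real"
    by (rule continuous_on_compose2[OF that c]) (use mem in auto)
  have b: "\<bar>partial_t \<beta> (max 0 t, clip L x)\<bar> \<le> M" for t x
    by (rule bound) (use L clip_mem[of L x] in auto)
  show ?thesis unfolding half_C1_def case_prod_beta fst_conv snd_conv
  proof (intro conjI allI impI)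
    show "continuous_on UNIV (\<lambda>z::real \<times> real. - \<beta> (max 0 (fst z), clip L (\<xi> (snd z))) / 2)"
      "continuous_on UNIV (\<lambda>z::real \<times> real. - partial_t \<beta> (max 0 (fst z), clip L (\<xi> (snd z))) / 2)"
      using \<beta> by (auto intro!: continuous_intros cc simp: C1_D_def)
    fix z :: "real \<times> real"
    show "\<bar>- partial_t \<beta> (max 0 (fst z), clip L (\<xi> (snd z))) / 2\<bar> \<le> M"
      using b[of "fst z" "\<xi> (snd z)"] by simp
  next
    fix t x :: real assume t: "0 < t"
    have "((\<lambda>s. - \<beta> (s, clip L (\<xi> x)) / 2) has_real_derivative - partial_t \<beta> (t, clip L (\<xi> x)) / 2) (at t)"
      by (intro DERIV_cdivide DERIV_minus partial_t_DERIV_real[OF \<beta> t]) (use L clip_mem in auto)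
    then have "((\<lambda>s. - \<beta> (max 0 s, clip L (\<xi> x)) / 2) has_real_derivative - partial_t \<beta> (t, clip L (\<xi> x)) / 2) (at t)"
      by (rule has_field_derivative_transform_within[where d = t]) (use t in \<open>auto simp: dist_real_def\<close>)
    then show "((\<lambda>s. - \<beta> (max 0 s, clip L (\<xi> x)) / 2) has_real_derivative - partial_t \<beta> (max 0 t, clip L (\<xi> x)) / 2) (at t)"
      using t by simp
  qed simp
qed

lemma init_rate_cont:
  assumes \<beta>: "C1_D L \<beta>" and L: "0 < L" and \<phi>0: "C1_on {0..L} \<phi>0"
  shows "continuous_on {0..L} (init_rate \<gamma> \<rho> L \<beta> \<phi>0 i)"
proof -
  have "continuous_on (dom_D L) \<beta>" using \<beta> by (simp add: C1_D_def)
  then have b: "continuous_on {0..L} (\<lambda>x. \<beta> (0, x))"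
    by (rule continuous_on_compose2) (auto intro!: continuous_intros simp: dom_D_def)
  have f: "continuous_on {0..L} \<phi>0"
    using \<phi>0 by (auto simp: C1_on_def continuous_on_eq_continuous_within intro: differentiable_imp_continuous_within)
  have v: "continuous_on {0..L} (\<lambda>x. vector_derivative (\<lambda>y. \<phi>0 y $ i) (at x within {0..L}))"
    using C1_on_component[OF \<phi>0 L, of i] by (simp add: C1_on_def)
  show ?thesis
    unfolding init_rate_def char_speed_def vector_add_component
    by (cases "i = 1") (use v in \<open>auto intro!: continuous_intros f b\<close>)
qed

text \<open>The dictionary between the vector problem and \<open>riemann_system\<close>. Besides a
  solution it delivers the bound \<open>M\<close> on the domain, from which the comparison argument
  gets its lower bound on the speeds.\<close>

lemma ibvp_exists:
  fixes \<gamma> \<rho> L M \<kappa> \<kappa>' \<epsilon>0 B :: real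
  defines "c0 \<equiv> sound \<gamma> \<rho>" and "P \<equiv> char_spread \<gamma>"
  defines "\<Gamma> \<equiv> 2 / c0 * B" and "Ca \<equiv> 4 / c0\<^sup>2 * P"
  defines "C3 \<equiv> 2 * (Ca * B + 2 / c0)"
  defines "D \<equiv> 9 * L * Ca + (C3 + (3 * \<Gamma> + C3) * (10 * L * Ca)) / \<Gamma>"
  assumes \<gamma>: "\<gamma> > 1" and \<rho>: "\<rho> > 0" and L: "0 < L" and B: "0 < B" and M: "0 < M" "M \<le> 1"
    and \<kappa>: "\<bar>\<kappa>1\<bar> \<le> \<kappa>" "\<bar>\<kappa>2\<bar> \<le> \<kappa>" "\<kappa> \<le> \<kappa>'" "\<kappa>' < 1"
    and \<beta>: "C1_D L \<beta>" "\<And>t x. 0 \<le> t \<Longrightarrow> x \<in> {0..L} \<Longrightarrow> - 2 * B \<le> \<beta> (t, x) \<and> \<beta> (t, x) \<le> 0"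
      "\<And>t x. 0 \<le> t \<Longrightarrow> x \<in> {0..L} \<Longrightarrow> \<bar>partial_t \<beta> (t, x)\<bar> \<le> M"
    and b1: "C1_on {0..} \<phi>1b" "\<And>t. 0 \<le> t \<Longrightarrow> \<bar>\<phi>1b t\<bar> \<le> \<epsilon>0 \<and> \<bar>vector_derivative \<phi>1b (at t within {0..})\<bar> \<le> \<epsilon>0"
    and b2: "C1_on {0..} \<phi>2b" "\<And>t. 0 \<le> t \<Longrightarrow> \<bar>\<phi>2b t\<bar> \<le> \<epsilon>0 \<and> \<bar>vector_derivative \<phi>2b (at t within {0..})\<bar> \<le> \<epsilon>0"
    and \<phi>0: "C1_on {0..L} \<phi>0" "\<And>x i. x \<in> {0..L} \<Longrightarrow> \<bar>\<phi>0 x $ i\<bar> + \<epsilon>0 \<le> M"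
      "\<And>x i. x \<in> {0..L} \<Longrightarrow> exp (\<Gamma> * L) * \<bar>init_rate \<gamma> \<rho> L \<beta> \<phi>0 i x\<bar> \<le> \<epsilon>0"
    and comp: "compatible \<gamma> \<rho> L \<kappa>1 \<kappa>2 \<beta> \<phi>1b \<phi>2b \<phi>0"
    and sm: "\<kappa> * M + 2 * \<epsilon>0 + 2 / c0 * L * \<epsilon>0 \<le> \<kappa>' * M" "2 * (P * M) \<le> c0" "4 * (Ca * M * L) \<le> 1"
      "D * M < (1 - \<kappa>') * exp (- \<Gamma> * L)"
  shows "\<exists>\<phi>. ibvp_solution \<gamma> \<rho> L \<kappa>1 \<kappa>2 \<beta> \<phi>1b \<phi>2b \<phi>0 \<phi> \<and> (\<forall>z\<in>dom_D L. \<forall>i. \<bar>\<phi> z $ i\<bar> \<le> M)"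
proof -
  define p q where "p = char_coeff \<gamma> (\<gamma> + 1)" and "q = char_coeff \<gamma> (3 - \<gamma>)"
  define ks where "ks k = (if k then \<kappa>2 else \<kappa>1)" for k
  define b where "b k = (\<lambda>(t, x). - \<beta> (max 0 t, clip L (if k then x else L - x)) / 2)" for k :: bool
  define b' where "b' k = (\<lambda>(t, x). - partial_t \<beta> (max 0 t, clip L (if k then x else L - x)) / 2)" for k :: bool
  define hb where "hb k = (if k then \<phi>2b else \<phi>1b)" for k
  define h where "h k s = hb k (max 0 s)" for k s
  define h' where "h' k s = vector_derivative (hb k) (at (max 0 s) within {0..})" for k s
  define f0 where "f0 k x = (if k then \<phi>0 x $ 2 else \<phi>0 (L - x) $ 1)" for k x
  define f0' where "f0' k x = (if k then vector_derivative (\<lambda>y. \<phi>0 y $ 2) (at x within {0..L})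
    else - vector_derivative (\<lambda>y. \<phi>0 y $ 1) (at (L - x) within {0..L}))" for k x
  define q0 where "q0 k x = (if k then init_rate \<gamma> \<rho> L \<beta> \<phi>0 2 x else init_rate \<gamma> \<rho> L \<beta> \<phi>0 1 (L - x))" for k x
  have c0: "0 < c0" unfolding c0_def by (rule sound_pos[OF \<gamma> \<rho>])
  have P: "0 \<le> P" using \<gamma> by (simp add: P_def char_spread_def)
  have pq: "\<bar>p k\<bar> + \<bar>q k\<bar> \<le> P" for k
    using \<gamma> by (simp add: p_def q_def char_coeff_def P_def char_spread_def abs_minus_commute)
  have hb: "C1_on {0..} (hb k)" "\<And>t. 0 \<le> t \<Longrightarrow> \<bar>hb k t\<bar> \<le> \<epsilon>0 \<and> \<bar>vector_derivative (hb k) (at t within {0..})\<bar> \<le> \<epsilon>0" for k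
    using b1 b2 by (simp_all add: hb_def)
  have hbc: "continuous_on {0..} (hb k)" "continuous_on {0..} (\<lambda>t. vector_derivative (hb k) (at t within {0..}))" for k
    using hb(1)[of k] by (auto simp: C1_on_def continuous_on_eq_continuous_within[of _ "hb k"] intro: differentiable_imp_continuous_within)
  have hd: "(h k has_real_derivative h' k s) (at s)" if "0 < s" for k s
  proof -
    have "(hb k has_real_derivative vector_derivative (hb k) (at s within {0..})) (at s)"
      using C1_on_DERIV[OF hb(1)[of k], of s] that at_within_interior[of s "{0..}"] by simp
    then have "(h k has_real_derivative vector_derivative (hb k) (at s within {0..})) (at s)"
      by (rule has_field_derivative_transform_within[where d = s]) (use that in \<open>auto simp: h_def dist_real_def\<close>)
    then show ?thesis using that by (simp add: h'_def)
  qed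
  have f0d: "(f0 k has_real_derivative f0' k x) (at x within {0..L})" if x: "x \<in> {0..L}" for k x
  proof (cases k)
    case True
    then show ?thesis using C1_on_DERIV[OF C1_on_component[OF \<phi>0(1) L, of 2] x] by (simp add: f0_def[abs_def] f0'_def)
  next
    case False
    have "L - x \<in> {0..L}" using x by auto
    from DERIV_reflect[OF C1_on_DERIV[OF C1_on_component[OF \<phi>0(1) L, of 1] this] order_refl] False
    show ?thesis by (simp add: f0_def[abs_def] f0'_def)
  qed
  have q0c: "continuous_on {0..L} (q0 k)" for k
  proof (cases k)
    case True then show ?thesis using init_rate_cont[OF \<beta>(1) L \<phi>0(1), of \<gamma> \<rho> 2] by (simp add: q0_def[abs_def])
  next
    case False
    have "continuous_on {0..L} (\<lambda>x. init_rate \<gamma> \<rho> L \<beta> \<phi>0 1 (L - x))"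
      by (rule continuous_on_compose2[OF init_rate_cont[OF \<beta>(1) L \<phi>0(1)]]) (auto intro!: continuous_intros)
    then show ?thesis using False by (simp add: q0_def[abs_def])
  qed
  \<comment> \<open>This is the definition of \<open>init_rate\<close>, solved for the slope term
    and rewritten in inflow coordinates.\<close>
  have pde0: "(c0 + p k * f0 k x + q k * f0 (\<not> k) (L - x)) * f0' k x
      = - b k (0, x) * (f0 k x + f0 (\<not> k) (L - x)) - q0 k x" if x: "x \<in> {0..L}" for k x
  proof -
    have Lx: "L - x \<in> {0..L}" using x by auto
    show ?thesis
      using clip_id[OF x] clip_id[OF Lx]
      by (cases k) (simp_all add: p_def q_def char_coeff_def f0_def f0'_def b_def q0_def init_rate_def
        char_speed_bg[OF \<gamma>] c0_def[symmetric], simp_all add: field_simps)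
  qed
  have "riemann_system L c0 B P \<Gamma> Ca C3 D M \<kappa> \<kappa>' \<epsilon>0 p q ks b b' h h' f0 f0' q0"
  proof
    show "0 \<le> \<kappa>" using \<kappa>(1) by linarith
    show "\<bar>ks k\<bar> \<le> \<kappa>" for k using \<kappa> by (simp add: ks_def)
    have \<xi>: "continuous_on UNIV (\<lambda>x. if k then x else L - x)" for k by (cases k) (auto intro: continuous_intros)
    show "half_C1 M (b k) (b' k)" for k
      unfolding b_def b'_def by (rule half_C1_clipped[OF \<beta>(1) L \<beta>(3) \<xi>])
    have br: "0 \<le> b k (t, x) \<and> b k (t, x) \<le> B" for k t x
      using \<beta>(2)[of "max 0 t" "clip L (if k then x else L - x)"] clip_mem[of L "if k then x else L - x"] L
      by (auto simp: b_def)
    show "0 \<le> b k z" "b k z \<le> B" for k z using br[of k "fst z" "snd z"] by auto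
    show "continuous_on UNIV (h k)" for k
      unfolding h_def by (rule continuous_on_compose2[OF hbc(1)]) (auto intro!: continuous_intros)
    show "continuous_on UNIV (h' k)" for k
      unfolding h'_def by (rule continuous_on_compose2[OF hbc(2)]) (auto intro!: continuous_intros)
    show "h k s = h k 0" if "s \<le> 0" for k s using that by (simp add: h_def)
    show "\<bar>h k s\<bar> \<le> \<epsilon>0" "\<bar>h' k s\<bar> \<le> \<epsilon>0" for k s using hb(2)[of "max 0 s" k] by (simp_all add: h_def h'_def)
    show "\<bar>f0 k x\<bar> + \<epsilon>0 \<le> M" if "x \<in> {0..L}" for k x
      using \<phi>0(2)[of x 2] \<phi>0(2)[of "L - x" 1] that by (simp add: f0_def)
    show "exp (\<Gamma> * L) * \<bar>q0 k x\<bar> \<le> \<epsilon>0" if "x \<in> {0..L}" for k x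
      using \<phi>0(3)[of x 2] \<phi>0(3)[of "L - x" 1] that by (simp add: q0_def)
    show "f0 k 0 = h k 0 + ks k * f0 (\<not> k) L" "q0 k 0 = h' k 0 + ks k * q0 (\<not> k) L" for k
      using comp by (simp_all add: compatible_def Let_def f0_def h_def hb_def ks_def q0_def h'_def)
  qed (fact L c0 B P pq M \<kappa> hd f0d q0c pde0 sm \<Gamma>_def[THEN meta_eq_to_obj_eq] Ca_def[THEN meta_eq_to_obj_eq]
      C3_def[THEN meta_eq_to_obj_eq] D_def[THEN meta_eq_to_obj_eq])+
  then interpret R: riemann_system L c0 B P \<Gamma> Ca C3 D M \<kappa> \<kappa>' \<epsilon>0 p q ks b b' h h' f0 f0' q0 .
  obtain f r where f: "R.adm f" and r: "R.adm_rate r" and fp: "R.solve f = f"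
    and dt: "\<And>k t x. 0 \<le> t \<Longrightarrow> ((\<lambda>t. f k (t, x)) has_real_derivative r k (t, x)) (at t within {0..})"
    by (rule R.fixed_point_exists) blast
  \<comment> \<open>The space derivative is expressed through functions known to be continuous,
    which makes the C1 property immediate.\<close>
  define fx where "fx k = (\<lambda>(t, x). - R.spd f k (t, x) * b k (t, x) * (f k (t, x) + f (\<not> k) (t, L - x)) - R.spd f k (t, x) * r k (t, x))" for k
  have dx: "((\<lambda>y. f k (t, y)) has_real_derivative fx k (t, x)) (at x within {0..L})" if "0 \<le> t" "x \<in> {0..L}" for k t x
    unfolding fx_def case_prod_conv by (rule R.fixed_DERIV_x[OF f r fp dt that])
  have pde: "r k (t, x) + R.den f k (t, x) * fx k (t, x) = - b k (t, x) * (f k (t, x) + f (\<not> k) (t, L - x))" for k t x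
    using R.den_pos[OF f, of k "(t, x)"] by (simp add: fx_def R.spd_def field_simps)
  define \<phi> where "\<phi> = (\<lambda>(t, x). f False (t, L - x) *\<^sub>R axis 1 1 + f True (t, x) *\<^sub>R axis 2 1 :: real^2)"
  define \<phi>t where "\<phi>t = (\<lambda>(t, x). r False (t, L - x) *\<^sub>R axis 1 1 + r True (t, x) *\<^sub>R axis 2 1 :: real^2)"
  define \<phi>x where "\<phi>x = (\<lambda>(t, x). (- fx False (t, L - x)) *\<^sub>R axis 1 1 + fx True (t, x) *\<^sub>R axis 2 1 :: real^2)"
  have comps: "\<phi> (t, x) $ 1 = f False (t, L - x)" "\<phi> (t, x) $ 2 = f True (t, x)"
    "\<phi>t (t, x) $ 1 = r False (t, L - x)" "\<phi>t (t, x) $ 2 = r True (t, x)"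
    "\<phi>x (t, x) $ 1 = - fx False (t, L - x)" "\<phi>x (t, x) $ 2 = fx True (t, x)" for t x
    unfolding \<phi>_def \<phi>t_def \<phi>x_def case_prod_conv by (rule vec2_nth)+
  have \<phi>td: "((\<lambda>t. \<phi> (t, x)) has_vector_derivative \<phi>t (t, x)) (at t within {0..})" if "0 \<le> t" for t x
    unfolding \<phi>_def \<phi>t_def case_prod_conv by (intro vec2_has_vector_derivative dt that)
  have \<phi>xd: "((\<lambda>x. \<phi> (t, x)) has_vector_derivative \<phi>x (t, x)) (at x within {0..L})" if "0 \<le> t" "x \<in> {0..L}" for t x
    unfolding \<phi>_def \<phi>x_def case_prod_conv using that
    by (intro vec2_has_vector_derivative dx DERIV_reflect) auto
  have pt: "partial_t \<phi> (t, x) = \<phi>t (t, x)" if "0 \<le> t" for t x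
    unfolding partial_t_def case_prod_conv
    by (rule vector_derivative_within[OF at_within_atLeast_nontrivial \<phi>td]) (use that in auto)
  have px: "partial_x L \<phi> (t, x) = \<phi>x (t, x)" if "0 \<le> t" "x \<in> {0..L}" for t x
    unfolding partial_x_def case_prod_conv
    by (rule vector_derivative_within[OF at_within_Icc_nontrivial \<phi>xd]) (use that L in auto)
  have fc: "continuous_on UNIV (f k)" "continuous_on UNIV (r k)" for k
    by (rule R.admD(1)[OF f], rule R.adm_rateD(1)[OF r])
  have fxc: "continuous_on UNIV (fx k)" for k
    unfolding fx_def case_prod_beta prod.collapse
    by (intro continuous_intros continuous_on_UNIV_compose[OF fc(1)] fc R.spd_cont f half_C1D(1)[OF R.b])
  have C1: "C1_D L \<phi>"
    unfolding C1_D_def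
  proof (intro conjI ballI)
    fix z assume "z \<in> dom_D L"
    then show "case z of (t, x) \<Rightarrow> (\<lambda>s. \<phi> (s, x)) differentiable at t within {0..} \<and> (\<lambda>y. \<phi> (t, y)) differentiable at x within {0..L}"
      using differentiableI_vector[OF \<phi>td] differentiableI_vector[OF \<phi>xd] unfolding dom_D_def by blast
  next
    show "continuous_on (dom_D L) \<phi>"
      unfolding \<phi>_def case_prod_beta
      by (intro continuous_intros continuous_on_UNIV_compose[OF fc(1)])
    have "continuous_on (dom_D L) \<phi>t"
      unfolding \<phi>t_def case_prod_beta
      by (intro continuous_intros continuous_on_UNIV_compose[OF fc(2)])
    then show "continuous_on (dom_D L) (partial_t \<phi>)"
      by (rule continuous_on_eq) (auto simp: pt dom_D_def)
    have "continuous_on (dom_D L) \<phi>x"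
      unfolding \<phi>x_def case_prod_beta
      by (intro continuous_intros continuous_on_UNIV_compose[OF fxc])
    then show "continuous_on (dom_D L) (partial_x L \<phi>)"
      by (rule continuous_on_eq) (auto simp: px dom_D_def)
  qed
  have "bvp_solution \<gamma> \<rho> L \<kappa>1 \<kappa>2 \<beta> \<phi>1b \<phi>2b \<phi>"
    unfolding bvp_solution_def
  proof (intro conjI C1 ballI allI impI)
    fix z assume "z \<in> dom_D L"
    then obtain t x where z: "z = (t, x)" "0 \<le> t" "x \<in> {0..L}" by (auto simp: dom_D_def)
    have Lx: "L - x \<in> {0..L}" using z by auto
    have 2: "partial_t \<phi> (t, x) $ 2 + char_speed \<gamma> 2 (\<phi> (t, x) + bg_state \<gamma> \<rho>) * partial_x L \<phi> (t, x) $ 2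
        = \<beta> (t, x) / 2 * (\<phi> (t, x) $ 1 + \<phi> (t, x) $ 2)"
      using pde[of True t x, unfolded R.den_def case_prod_conv] clip_id[OF z(3)] z(2)
      unfolding pt[OF z(2)] px[OF z(2,3)] char_speed_bg[OF \<gamma>] comps
      by (simp add: p_def q_def char_coeff_def b_def c0_def[symmetric] field_simps)
    have 1: "partial_t \<phi> (t, x) $ 1 + char_speed \<gamma> 1 (\<phi> (t, x) + bg_state \<gamma> \<rho>) * partial_x L \<phi> (t, x) $ 1
        = \<beta> (t, x) / 2 * (\<phi> (t, x) $ 1 + \<phi> (t, x) $ 2)"
      using pde[of False t "L - x", unfolded R.den_def case_prod_conv] clip_id[OF z(3)] z(2)
      unfolding pt[OF z(2)] px[OF z(2,3)] char_speed_bg[OF \<gamma>] comps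
      by (simp add: p_def q_def char_coeff_def b_def c0_def[symmetric] field_simps)
    show "case z of (t, x) \<Rightarrow> \<forall>i. partial_t \<phi> (t, x) $ i + char_speed \<gamma> i (\<phi> (t, x) + bg_state \<gamma> \<rho>) * partial_x L \<phi> (t, x) $ i
        = \<beta> (t, x) / 2 * (\<phi> (t, x) $ 1 + \<phi> (t, x) $ 2)"
      unfolding z case_prod_conv forall_2 using 1 2 by blast
  next
    fix t :: real assume t: "0 \<le> t"
    show "\<phi> (t, 0) $ 2 = \<phi>2b t + \<kappa>2 * \<phi> (t, 0) $ 1"
      using R.fixed_boundary[OF f r fp dt t, of True] t by (simp add: comps h_def hb_def ks_def)
    show "\<phi> (t, L) $ 1 = \<phi>1b t + \<kappa>1 * \<phi> (t, L) $ 2"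
      using R.fixed_boundary[OF f r fp dt t, of False] t by (simp add: comps h_def hb_def ks_def)
  qed
  moreover have "\<phi> (0, x) = \<phi>0 x" if x: "x \<in> {0..L}" for x
  proof -
    have "L - x \<in> {0..L}" using x by auto
    then have "\<phi> (0, x) $ 1 = \<phi>0 x $ 1" "\<phi> (0, x) $ 2 = \<phi>0 x $ 2"
      using x R.admD(4)[OF f, of 0] by (simp_all add: comps f0_def)
    then show ?thesis by (simp add: vec_eq_iff forall_2)
  qed
  moreover have "\<bar>\<phi> z $ i\<bar> \<le> M" for z i
    using R.admD(2)[OF f] exhaust_2[of i] by (cases z) (auto simp: comps)
  ultimately show ?thesis unfolding ibvp_solution_def by blast
qed

section \<open>Choice of the constants and conclusion\<close>

lemma sup_norm_le_iff: "sup_norm S f \<le> ereal c \<longleftrightarrow> (\<forall>p\<in>S. \<bar>f p\<bar> \<le> c)"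
  by (simp add: sup_norm_def SUP_le_iff)

lemma MAX_UNIV_le_iff:
  fixes g :: "2 \<Rightarrow> ereal" shows "(MAX i\<in>UNIV. g i) \<le> c \<longleftrightarrow> (\<forall>i. g i \<le> c)"
  by (subst Max_le_iff) auto

lemma partial_x_component:
  fixes \<phi> :: "real \<times> real \<Rightarrow> real^2"
  assumes "C1_D L \<phi>" "0 < L" "0 \<le> t" "x \<in> {0..L}"
  shows "partial_x L (\<lambda>p. \<phi> p $ i) (t, x) = partial_x L \<phi> (t, x) $ i"
  using C1_D_DERIV_x[OF assms(1,3,4), of i] vector_derivative_within[OF at_within_Icc_nontrivial[OF assms(4,2)]]
  by (simp add: partial_x_def[of L "\<lambda>p. \<phi> p $ i"] has_real_derivative_iff_has_vector_derivative)

lemma char_speed_bounds: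
  assumes \<gamma>: "\<gamma> > 1" and v: "\<And>i. \<bar>v $ i\<bar> \<le> d"
  shows "\<bar>char_speed \<gamma> i (v + bg_state \<gamma> \<rho>)\<bar> \<le> \<bar>sound \<gamma> \<rho>\<bar> + char_spread \<gamma> * d"
    and "sound \<gamma> \<rho> - char_spread \<gamma> * d \<le> - char_speed \<gamma> 1 (v + bg_state \<gamma> \<rho>)"
    and "sound \<gamma> \<rho> - char_spread \<gamma> * d \<le> char_speed \<gamma> 2 (v + bg_state \<gamma> \<rho>)"
proof -
  have 1: "\<bar>(\<gamma> + 1) / 2 * v $ 1 + (3 - \<gamma>) / 2 * v $ 2\<bar> \<le> char_spread \<gamma> * d"
    by (rule linear_form_le) (use \<gamma> v in \<open>auto simp: char_spread_def\<close>)
  have 2: "\<bar>(3 - \<gamma>) / 2 * v $ 1 + (\<gamma> + 1) / 2 * v $ 2\<bar> \<le> char_spread \<gamma> * d"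
    by (rule linear_form_le) (use \<gamma> v in \<open>auto simp: char_spread_def\<close>)
  show "sound \<gamma> \<rho> - char_spread \<gamma> * d \<le> - char_speed \<gamma> 1 (v + bg_state \<gamma> \<rho>)"
    using 1 unfolding char_speed_bg[OF \<gamma>] by linarith
  show "sound \<gamma> \<rho> - char_spread \<gamma> * d \<le> char_speed \<gamma> 2 (v + bg_state \<gamma> \<rho>)"
    using 2 unfolding char_speed_bg[OF \<gamma>] by linarith
  have "i = 1 \<or> i = 2" by (rule exhaust_2)
  then show "\<bar>char_speed \<gamma> i (v + bg_state \<gamma> \<rho>)\<bar> \<le> \<bar>sound \<gamma> \<rho>\<bar> + char_spread \<gamma> * d"
  proof
    assume i: "i = 1"
    show ?thesis using 1 unfolding i char_speed_bg[OF \<gamma>] by linarith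
  next
    assume i: "i = 2"
    show ?thesis using 2 unfolding i char_speed_bg[OF \<gamma>] by linarith
  qed
qed

text \<open>Boundedness makes the real-valued supremum a genuine upper bound; its value at the
  background state, \<open>0 \<in> \<Psi>\<close>, then bounds it from below.\<close>

lemma travel_time_pos:
  assumes "0 < L" and \<Psi>: "admissible_nbhd \<gamma> \<rho> \<Psi>"
  shows "0 < travel_time \<gamma> \<rho> L \<Psi>"
proof -
  have 0: "0 \<in> \<Psi>" using \<Psi> interior_subset by (auto simp: admissible_nbhd_def)
  let ?s = "\<lambda>v. \<bar>char_speed \<gamma> 1 (v + bg_state \<gamma> \<rho>)\<bar>"
  have "bdd_above ((\<lambda>v. 1 / ?s v) ` \<Psi>)" 
    using \<Psi>[unfolded admissible_nbhd_def, THEN conjunct2, THEN conjunct2, THEN spec, of 1] .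
  then obtain K where K: "\<And>v. v \<in> \<Psi> \<Longrightarrow> 1 / ?s v \<le> K" unfolding bdd_above_def by blast
  have "bdd_above ((\<lambda>v. L / ?s v) ` \<Psi>)"
  proof (rule bdd_aboveI2)
    fix v assume "v \<in> \<Psi>"
    from mult_left_mono[OF K[OF this], of L] show "L / ?s v \<le> L * K" using assms(1) by simp
  qed
  then have "L / ?s 0 \<le> (SUP v\<in>\<Psi>. L / ?s v)" by (rule cSUP_upper[OF 0])
  moreover have "0 < L / ?s 0"
  proof -
    have "char_speed \<gamma> 1 (0 + bg_state \<gamma> \<rho>) < 0" using \<Psi> 0 unfolding admissible_nbhd_def by blast
    then show ?thesis using assms(1) by (intro divide_pos_pos) auto
  qed
  moreover have "(SUP v\<in>\<Psi>. L / ?s v) \<le> travel_time \<gamma> \<rho> L \<Psi>"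
    unfolding travel_time_def by (rule Max_ge) auto
  ultimately show ?thesis by linarith
qed

text \<open>Supplies the smallness thresholds for \<open>M\<close>; the witness divides by
  \<open>c + 1\<close> to cover \<open>c = 0\<close>.\<close>

lemma small_multiple:
  fixes c d :: real
  assumes "0 \<le> c" "0 < d" shows "\<exists>\<delta>>0. \<forall>M. 0 < M \<and> M \<le> \<delta> \<longrightarrow> c * M < d"
proof (intro exI[of _ "d / (c + 1)"] conjI allI impI)
  show "0 < d / (c + 1)" using assms by simp
  fix M assume M: "0 < M \<and> M \<le> d / (c + 1)"
  then have "(c + 1) * M \<le> d" using assms by (simp add: pos_le_divide_eq mult.commute)
  then show "c * M < d" using M by (simp add: algebra_simps)
qed

theorem theorem2p2:
  fixes \<gamma> \<rho> L T \<beta>s \<kappa>1 \<kappa>2 \<epsilon>1 C\<^sub>E :: real and \<Psi> :: "(real^2) set"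
  assumes "\<gamma> > 1" and "\<rho> > 0" and "L > 0" and "T > 0" and "\<beta>s < 0"
    and "\<bar>\<kappa>1\<bar> < 1" and "\<bar>\<kappa>2\<bar> < 1"
    and "admissible_nbhd \<gamma> \<rho> \<Psi>"
    and "\<epsilon>1 > 0" and "C\<^sub>E > 0"
    and "periodic_existence \<gamma> \<rho> L T \<beta>s \<kappa>1 \<kappa>2 \<epsilon>1 C\<^sub>E"
  shows "\<exists>\<epsilon>2 C\<^sub>S \<xi>. 0 < \<epsilon>2 \<and> \<epsilon>2 < \<epsilon>1 \<and> 0 < C\<^sub>S \<and> 0 < \<xi> \<and> \<xi> < 1 \<and>
    (\<forall>\<epsilon> \<beta> \<phi>1b \<phi>2b \<phi>0.
       0 < \<epsilon> \<and> \<epsilon> < \<epsilon>2 \<and>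
       admissible_damping L T \<beta>s \<epsilon> \<beta> \<and>
       C1_on {0..} \<phi>1b \<and> (\<forall>t>0. \<phi>1b (t + T) = \<phi>1b t) \<and> C1_norm {0..} \<phi>1b \<le> ereal \<epsilon> \<and>
       C1_on {0..} \<phi>2b \<and> (\<forall>t>0. \<phi>2b (t + T) = \<phi>2b t) \<and> C1_norm {0..} \<phi>2b \<le> ereal \<epsilon> \<and>
       C1_on {0..L} \<phi>0 \<and> C1_norm_vec {0..L} \<phi>0 \<le> ereal (C\<^sub>E * \<epsilon>) \<and>
       compatible \<gamma> \<rho> L \<kappa>1 \<kappa>2 \<beta> \<phi>1b \<phi>2b \<phi>0
       \<longrightarrow>
       (\<exists>\<phi>. ibvp_solution \<gamma> \<rho> L \<kappa>1 \<kappa>2 \<beta> \<phi>1b \<phi>2b \<phi>0 \<phi> \<and>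
            (\<forall>\<psi>. ibvp_solution \<gamma> \<rho> L \<kappa>1 \<kappa>2 \<beta> \<phi>1b \<phi>2b \<phi>0 \<psi> \<longrightarrow> (\<forall>p\<in>dom_D L. \<psi> p = \<phi> p)) \<and>
            (\<forall>\<phi>T. periodic_solution \<gamma> \<rho> L T \<kappa>1 \<kappa>2 C\<^sub>E \<epsilon> \<beta> \<phi>1b \<phi>2b \<phi>T \<longrightarrow>
               (\<forall>t\<ge>0. C0_norm_vec {0..L} (\<lambda>x. \<phi> (t, x) - \<phi>T (t, x))
                       \<le> ereal (C\<^sub>S * \<epsilon> * \<xi> ^ nat \<lfloor>t / travel_time \<gamma> \<rho> L \<Psi>\<rfloor>)))))"
proof -
  note \<gamma> = assms(1) and \<rho> = assms(2) and L = assms(3) and CE = assms(10)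
  define c0 P B where "c0 = sound \<gamma> \<rho>" and "P = char_spread \<gamma>" and "B = - \<beta>s / 2"
  have c0: "0 < c0" unfolding c0_def by (rule sound_pos[OF \<gamma> \<rho>])
  have P: "0 \<le> P" using \<gamma> by (simp add: P_def char_spread_def)
  have B: "0 < B" using assms(5) by (simp add: B_def)
  define \<Gamma> where "\<Gamma> = 2 / c0 * B"
  define Ca where "Ca = 4 / c0\<^sup>2 * P"
  define C3 where "C3 = 2 * (Ca * B + 2 / c0)"
  define D where "D = 9 * L * Ca + (C3 + (3 * \<Gamma> + C3) * (10 * L * Ca)) / \<Gamma>"
  have \<Gamma>: "0 < \<Gamma>" using c0 B by (simp add: \<Gamma>_def)
  have Ca: "0 \<le> Ca" using c0 P by (simp add: Ca_def)
  have C3: "0 \<le> C3" using Ca B c0 by (simp add: C3_def)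
  have D: "0 \<le> D" using \<Gamma> Ca C3 L unfolding D_def by simp
  \<comment> \<open>The gap between \<kappa> and \<kappa>' absorbs the boundary data and the
    correction \<open>W\<close>; as a midpoint \<kappa>' is also positive when there is no
    reflection.\<close>
  define \<kappa> \<kappa>' where "\<kappa> = max \<bar>\<kappa>1\<bar> \<bar>\<kappa>2\<bar>" and "\<kappa>' = (1 + \<kappa>) / 2"
  have \<kappa>: "\<bar>\<kappa>1\<bar> \<le> \<kappa>" "\<bar>\<kappa>2\<bar> \<le> \<kappa>" "\<kappa> < \<kappa>'" "0 < \<kappa>'" "\<kappa>' < 1"
    using assms(6,7) unfolding \<kappa>_def \<kappa>'_def by auto
  \<comment> \<open>\<open>c0 / 2\<close> bounds both speeds from below once
    \<open>2 * P * M < c0\<close>; \<open>m\<close> is the smallest exponent with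
    \<open>B + 1 \<le> s0 * m\<close>.\<close>
  define s0 m where "s0 = c0 / 2" and "m = (B + 1) / s0"
  have s0: "0 < s0" and m: "0 \<le> m" "B + 1 \<le> s0 * m" using c0 B by (auto simp: s0_def m_def)
  \<comment> \<open>\<open>1 - \<zeta>\<close> is the largest value of the weight in the comparison
    principle, attained at the outflow end.\<close>
  define \<zeta> where "\<zeta> = (1 - \<kappa>') * exp (- m * L)"
  have \<zeta>: "0 < \<zeta>" using \<kappa> by (simp add: \<zeta>_def)
  \<comment> \<open>\<open>K0 * \<epsilon>\<close> will be \<open>\<epsilon>0\<close>: the summand 1
    covers the boundary data, the other one the initial rates with their factor
    \<open>exp (\<Gamma> * L)\<close>, the speeds being at most \<open>2 * c0\<close>.\<close>
  define K0 where "K0 = 1 + exp (\<Gamma> * L) * ((2 * c0 + 2 * B) * C\<^sub>E)"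
  have K0: "1 \<le> K0" using c0 B CE by (simp add: K0_def)
  \<comment> \<open>With \<open>M = K * \<epsilon>\<close>, the first two summands leave room for
    initial datum plus \<open>\<epsilon>0\<close>; the last makes
    \<open>(\<kappa>' - \<kappa>) * M\<close> cover the data in the boundary values.\<close>
  define K where "K = C\<^sub>E + K0 + (2 + 2 / c0 * L) * K0 / (\<kappa>' - \<kappa>)"
  have K_rest: "0 \<le> (2 + 2 / c0 * L) * K0 / (\<kappa>' - \<kappa>)" using c0 L K0 \<kappa>(3) by simp
  have K: "1 \<le> K" "C\<^sub>E + K0 \<le> K" "C\<^sub>E \<le> K" using K_rest K0 CE by (auto simp: K_def)
  have "(\<kappa>' - \<kappa>) * ((2 + 2 / c0 * L) * K0 / (\<kappa>' - \<kappa>)) \<le> (\<kappa>' - \<kappa>) * K"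
    using \<kappa>(3) K0 CE by (intro mult_left_mono) (auto simp: K_def)
  then have K_V: "(2 + 2 / c0 * L) * K0 \<le> (\<kappa>' - \<kappa>) * K" using \<kappa>(3) by simp
  obtain \<delta>1 where \<delta>1: "0 < \<delta>1" "\<And>M. 0 < M \<Longrightarrow> M \<le> \<delta>1 \<Longrightarrow> 2 * P * M < c0"
    using small_multiple[of "2 * P" c0] P c0 by auto
  obtain \<delta>2 where \<delta>2: "0 < \<delta>2" "\<And>M. 0 < M \<Longrightarrow> M \<le> \<delta>2 \<Longrightarrow> 4 * Ca * L * M < 1"
    using small_multiple[of "4 * Ca * L" 1] Ca L by auto
  obtain \<delta>3 where \<delta>3: "0 < \<delta>3" "\<And>M. 0 < M \<Longrightarrow> M \<le> \<delta>3 \<Longrightarrow> D * M < (1 - \<kappa>') * exp (- \<Gamma> * L)"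
    using small_multiple[of D "(1 - \<kappa>') * exp (- \<Gamma> * L)"] D \<kappa> by auto
  obtain \<delta>4 where \<delta>4: "0 < \<delta>4" "\<And>M. 0 < M \<Longrightarrow> M \<le> \<delta>4 \<Longrightarrow> P * M < \<zeta> / 2"
    using small_multiple[of P "\<zeta> / 2"] P \<zeta> by auto
  define \<delta> where "\<delta> = min 1 (min (min \<delta>1 \<delta>2) (min \<delta>3 \<delta>4))"
  have \<delta>: "0 < \<delta>" "\<delta> \<le> 1" "\<delta> \<le> \<delta>1" "\<delta> \<le> \<delta>2" "\<delta> \<le> \<delta>3" "\<delta> \<le> \<delta>4"
    using \<delta>1 \<delta>2 \<delta>3 \<delta>4 by (auto simp: \<delta>_def)
  define \<epsilon>2 where "\<epsilon>2 = min (\<epsilon>1 / 2) (\<delta> / K)"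
  \<comment> \<open>The threshold \<delta>4 keeps the slope term of the periodic solution below half
    of \<zeta>; a quarter is spent on decay, so the required inequality stays strict.\<close>
  define \<omega> where "\<omega> = \<zeta> / 4"
  define T0 where "T0 = travel_time \<gamma> \<rho> L \<Psi>"
  have T0: "0 < T0" unfolding T0_def by (rule travel_time_pos[OF L assms(8)])
  define \<xi> where "\<xi> = exp (- \<omega> * T0)"
  \<comment> \<open>The initial distance to the periodic solution is at most
    \<open>2 * (C\<^sub>E * \<epsilon>)\<close>, and the comparison principle divides by
    \<kappa>'.\<close>
  define CS where "CS = 2 * C\<^sub>E / \<kappa>'"
  have \<epsilon>2: "0 < \<epsilon>2" "\<epsilon>2 < \<epsilon>1" using assms(9) \<delta> K by (auto simp: \<epsilon>2_def)
  have CS: "0 < CS" using CE \<kappa> by (simp add: CS_def)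
  have \<xi>: "0 < \<xi>" "\<xi> < 1" using \<zeta> T0 by (auto simp: \<xi>_def \<omega>_def)
  have main: "\<exists>\<phi>. ibvp_solution \<gamma> \<rho> L \<kappa>1 \<kappa>2 \<beta> \<phi>1b \<phi>2b \<phi>0 \<phi> \<and>
      (\<forall>\<psi>. ibvp_solution \<gamma> \<rho> L \<kappa>1 \<kappa>2 \<beta> \<phi>1b \<phi>2b \<phi>0 \<psi> \<longrightarrow> (\<forall>p\<in>dom_D L. \<psi> p = \<phi> p)) \<and>
      (\<forall>\<phi>T. periodic_solution \<gamma> \<rho> L T \<kappa>1 \<kappa>2 C\<^sub>E \<epsilon> \<beta> \<phi>1b \<phi>2b \<phi>T \<longrightarrow>
         (\<forall>t\<ge>0. C0_norm_vec {0..L} (\<lambda>x. \<phi> (t, x) - \<phi>T (t, x)) \<le> ereal (CS * \<epsilon> * \<xi> ^ nat \<lfloor>t / T0\<rfloor>)))"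
    if \<epsilon>: "0 < \<epsilon>" "\<epsilon> < \<epsilon>2" and damp: "admissible_damping L T \<beta>s \<epsilon> \<beta>"
      and b1: "C1_on {0..} \<phi>1b" "C1_norm {0..} \<phi>1b \<le> ereal \<epsilon>"
      and b2: "C1_on {0..} \<phi>2b" "C1_norm {0..} \<phi>2b \<le> ereal \<epsilon>"
      and \<phi>0: "C1_on {0..L} \<phi>0" "C1_norm_vec {0..L} \<phi>0 \<le> ereal (C\<^sub>E * \<epsilon>)"
      and comp: "compatible \<gamma> \<rho> L \<kappa>1 \<kappa>2 \<beta> \<phi>1b \<phi>2b \<phi>0" for \<epsilon> \<beta> \<phi>1b \<phi>2b \<phi>0
  proof -
    define M \<epsilon>0 where "M = K * \<epsilon>" and "\<epsilon>0 = K0 * \<epsilon>"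
    have M0: "0 < M" using \<epsilon> K by (simp add: M_def)
    have "\<epsilon> * K \<le> \<delta>" using \<epsilon>(2) K \<delta> unfolding \<epsilon>2_def by (simp add: pos_less_divide_eq)
    then have M\<delta>: "M \<le> \<delta>" by (simp add: M_def mult.commute)
    have \<epsilon>M: "\<epsilon> \<le> M" "C\<^sub>E * \<epsilon> \<le> M" using K \<epsilon> by (auto simp: M_def mult_right_mono)
    have CE\<epsilon>: "0 < C\<^sub>E * \<epsilon>" using CE \<epsilon> by simp
    have \<epsilon>\<epsilon>0: "\<epsilon> \<le> \<epsilon>0" using K0 \<epsilon> by (simp add: \<epsilon>0_def)
    have \<beta>: "C1_D L \<beta>"
      "\<And>t x. 0 \<le> t \<Longrightarrow> x \<in> {0..L} \<Longrightarrow> - 2 * B \<le> \<beta> (t, x) \<and> \<beta> (t, x) \<le> 0 \<and> \<bar>partial_t \<beta> (t, x)\<bar> \<le> \<epsilon>"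
      using damp by (auto simp: admissible_damping_def C2_D_def dom_D_def B_def)
    have bd: "\<bar>g t\<bar> \<le> \<epsilon>0 \<and> \<bar>vector_derivative g (at t within {0..})\<bar> \<le> \<epsilon>0"
      if "C1_norm {0..} g \<le> ereal \<epsilon>" "0 \<le> t" for g t
      using that \<epsilon>\<epsilon>0 by (auto simp: C1_norm_def sup_norm_le_iff intro: order_trans)
    have \<phi>0b: "\<bar>\<phi>0 x $ i\<bar> \<le> C\<^sub>E * \<epsilon>" "\<bar>vector_derivative (\<lambda>x. \<phi>0 x $ i) (at x within {0..L})\<bar> \<le> C\<^sub>E * \<epsilon>"
      if "x \<in> {0..L}" for x i
      using \<phi>0(2) that by (auto simp: C1_norm_vec_def MAX_UNIV_le_iff C1_norm_def sup_norm_le_iff simp del: atLeastAtMost_iff)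
    have PM: "2 * P * M < c0" using \<delta>1(2)[OF M0] M\<delta> \<delta> by linarith
    have rate: "exp (\<Gamma> * L) * \<bar>init_rate \<gamma> \<rho> L \<beta> \<phi>0 i x\<bar> \<le> \<epsilon>0" if x: "x \<in> {0..L}" for i x
    proof -
      have "P * (C\<^sub>E * \<epsilon>) \<le> P * M" using \<epsilon>M P by (intro mult_left_mono) auto
      then have "\<bar>char_speed \<gamma> i (\<phi>0 x + bg_state \<gamma> \<rho>)\<bar> \<le> 2 * c0"
        using char_speed_bounds(1)[OF \<gamma> \<phi>0b(1)[OF x], of i \<rho>] PM P c0
        unfolding c0_def[symmetric] P_def[symmetric] by (simp add: mult.assoc)
      then have 1: "\<bar>char_speed \<gamma> i (\<phi>0 x + bg_state \<gamma> \<rho>) * vector_derivative (\<lambda>y. \<phi>0 y $ i) (at x within {0..L})\<bar> \<le> 2 * c0 * (C\<^sub>E * \<epsilon>)"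
        by (rule abs_mult_le) (rule \<phi>0b(2)[OF x])
      have 2: "\<bar>\<beta> (0, x) / 2 * (\<phi>0 x $ 1 + \<phi>0 x $ 2)\<bar> \<le> B * (2 * (C\<^sub>E * \<epsilon>))"
      proof (rule abs_mult_le)
        show "\<bar>\<beta> (0, x) / 2\<bar> \<le> B" using \<beta>(2)[of 0 x] x by auto
        show "\<bar>\<phi>0 x $ 1 + \<phi>0 x $ 2\<bar> \<le> 2 * (C\<^sub>E * \<epsilon>)" using \<phi>0b(1)[OF x, of 1] \<phi>0b(1)[OF x, of 2] by linarith
      qed
      have "\<bar>init_rate \<gamma> \<rho> L \<beta> \<phi>0 i x\<bar> \<le> (2 * c0 + 2 * B) * (C\<^sub>E * \<epsilon>)"
        using 1 2 unfolding init_rate_def by (simp add: algebra_simps)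
      then have "exp (\<Gamma> * L) * \<bar>init_rate \<gamma> \<rho> L \<beta> \<phi>0 i x\<bar> \<le> exp (\<Gamma> * L) * ((2 * c0 + 2 * B) * (C\<^sub>E * \<epsilon>))"
        by (rule mult_left_mono) simp
      then show ?thesis using \<epsilon> by (simp add: \<epsilon>0_def K0_def algebra_simps)
    qed
    have "\<exists>\<phi>. ibvp_solution \<gamma> \<rho> L \<kappa>1 \<kappa>2 \<beta> \<phi>1b \<phi>2b \<phi>0 \<phi> \<and> (\<forall>z\<in>dom_D L. \<forall>i. \<bar>\<phi> z $ i\<bar> \<le> M)"
    proof (rule ibvp_exists[of \<gamma> \<rho> L B M \<kappa>1 \<kappa> \<kappa>2 \<kappa>' \<beta> \<phi>1b \<epsilon>0 \<phi>2b \<phi>0,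
        folded c0_def P_def, folded \<Gamma>_def Ca_def, folded C3_def, folded D_def])
      show "\<bar>\<phi>0 x $ i\<bar> + \<epsilon>0 \<le> M" if "x \<in> {0..L}" for x i
      proof -
        have "C\<^sub>E * \<epsilon> + \<epsilon>0 \<le> M"
          using mult_right_mono[OF K(2), of \<epsilon>] \<epsilon> by (simp add: M_def \<epsilon>0_def algebra_simps)
        then show ?thesis using \<phi>0b(1)[OF that, of i] by linarith
      qed
      have "(2 + 2 / c0 * L) * K0 * \<epsilon> \<le> (\<kappa>' - \<kappa>) * K * \<epsilon>" using K_V \<epsilon> by (intro mult_right_mono) auto
      then show "\<kappa> * M + 2 * \<epsilon>0 + 2 / c0 * L * \<epsilon>0 \<le> \<kappa>' * M" by (simp add: M_def \<epsilon>0_def algebra_simps)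
      show "4 * (Ca * M * L) \<le> 1" using \<delta>2(2)[OF M0] M\<delta> \<delta> by (simp add: mult_ac)
      show "D * M < (1 - \<kappa>') * exp (- \<Gamma> * L)" by (rule \<delta>3(2)[OF M0]) (use M\<delta> \<delta> in linarith)
      show "2 * (P * M) \<le> c0" using PM by (simp add: mult.assoc)
      show "M \<le> 1" using M\<delta> \<delta> by linarith
      show "\<bar>partial_t \<beta> (t, x)\<bar> \<le> M" if "0 \<le> t" "x \<in> {0..L}" for t x
        using \<beta>(2)[OF that] \<epsilon>M by linarith
      show "- 2 * B \<le> \<beta> (t, x) \<and> \<beta> (t, x) \<le> 0" if "0 \<le> t" "x \<in> {0..L}" for t x
        using \<beta>(2)[OF that] by blast
    qed (fact \<gamma> \<rho> L B M0 \<beta>(1) b1(1) b2(1) \<phi>0(1) comp rate \<kappa>(1,2,5) bd[OF b1(2)] bd[OF b2(2)] less_imp_le[OF \<kappa>(3)])+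
    then obtain \<phi> where \<phi>: "ibvp_solution \<gamma> \<rho> L \<kappa>1 \<kappa>2 \<beta> \<phi>1b \<phi>2b \<phi>0 \<phi>" "\<And>z i. z \<in> dom_D L \<Longrightarrow> \<bar>\<phi> z $ i\<bar> \<le> M"
      by blast
    have \<phi>b: "bvp_solution \<gamma> \<rho> L \<kappa>1 \<kappa>2 \<beta> \<phi>1b \<phi>2b \<phi>" and \<phi>i: "\<And>x. x \<in> {0..L} \<Longrightarrow> \<phi> (0, x) = \<phi>0 x"
      using \<phi>(1) by (auto simp: ibvp_solution_def)
    have speed: "s0 \<le> - char_speed \<gamma> 1 (\<phi> (t, x) + bg_state \<gamma> \<rho>) \<and> s0 \<le> char_speed \<gamma> 2 (\<phi> (t, x) + bg_state \<gamma> \<rho>)"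
      if "0 \<le> t" "x \<in> {0..L}" for t x
    proof -
      have "\<bar>\<phi> (t, x) $ i\<bar> \<le> M" for i using \<phi>(2) that by (simp add: dom_D_def)
      from char_speed_bounds(2,3)[OF \<gamma> this, of \<rho>] show ?thesis
        using PM unfolding c0_def[symmetric] P_def[symmetric] s0_def by (auto simp: mult.assoc)
    qed
    note diff = bvp_difference[OF \<gamma> L _ \<phi>b _ s0 speed _ _ _ order_trans[OF \<kappa>(1) less_imp_le[OF \<kappa>(3)]]
        order_trans[OF \<kappa>(2) less_imp_le[OF \<kappa>(3)]] \<kappa>(4,5) _ m, folded P_def \<zeta>_def]
    have unique: "\<psi> p = \<phi> p" if \<psi>: "ibvp_solution \<gamma> \<rho> L \<kappa>1 \<kappa>2 \<beta> \<phi>1b \<phi>2b \<phi>0 \<psi>" and p: "p \<in> dom_D L" for \<psi> p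
    proof -
      obtain t x where tx: "p = (t, x)" "0 \<le> t" "x \<in> {0..L}" using p by (auto simp: dom_D_def)
      have \<psi>b: "bvp_solution \<gamma> \<rho> L \<kappa>1 \<kappa>2 \<beta> \<phi>1b \<phi>2b \<psi>" and \<psi>i: "\<And>x. x \<in> {0..L} \<Longrightarrow> \<psi> (0, x) = \<phi>0 x"
        using \<psi> by (auto simp: ibvp_solution_def)
      \<comment> \<open>A competitor comes without a bound; on the compact time interval up to
        \<open>t\<close> its slope is bounded by continuity.\<close>
      have "continuous_on ({0..t} \<times> {0..L}) (partial_x L \<psi>)"
        using bvp_solutionD(1)[OF \<psi>b] by (auto simp: C1_D_def dom_D_def intro: continuous_on_subset)
      then have "bounded (partial_x L \<psi> ` ({0..t} \<times> {0..L}))"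
        by (intro compact_imp_bounded compact_continuous_image compact_Times compact_Icc)
      then obtain c where c: "0 < c" "\<And>z. z \<in> {0..t} \<times> {0..L} \<Longrightarrow> norm (partial_x L \<psi> z) \<le> c"
        unfolding bounded_pos by auto
      \<comment> \<open>A negative \<omega> of this size outweighs the slope bound \<open>c\<close>.
        The exponential growth it permits is harmless, since the initial distance is 0.\<close>
      have "\<bar>\<phi> (t, x) $ i - \<psi> (t, x) $ i\<bar> \<le> 0 / \<kappa>' * exp (- (- (P * c + 1) / \<kappa>') * t)" for i
      proof (rule diff)
        show "\<bar>partial_x L \<psi> (u, y) $ i\<bar> \<le> c" if "u \<in> {0..t}" "y \<in> {0..L}" for u y i
          using component_le_norm_cart[of "partial_x L \<psi> (u, y)" i] c(2)[of "(u, y)"] that by auto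
        show "P * c < (1 - y) - (- (P * c + 1) / \<kappa>') * y" if y: "\<kappa>' \<le> y" "y \<le> 1 - \<zeta>" for y
        proof -
          have Pc: "0 \<le> P * c" using P c by simp
          have "(P * c + 1) / \<kappa>' * \<kappa>' \<le> (P * c + 1) / \<kappa>' * y"
            using y Pc \<kappa> by (intro mult_left_mono) auto
          then have "P * c + 1 \<le> (P * c + 1) / \<kappa>' * y" using \<kappa> by simp
          moreover have "- (- (P * c + 1) / \<kappa>') * y = (P * c + 1) / \<kappa>' * y" 
            by (simp only: minus_divide_left[symmetric] minus_minus)
          ultimately show ?thesis using y \<zeta> by linarith
        qed
      qed (use tx \<beta>(2) c \<psi>b \<phi>i \<psi>i in auto)
      then have "\<phi> (t, x) $ i = \<psi> (t, x) $ i" for i by simp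
      then show ?thesis using tx by (simp add: vec_eq_iff)
    qed
    have decay: "C0_norm_vec {0..L} (\<lambda>x. \<phi> (t, x) - \<phi>T (t, x)) \<le> ereal (CS * \<epsilon> * \<xi> ^ nat \<lfloor>t / T0\<rfloor>)"
      if \<phi>T: "periodic_solution \<gamma> \<rho> L T \<kappa>1 \<kappa>2 C\<^sub>E \<epsilon> \<beta> \<phi>1b \<phi>2b \<phi>T" and t: "0 \<le> t" for \<phi>T t
    proof -
      have Tb: "bvp_solution \<gamma> \<rho> L \<kappa>1 \<kappa>2 \<beta> \<phi>1b \<phi>2b \<phi>T" and TN: "C1_norm_D L \<phi>T \<le> ereal (C\<^sub>E * \<epsilon>)"
        using \<phi>T by (auto simp: periodic_solution_def)
      have TB: "\<bar>\<phi>T z $ i\<bar> \<le> C\<^sub>E * \<epsilon>" "\<bar>partial_x L (\<lambda>p. \<phi>T p $ i) z\<bar> \<le> C\<^sub>E * \<epsilon>" if "z \<in> dom_D L" for z i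
        using TN that by (auto simp: C1_norm_D_def MAX_UNIV_le_iff sup_norm_le_iff)
      have est: "\<bar>\<phi> (t, x) $ i - \<phi>T (t, x) $ i\<bar> \<le> 2 * (C\<^sub>E * \<epsilon>) / \<kappa>' * exp (- \<omega> * t)" if x: "x \<in> {0..L}" for x i
      proof (rule diff)
        show "\<bar>partial_x L \<phi>T (u, y) $ i\<bar> \<le> C\<^sub>E * \<epsilon>" if "u \<in> {0..t}" "y \<in> {0..L}" for u y i
          using TB(2)[of "(u, y)" i] partial_x_component[OF bvp_solutionD(1)[OF Tb] L, of u y i] that by (auto simp: dom_D_def)
        show "\<bar>\<phi> (0, y) $ i - \<phi>T (0, y) $ i\<bar> \<le> 2 * (C\<^sub>E * \<epsilon>)" if "y \<in> {0..L}" for y i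
          using TB(1)[of "(0, y)" i] \<phi>0b(1)[OF that, of i] \<phi>i[OF that] that by (auto simp: dom_D_def)
        show "P * (C\<^sub>E * \<epsilon>) < (1 - y) - \<omega> * y" if y: "\<kappa>' \<le> y" "y \<le> 1 - \<zeta>" for y
        proof -
          have "P * (C\<^sub>E * \<epsilon>) \<le> P * M" using P \<epsilon>M by (intro mult_left_mono) auto
          moreover have "P * M < \<zeta> / 2" by (rule \<delta>4(2)[OF M0]) (use M\<delta> \<delta> in linarith)
          moreover have "\<omega> * y \<le> \<omega> * 1" using y \<zeta> by (intro mult_left_mono) (auto simp: \<omega>_def)
          ultimately show ?thesis using y \<zeta> unfolding \<omega>_def by linarith
        qed
      qed (use t x \<beta>(2) CE\<epsilon> Tb in auto)
      \<comment> \<open>Rounding \<open>t / T0\<close> down can only weaken the exponential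
        bound.\<close>
      have "exp (- \<omega> * t) \<le> \<xi> ^ nat \<lfloor>t / T0\<rfloor>"
      proof -
        have "real (nat \<lfloor>t / T0\<rfloor>) \<le> t / T0" using t T0 by simp
        then have "T0 * real (nat \<lfloor>t / T0\<rfloor>) \<le> t" using T0 by (simp add: pos_le_divide_eq mult.commute)
        then have "\<omega> * (T0 * real (nat \<lfloor>t / T0\<rfloor>)) \<le> \<omega> * t" using \<zeta> by (intro mult_left_mono) (auto simp: \<omega>_def)
        moreover have "\<xi> ^ nat \<lfloor>t / T0\<rfloor> = exp (- (\<omega> * (T0 * real (nat \<lfloor>t / T0\<rfloor>))))"
          unfolding \<xi>_def exp_of_nat_mult[symmetric] by (simp add: mult_ac)
        ultimately show ?thesis by simp
      qed
      then have "CS * \<epsilon> * exp (- \<omega> * t) \<le> CS * \<epsilon> * \<xi> ^ nat \<lfloor>t / T0\<rfloor>"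
        using \<epsilon> CE \<kappa> by (intro mult_left_mono) (auto simp: CS_def)
      then have "\<bar>(\<phi> (t, x) - \<phi>T (t, x)) $ i\<bar> \<le> CS * \<epsilon> * \<xi> ^ nat \<lfloor>t / T0\<rfloor>" if "x \<in> {0..L}" for x i
        using est[OF that, of i] by (simp add: CS_def)
      then show ?thesis
        by (simp add: C0_norm_vec_def MAX_UNIV_le_iff sup_norm_le_iff del: atLeastAtMost_iff)
    qed
    show ?thesis using \<phi>(1) unique decay by blast
  qed
  show ?thesis
    unfolding T0_def[symmetric]
    by (intro exI[of _ \<epsilon>2] exI[of _ CS] exI[of _ \<xi>] conjI \<epsilon>2 CS \<xi> allI impI, elim conjE, rule main)
      assumption+
qed

end
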